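(* Let $\mathcal{F}\subset\partial_P\Omega$ be the collection of all non-singleton prime ends of $\Omega$ together with all rectifiably inaccessible singleton prime ends of $\Omega$, i.e. $\mathcal{F}=\partial_P\Omega\setminus\partial_{RSP}\Omega$. Then $\overline{C}^P_p(\mathcal{F})=0$.
   Context: Standing assumptions: $1<p<\infty$; $(X,d,\mu)$ is a complete metric measure space, $\mu$ is a doubling Radon measure ($0<\mu(B(x,2r))\le C\mu(B(x,r))<\infty$), and $X$ supports a $p$-Poincaré inequality; consequently $X$ is proper and quasiconvex (any two points are joined by a rectifiable curve of length at most a constant times their distance), so every domain in $X$ is rectifiably connected. $\Omega\subsetneq X$ is a bounded domain with $C_p(X\setminus\Omega)>0$, satisfying the following assumption: every collection of ends of $\Omega$ that is totally ordered by division has a lower bound, i.e. there is an end dividing every member of the collection. Prime ends: The Mazurkiewicz metric on $\Omega$ is $d_M(x,y)=\inf\operatorname{diam}(E)$, the infimum over compact connected $E\subset\Omega$ containing $x,y$; $\operatorname{dist}_M(A,K)=\inf\{d_M(x,y):x\in A,y\in K\}$. An acceptable set is a connected set $E\subsetneq\Omega$ with $\overline E\cap\partial\Omega\neq\emptyset$. A chain is a sequence $\{E_k\}_{k\ge1}$ of acceptable sets with $E_{k+1}\subset E_k$, $\operatorname{dist}_M(\Omega\cap\partial E_{k+1},\Omega\cap\partial E_k)>0$ for all $k$, and impression $\bigcap_k\overline{E_k}\subset\partial\Omega$. A chain $\{E_k\}$ divides $\{F_k\}$ if for each $k$ there is $l_k$ with $E_{l_k}\subset F_k$; two chains are equivalent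 if each divides the other; an end $[E_k]$ is an equivalence class, and its impression $I[E_k]$ is the impression of any representative. Division induces a partial order on ends; a prime end is an end not divisible by any other end. $\partial_P\Omega$ is the set of prime ends, $\partial_{SP}\Omega$ the set of prime ends with singleton impression, and $\overline\Omega^P=\Omega\cup\partial_P\Omega$. A sequence $(x_n)$ in $\Omega$ converges to $[E_k]$ if for every $k$, $x_n\in E_k$ for all sufficiently large $n$. The prime end topology on $\overline\Omega^P$ has basis $\{G,G^P: G\subset\Omega\text{ open}\}$, where $G^P=G\cup\{[E_k]\in\partial_P\Omega:E_n\subset G\text{ for some }n\}$; limits $\lim_{\Omega\ni y\to x}$ and $\liminf_{\Omega\ni y\to x}$ for $x\in\partial_P\Omega$ are taken with respect to this topology. Classification: A prime end $[E_k]\in\partial_{SP}\Omega$ is rectifiably accessible if there is a rectifiable curve $\gamma:[0,1]\to X$ with $\gamma([0,1))\subset\Omega$, $\{\gamma(1)\}=I[E_k]$, and for each $k$ some $t_k\in(0,1)$ with $\gamma((t_k,1))\subset E_k$; otherwise it is rectifiably inaccessible. $\partial_{RSP}\Omega$ denotes the set of rectifiably accessible prime ends. Sobolev notions: A nonnegative Borel $g$ is an upper gradient of $u$ on an open set $U$ if $|u(x)-u(y)|\le\int_\gamma g\,ds$ for every nonconstant rectifiable curve $\gamma$ in $U$ with endpoints $x,y$. $N^{1,p}(U)$ is the space of measurable $u$ with $\|u\|_{N^{1,p}(U)}^p=\int_U|u|^p\,d\mu+\inf_g\int_U g^p\,d\mu<\infty$ (infimum over upper gradients in $U$), modulo functions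 of zero norm. The Sobolev capacity of $E\subset X$ is $C_p(E)=\inf\|u\|^p_{N^{1,p}(X)}$ over $u\in N^{1,p}(X)$ with $u\ge1$ on $E$. The prime end capacity of $E\subset\overline\Omega^P$ is $\overline{C}^P_p(E)=\inf\|u\|^p_{N^{1,p}(\Omega)}$ over all $u\in N^{1,p}(\Omega)$ with $u\ge1$ on $E\cap\Omega$ and $\liminf_{\Omega\ni y\to x}u(y)\ge1$ for all $x\in E\cap\partial_P\Omega$. *)

theory Defs
  imports "HOL-Analysis.Analysis"
begin

text \<open>The space X is the whole type 'a (a complete metric space); mu is a Borel
measure on it.  Functions are measured with respect to the completion of mu.\<close>

definition doubling_measure :: "'a::metric_space measure \<Rightarrow> bool" where
  "doubling_measure \<mu> \<longleftrightarrow> sets \<mu> = sets borel \<and>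
     (\<exists>C::real. \<forall>x r. r > 0 \<longrightarrow>
        0 < emeasure \<mu> (ball x (2*r)) \<and>
        emeasure \<mu> (ball x (2*r)) \<le> ennreal C * emeasure \<mu> (ball x r) \<and>
        emeasure \<mu> (ball x r) < \<infinity>)"

definition curve_length :: "(real \<Rightarrow> 'a::metric_space) \<Rightarrow> real \<Rightarrow> real \<Rightarrow> ennreal" where
  "curve_length \<gamma> a b =
     (SUP (n, t) \<in> {(n::nat, t::nat \<Rightarrow> real). t 0 = a \<and> t n = b \<and> (\<forall>i<n. t i \<le> t (Suc i))}.
        (\<Sum>i<n. ennreal (dist (\<gamma> (t i)) (\<gamma> (t (Suc i))))))"

definition rectifiable_curve :: "(real \<Rightarrow> 'a::metric_space) \<Rightarrow> bool" where
  "rectifiable_curve \<gamma> \<longleftrightarrow> continuous_on {0..1} \<gamma> \<and> curve_length \<gamma> 0 1 < \<infinity>"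

definition length_fun :: "(real \<Rightarrow> 'a::metric_space) \<Rightarrow> real \<Rightarrow> real" where
  "length_fun \<gamma> t = enn2real (curve_length \<gamma> 0 (min 1 (max 0 t)))"

definition line_integral :: "(real \<Rightarrow> 'a::metric_space) \<Rightarrow> ('a \<Rightarrow> ennreal) \<Rightarrow> ennreal" where
  "line_integral \<gamma> g = (\<integral>\<^sup>+ t. g (\<gamma> t) * indicator {0..1} t \<partial>interval_measure (length_fun \<gamma>))"

definition upper_gradient :: "'a::metric_space set \<Rightarrow> ('a \<Rightarrow> real) \<Rightarrow> ('a \<Rightarrow> ennreal) \<Rightarrow> bool" where
  "upper_gradient U u g \<longleftrightarrow> g \<in> borel_measurable borel \<and>
     (\<forall>\<gamma>. rectifiable_curve \<gamma> \<and> \<gamma> ` {0..1} \<subseteq> U \<and> (\<exists>s\<in>{0..1}. \<gamma> s \<noteq> \<gamma> 0) \<longrightarrow>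
        ennreal \<bar>u (\<gamma> 0) - u (\<gamma> 1)\<bar> \<le> line_integral \<gamma> g)"

definition epow :: "ennreal \<Rightarrow> real \<Rightarrow> ennreal" where
  "epow a p = (if a = \<infinity> then \<infinity> else ennreal (enn2real a powr p))"

definition N1p_normp :: "real \<Rightarrow> 'a::metric_space measure \<Rightarrow> 'a set \<Rightarrow> ('a \<Rightarrow> real) \<Rightarrow> ennreal" where
  "N1p_normp p \<mu> U u =
     (\<integral>\<^sup>+ x\<in>U. ennreal (\<bar>u x\<bar> powr p) \<partial>completion \<mu>) +
     (INF g\<in>{g. upper_gradient U u g}. \<integral>\<^sup>+ x\<in>U. epow (g x) p \<partial>completion \<mu>)"

definition in_N1p :: "real \<Rightarrow> 'a::metric_space measure \<Rightarrow> 'a set \<Rightarrow> ('a \<Rightarrow> real) \<Rightarrow> bool" where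
  "in_N1p p \<mu> U u \<longleftrightarrow>
     (\<lambda>x. u x * indicator U x) \<in> borel_measurable (completion \<mu>) \<and>
     N1p_normp p \<mu> U u < \<infinity>"

definition sobolev_cap :: "real \<Rightarrow> 'a::metric_space measure \<Rightarrow> 'a set \<Rightarrow> ennreal" where
  "sobolev_cap p \<mu> E = (INF u\<in>{u. in_N1p p \<mu> UNIV u \<and> (\<forall>x\<in>E. u x \<ge> 1)}. N1p_normp p \<mu> UNIV u)"

definition poincare :: "real \<Rightarrow> 'a::metric_space measure \<Rightarrow> bool" where
  "poincare p \<mu> \<longleftrightarrow> (\<exists>C::real. \<exists>lam::real. C > 0 \<and> lam \<ge> 1 \<and>
     (\<forall>x r u g. r > 0 \<longrightarrow> (\<forall>y s. set_integrable (completion \<mu>) (ball y s) u) \<longrightarrow>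
        upper_gradient UNIV u g \<longrightarrow>
        (\<integral>\<^sup>+ y\<in>ball x (lam*r). epow (g y) p \<partial>completion \<mu>) < \<infinity> \<longrightarrow>
        (let uB = (\<integral>y\<in>ball x r. u y \<partial>completion \<mu>) / measure \<mu> (ball x r) in
          (\<integral>y\<in>ball x r. \<bar>u y - uB\<bar> \<partial>completion \<mu>) / measure \<mu> (ball x r)
          \<le> C * r * (enn2real (\<integral>\<^sup>+ y\<in>ball x (lam*r). epow (g y) p \<partial>completion \<mu>)
                        / measure \<mu> (ball x (lam*r))) powr (1/p))))"

definition mazurkiewicz :: "'a::metric_space set \<Rightarrow> 'a \<Rightarrow> 'a \<Rightarrow> real" where
  "mazurkiewicz \<Omega> x y = Inf {diameter E | E. compact E \<and> connected E \<and> E \<subseteq> \<Omega> \<and> x \<in> E \<and> y \<in> E}"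

definition dist_M :: "'a::metric_space set \<Rightarrow> 'a set \<Rightarrow> 'a set \<Rightarrow> real" where
  "dist_M \<Omega> A K = Inf {mazurkiewicz \<Omega> x y | x y. x \<in> A \<and> y \<in> K}"

definition acceptable :: "'a::metric_space set \<Rightarrow> 'a set \<Rightarrow> bool" where
  "acceptable \<Omega> E \<longleftrightarrow> connected E \<and> E \<subset> \<Omega> \<and> closure E \<inter> frontier \<Omega> \<noteq> {}"

definition pe_chain :: "'a::metric_space set \<Rightarrow> (nat \<Rightarrow> 'a set) \<Rightarrow> bool" where
  "pe_chain \<Omega> E \<longleftrightarrow> (\<forall>k. acceptable \<Omega> (E k)) \<and> (\<forall>k. E (Suc k) \<subseteq> E k) \<and>
     (\<forall>k. dist_M \<Omega> (\<Omega> \<inter> frontier (E (Suc k))) (\<Omega> \<inter> frontier (E k)) > 0) \<and>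
     (\<Inter>k. closure (E k)) \<subseteq> frontier \<Omega>"

definition chain_divides :: "(nat \<Rightarrow> 'a set) \<Rightarrow> (nat \<Rightarrow> 'a set) \<Rightarrow> bool" where
  "chain_divides E F \<longleftrightarrow> (\<forall>k. \<exists>l. E l \<subseteq> F k)"

definition chain_equiv :: "(nat \<Rightarrow> 'a set) \<Rightarrow> (nat \<Rightarrow> 'a set) \<Rightarrow> bool" where
  "chain_equiv E F \<longleftrightarrow> chain_divides E F \<and> chain_divides F E"

definition pe_ends :: "'a::metric_space set \<Rightarrow> (nat \<Rightarrow> 'a set) set set" where
  "pe_ends \<Omega> = {{F. pe_chain \<Omega> F \<and> chain_equiv E F} | E. pe_chain \<Omega> E}"

definition end_divides :: "(nat \<Rightarrow> 'a set) set \<Rightarrow> (nat \<Rightarrow> 'a set) set \<Rightarrow> bool" where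
  "end_divides e f \<longleftrightarrow> (\<exists>E\<in>e. \<exists>F\<in>f. chain_divides E F)"

definition impression :: "(nat \<Rightarrow> 'a::topological_space set) set \<Rightarrow> 'a set" where
  "impression e = (\<Inter>k. closure ((SOME E. E \<in> e) k))"

definition prime_ends :: "'a::metric_space set \<Rightarrow> (nat \<Rightarrow> 'a set) set set" where
  "prime_ends \<Omega> = {e \<in> pe_ends \<Omega>. \<forall>f\<in>pe_ends \<Omega>. end_divides f e \<longrightarrow> f = e}"

definition singleton_prime_ends :: "'a::metric_space set \<Rightarrow> (nat \<Rightarrow> 'a set) set set" where
  "singleton_prime_ends \<Omega> = {e \<in> prime_ends \<Omega>. \<exists>x. impression e = {x}}"

definition rect_accessible_prime_ends :: "'a::metric_space set \<Rightarrow> (nat \<Rightarrow> 'a set) set set" where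
  "rect_accessible_prime_ends \<Omega> = {e \<in> singleton_prime_ends \<Omega>.
     \<exists>\<gamma> E. E \<in> e \<and> rectifiable_curve \<gamma> \<and> \<gamma> ` {0..<1} \<subseteq> \<Omega> \<and> impression e = {\<gamma> 1} \<and>
        (\<forall>k. \<exists>t\<in>{0<..<1}. \<gamma> ` {t<..<1} \<subseteq> E k)}"

definition ends_chains_bounded :: "'a::metric_space set \<Rightarrow> bool" where
  "ends_chains_bounded \<Omega> \<longleftrightarrow>
     (\<forall>S. S \<subseteq> pe_ends \<Omega> \<and> S \<noteq> {} \<and> (\<forall>e\<in>S. \<forall>f\<in>S. end_divides e f \<or> end_divides f e) \<longrightarrow>
        (\<exists>g\<in>pe_ends \<Omega>. \<forall>e\<in>S. end_divides g e))"

text \<open>Neighbourhood filter (restricted to Omega) of a prime end in the prime end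
  topology: generated by the open sets G of Omega with E n contained in G for some n.\<close>
definition pe_nhds :: "'a::metric_space set \<Rightarrow> (nat \<Rightarrow> 'a set) set \<Rightarrow> 'a filter" where
  "pe_nhds \<Omega> e = (INF G\<in>{G. open G \<and> G \<subseteq> \<Omega> \<and> (\<exists>E\<in>e. \<exists>n. E n \<subseteq> G)}. principal G)"

definition pe_cap :: "real \<Rightarrow> 'a::metric_space measure \<Rightarrow> 'a set \<Rightarrow> (nat \<Rightarrow> 'a set) set set \<Rightarrow> ennreal" where
  "pe_cap p \<mu> \<Omega> F = (INF u\<in>{u. in_N1p p \<mu> \<Omega> u \<and>
        (\<forall>e\<in>F. Liminf (pe_nhds \<Omega> e) (\<lambda>y. ereal (u y)) \<ge> 1)}. N1p_normp p \<mu> \<Omega> u)"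

end

theory Submission
  imports Defs
begin

text \<open>
  Let \<open>d\<close> be the distance to the complement of \<open>\<Omega>\<close>. Since the boundary strips \<open>{x \<in> \<Omega>. d x < r}\<close>
  have measure tending to 0, there is a weight \<open>h (d x)\<close> in \<open>L\<^sup>p \<Omega>\<close> that blows up at the boundary.
  Let \<open>U x\<close> be the least weighted length of a path in \<open>\<Omega>\<close> from a base point to \<open>x\<close>. The functions
  \<open>min 1 (U / n)\<close> have upper gradient \<open>h (d x) / n\<close> and tend to 0 in \<open>N\<^sup>1\<^sup>p\<close>, so it suffices that
  \<open>U\<close> tends to infinity at every prime end that is not rectifiably accessible. If \<open>U\<close> stays bounded
  along points approaching a prime end \<open>[E k]\<close>, there are curves of bounded length that reach
  \<open>E n\<close> and spend only a short time near the boundary. They need a definite time to pass from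
  \<open>E k\<close> to \<open>E (k + 1)\<close>, so they visit there a fixed compact subset of \<open>\<Omega>\<close>; limits of the visited
  points can be joined to a single rectifiable curve that ends at the prime end. The components of
  \<open>\<Omega>\<close> intersected with small balls around its endpoint form an end dividing \<open>[E k]\<close>, hence equal to it.
\<close>

subsection \<open>Curve length and upper gradients\<close>

text \<open>Curves of bounded length that reach the sets \<open>E n\<close> need not have a useful
  limit: a limit curve may touch the boundary of \<Omega> long before its end. This shapes the
  argument. The blow-up of the weight forces every curve of bounded cost back into a fixed compact
  subset of \<Omega> within any given time; limits are taken only of such points, and between them
  pieces of the original curves, which do lie in \<Omega>, are kept. The weighted distance is an
  infimum over finite chains of points. Adding one step to a chain gives a local Lipschitz bound at
  once, hence continuity and measurability, and quasiconvexity turns each step back into a curve.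
  The same chains, with constant step bound and weight 1, serve to derive quasiconvexity from the
  Poincare inequality.\<close>

declare sum_ennreal [simp del]

lemma curve_length_partition:
  assumes "t 0 = a" "t n = b" "\<And>i. i < n \<Longrightarrow> t i \<le> t (Suc i)"
  shows "(\<Sum>i<n. ennreal (dist (\<gamma> (t i)) (\<gamma> (t (Suc i))))) \<le> curve_length \<gamma> a b"
  unfolding curve_length_def
  by (rule SUP_upper2[of "(n, t)"]) (use assms in auto)

lemma curve_length_leI:
  assumes "\<And>n t. t 0 = a \<Longrightarrow> t n = b \<Longrightarrow> (\<And>i. i < n \<Longrightarrow> t i \<le> t (Suc i)) \<Longrightarrow>
     (\<Sum>i<n. ennreal (dist (\<gamma> (t i)) (\<gamma> (t (Suc i))))) \<le> B"
  shows "curve_length \<gamma> a b \<le> B"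
  unfolding curve_length_def by (rule SUP_least) (use assms in auto)

lemma partition_mono:
  fixes t :: "nat \<Rightarrow> real"
  assumes "\<And>i. i < n \<Longrightarrow> t i \<le> t (Suc i)" "i \<le> j" "j \<le> n"
  shows "t i \<le> t j"
  using assms(2,3)
proof (induction j rule: dec_induct)
  case (step m)
  then show ?case using assms(1)[of m] by simp
qed simp

lemma curve_length_cons:
  assumes "a \<le> c" "c \<le> b"
  shows "ennreal (dist (\<gamma> a) (\<gamma> c)) + curve_length \<gamma> c b \<le> curve_length \<gamma> a b"
proof -
  let ?P = "{(n::nat, t::nat \<Rightarrow> real). t 0 = c \<and> t n = b \<and> (\<forall>i<n. t i \<le> t (Suc i))}"
  have "(1, \<lambda>i. if i = 0 then c else b) \<in> ?P"
    using assms by auto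
  then have ne: "?P \<noteq> {}" by blast
  show ?thesis
    unfolding curve_length_def[of \<gamma> c b]
    unfolding ennreal_SUP_add_right[OF ne]
  proof (rule SUP_least, clarify)
    fix n :: nat and t :: "nat \<Rightarrow> real"
    assume t: "c = t 0" "b = t n" "\<forall>i<n. t i \<le> t (Suc i)"
    define s where "s = case_nat a t"
    have "(\<Sum>i<Suc n. ennreal (dist (\<gamma> (s i)) (\<gamma> (s (Suc i))))) \<le> curve_length \<gamma> a b"
    proof (rule curve_length_partition)
      show "s i \<le> s (Suc i)" if "i < Suc n" for i
        using that t assms by (cases i) (auto simp: s_def)
    qed (use t in \<open>auto simp: s_def\<close>)
    moreover have "(\<Sum>i<Suc n. ennreal (dist (\<gamma> (s i)) (\<gamma> (s (Suc i))))) =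
      ennreal (dist (\<gamma> a) (\<gamma> c)) + (\<Sum>i<n. ennreal (dist (\<gamma> (t i)) (\<gamma> (t (Suc i)))))"
      unfolding sum.lessThan_Suc_shift by (simp add: s_def t)
    ultimately show "ennreal (dist (\<gamma> a) (\<gamma> (t 0))) + (\<Sum>i<n. ennreal (dist (\<gamma> (t i)) (\<gamma> (t (Suc i)))))
       \<le> curve_length \<gamma> a (t n)"
      using t by simp
  qed
qed

text \<open>Induction puts the points of the partition in front one at a time, each by
  \<open>curve_length_cons\<close>.\<close>

lemma partition_sum_add_curve_length:
  assumes "t 0 = a" "t n = s" "\<And>i. i < n \<Longrightarrow> t i \<le> t (Suc i)" "s \<le> b"
  shows "(\<Sum>i<n. ennreal (dist (\<gamma> (t i)) (\<gamma> (t (Suc i))))) + curve_length \<gamma> s b \<le> curve_length \<gamma> a b"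
  using assms
proof (induction n arbitrary: t a)
  case (Suc n)
  have IH: "(\<Sum>i<n. ennreal (dist (\<gamma> (t (Suc i))) (\<gamma> (t (Suc (Suc i)))))) + curve_length \<gamma> s b
      \<le> curve_length \<gamma> (t 1) b"
    using Suc.IH[of "\<lambda>i. t (Suc i)" "t 1"] Suc.prems by simp
  have "t 1 \<le> b"
    using partition_mono[of "Suc n" t 1 "Suc n"] Suc.prems by simp
  then have "ennreal (dist (\<gamma> (t 0)) (\<gamma> (t 1))) + curve_length \<gamma> (t 1) b \<le> curve_length \<gamma> a b"
    using curve_length_cons[of a "t 1" b \<gamma>] Suc.prems(1) Suc.prems(3)[of 0] by simp
  then show ?case
    unfolding sum.lessThan_Suc_shift add.assoc
    using order_trans[OF add_left_mono[OF IH, of "ennreal (dist (\<gamma> (t 0)) (\<gamma> (t 1)))"]] by simp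
qed simp

lemma curve_length_add_le:
  assumes "a \<le> s" "s \<le> b"
  shows "curve_length \<gamma> a s + curve_length \<gamma> s b \<le> curve_length \<gamma> a b"
proof -
  let ?P = "{(n::nat, t::nat \<Rightarrow> real). t 0 = a \<and> t n = s \<and> (\<forall>i<n. t i \<le> t (Suc i))}"
  have "(1, \<lambda>i. if i = 0 then a else s) \<in> ?P"
    using assms by auto
  then have ne: "?P \<noteq> {}" by blast
  show ?thesis
    unfolding curve_length_def[of \<gamma> a s]
    unfolding ennreal_SUP_add_left[OF ne, symmetric]
    by (rule SUP_least) (use assms in \<open>auto intro!: partition_sum_add_curve_length\<close>)
qed

lemma dist_le_curve_length: "a \<le> b \<Longrightarrow> ennreal (dist (\<gamma> a) (\<gamma> b)) \<le> curve_length \<gamma> a b"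
  using curve_length_partition[of "\<lambda>i. if i = 0 then a else b" a 1 b \<gamma>] by simp

text \<open>A partition that jumps over \<open>s\<close> is refined by inserting \<open>s\<close>,
  which the triangle inequality allows. With \<open>curve_length_add_le\<close> this makes length
  additive, so increments of \<open>length_fun\<close> are lengths of subarcs.\<close>

lemma curve_length_le_add:
  assumes "a \<le> s" "s \<le> b"
  shows "curve_length \<gamma> a b \<le> curve_length \<gamma> a s + curve_length \<gamma> s b"
proof (rule curve_length_leI)
  fix n :: nat and t :: "nat \<Rightarrow> real"
  assume "t 0 = a" "t n = b" "\<And>i. i < n \<Longrightarrow> t i \<le> t (Suc i)"
  then show "(\<Sum>i<n. ennreal (dist (\<gamma> (t i)) (\<gamma> (t (Suc i))))) \<le> curve_length \<gamma> a s + curve_length \<gamma> s b"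
    using assms(1)
  proof (induction n arbitrary: t a)
    case (Suc n)
    let ?r = "\<Sum>i<n. ennreal (dist (\<gamma> (t (Suc i))) (\<gamma> (t (Suc (Suc i)))))"
    have t1: "a \<le> t 1" "t 1 \<le> b"
      using partition_mono[of "Suc n" t 1 "Suc n"] Suc.prems(1,2) Suc.prems(3)[of 0] Suc.prems(3) by auto
    have "ennreal (dist (\<gamma> a) (\<gamma> (t 1))) + ?r \<le> curve_length \<gamma> a s + curve_length \<gamma> s b"
    proof (cases "s \<le> t 1")
      case True
      have "?r \<le> curve_length \<gamma> (t 1) b"
        using Suc.prems by (intro curve_length_partition) auto
      then have r: "ennreal (dist (\<gamma> s) (\<gamma> (t 1))) + ?r \<le> curve_length \<gamma> s b"
        by (rule order_trans[OF add_left_mono curve_length_cons[OF True t1(2), of \<gamma>]])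
      have "ennreal (dist (\<gamma> a) (\<gamma> s)) \<le> curve_length \<gamma> a s"
        using Suc.prems by (intro dist_le_curve_length)
      moreover have "ennreal (dist (\<gamma> a) (\<gamma> (t 1))) \<le> ennreal (dist (\<gamma> a) (\<gamma> s)) + ennreal (dist (\<gamma> s) (\<gamma> (t 1)))"
        by (simp add: dist_triangle flip: ennreal_plus)
      ultimately have "ennreal (dist (\<gamma> a) (\<gamma> (t 1))) \<le> curve_length \<gamma> a s + ennreal (dist (\<gamma> s) (\<gamma> (t 1)))"
        by (meson add_right_mono order_trans)
      then have "ennreal (dist (\<gamma> a) (\<gamma> (t 1))) + ?r \<le> curve_length \<gamma> a s + (ennreal (dist (\<gamma> s) (\<gamma> (t 1))) + ?r)"
        unfolding add.assoc[symmetric] by (rule add_right_mono)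
      also have "\<dots> \<le> curve_length \<gamma> a s + curve_length \<gamma> s b"
        by (rule add_left_mono[OF r])
      finally show ?thesis .
    next
      case False
      have "ennreal (dist (\<gamma> a) (\<gamma> (t 1))) + ?r \<le>
          ennreal (dist (\<gamma> a) (\<gamma> (t 1))) + (curve_length \<gamma> (t 1) s + curve_length \<gamma> s b)"
        by (rule add_left_mono) (use Suc.IH[of "\<lambda>i. t (Suc i)" "t 1"] Suc.prems False in simp)
      also have "\<dots> \<le> curve_length \<gamma> a s + curve_length \<gamma> s b"
        unfolding add.assoc[symmetric] using t1 False by (intro add_right_mono curve_length_cons) auto
      finally show ?thesis .
    qed
    then show ?case
      unfolding sum.lessThan_Suc_shift using Suc.prems(1) by simp
  qed (use assms in simp)
qed

text \<open>The point \<open>c\<close> is the first partition point strictly beyond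
  \<open>s\<close>; repetitions of \<open>s\<close> before it contribute nothing. Strictness leaves
  room to insert a further point between \<open>s\<close> and \<open>c\<close>.\<close>

lemma curve_length_tail_approx:
  assumes "s < b" "t 0 = s" "t n = b" "\<And>i. i < n \<Longrightarrow> t i \<le> t (Suc i)"
  shows "\<exists>c. s < c \<and> c \<le> b \<and>
    (\<Sum>i<n. ennreal (dist (\<gamma> (t i)) (\<gamma> (t (Suc i))))) \<le> ennreal (dist (\<gamma> s) (\<gamma> c)) + curve_length \<gamma> c b"
  using assms
proof (induction n arbitrary: t)
  case (Suc n)
  let ?r = "\<Sum>i<n. ennreal (dist (\<gamma> (t (Suc i))) (\<gamma> (t (Suc (Suc i)))))"
  have t1: "s \<le> t 1" "t 1 \<le> b"
    using partition_mono[of "Suc n" t 1 "Suc n"] Suc.prems(2,3) Suc.prems(4)[of 0] Suc.prems(4) by auto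
  show ?case
  proof (cases "s < t 1")
    case True
    have "?r \<le> curve_length \<gamma> (t 1) b"
      using Suc.prems by (intro curve_length_partition) auto
    then show ?thesis
      unfolding sum.lessThan_Suc_shift using True t1 Suc.prems(2)
      by (intro exI[of _ "t 1"]) (auto intro: add_left_mono)
  next
    case False
    then have "t 1 = s" using t1 by simp
    then show ?thesis
      unfolding sum.lessThan_Suc_shift using Suc.IH[of "\<lambda>i. t (Suc i)"] Suc.prems by simp
  qed
qed simp

text \<open>Take a partition of \<open>[s, 1]\<close> that nearly exhausts the length, with first
  chord from \<open>s\<close> to \<open>c\<close>. By continuity a point \<open>c'\<close> just
  after \<open>s\<close> can be inserted at a small chord distance, so the arc from
  \<open>c'\<close> on carries the length up to \<open>e\<close>, and additivity leaves at most
  \<open>e\<close> for the arc before it.\<close>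

lemma curve_length_right_small:
  assumes "rectifiable_curve \<gamma>" "0 \<le> s" "s < 1" "0 < e"
  shows "\<exists>c>s. c \<le> 1 \<and> curve_length \<gamma> s c \<le> ennreal e"
proof -
  have fin: "curve_length \<gamma> s 1 < \<infinity>"
  proof -
    have "curve_length \<gamma> s 1 \<le> curve_length \<gamma> 0 s + curve_length \<gamma> s 1" by simp
    also have "\<dots> \<le> curve_length \<gamma> 0 1" using assms by (intro curve_length_add_le) auto
    also have "\<dots> < \<infinity>" using assms by (simp add: rectifiable_curve_def)
    finally show ?thesis .
  qed
  have "\<exists>n t. t 0 = s \<and> t n = 1 \<and> (\<forall>i<n. t i \<le> t (Suc i)) \<and>
      curve_length \<gamma> s 1 \<le> (\<Sum>i<n. ennreal (dist (\<gamma> (t i)) (\<gamma> (t (Suc i))))) + ennreal (e/2)"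
  proof (rule ccontr)
    assume neg: "\<not> ?thesis"
    have "curve_length \<gamma> s 1 \<le> curve_length \<gamma> s 1 - ennreal (e/2)"
    proof (rule curve_length_leI)
      fix n :: nat and t :: "nat \<Rightarrow> real"
      assume "t 0 = s" "t n = 1" "\<And>i. i < n \<Longrightarrow> t i \<le> t (Suc i)"
      then have "(\<Sum>i<n. ennreal (dist (\<gamma> (t i)) (\<gamma> (t (Suc i))))) + ennreal (e/2) \<le> curve_length \<gamma> s 1"
        using neg nle_le by blast
      then show "(\<Sum>i<n. ennreal (dist (\<gamma> (t i)) (\<gamma> (t (Suc i))))) \<le> curve_length \<gamma> s 1 - ennreal (e/2)"
        by (simp add: ennreal_le_minus_iff add.commute)
    qed
    \<comment> \<open>Subtraction in \<open>ennreal\<close> is truncated, so the inequality just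
      shown is absurd only for a positive length.\<close>
    moreover have "curve_length \<gamma> s 1 > 0"
    proof (rule ccontr)
      assume "\<not> 0 < curve_length \<gamma> s 1"
      then have "curve_length \<gamma> s 1 = 0" by simp
      then have "\<exists>n t. t 0 = s \<and> t n = 1 \<and> (\<forall>i<n. t i \<le> t (Suc i)) \<and>
        curve_length \<gamma> s 1 \<le> (\<Sum>i<n. ennreal (dist (\<gamma> (t i)) (\<gamma> (t (Suc i))))) + ennreal (e/2)"
        using assms by (intro exI[of _ 1] exI[of _ "\<lambda>i. if i = 0 then s else 1"]) auto
      then show False using neg by blast
    qed
    ultimately show False
      using fin \<open>0 < e\<close> by (cases "curve_length \<gamma> s 1") (auto simp: ennreal_minus ennreal_le_iff2)
  qed
  then obtain n t where t: "t 0 = s" "t n = 1" "\<forall>i<n. t i \<le> t (Suc i)"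
      and le: "curve_length \<gamma> s 1 \<le> (\<Sum>i<n. ennreal (dist (\<gamma> (t i)) (\<gamma> (t (Suc i))))) + ennreal (e/2)"
    by blast
  obtain c where c: "s < c" "c \<le> 1"
    "(\<Sum>i<n. ennreal (dist (\<gamma> (t i)) (\<gamma> (t (Suc i))))) \<le> ennreal (dist (\<gamma> s) (\<gamma> c)) + curve_length \<gamma> c 1"
    using curve_length_tail_approx[of s 1 t n \<gamma>] assms t by blast
  have "continuous_on {0..1} \<gamma>" using assms by (simp add: rectifiable_curve_def)
  then obtain d where d: "d > 0" "\<And>x. x \<in> {0..1} \<Longrightarrow> dist x s < d \<Longrightarrow> dist (\<gamma> x) (\<gamma> s) < e/2"
    using assms unfolding continuous_on_iff by (metis atLeastAtMost_iff half_gt_zero less_eq_real_def)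
  define c' where "c' = min c (s + d/2)"
  have c': "s < c'" "c' \<le> c" "dist c' s < d" "c' \<in> {0..1}"
    using c d assms by (auto simp: c'_def dist_real_def)
  have small: "dist (\<gamma> s) (\<gamma> c') \<le> e/2"
    using d(2)[OF c'(4,3)] by (simp add: dist_commute)
  have "ennreal (dist (\<gamma> s) (\<gamma> c)) + curve_length \<gamma> c 1 \<le>
      ennreal (dist (\<gamma> s) (\<gamma> c')) + (ennreal (dist (\<gamma> c') (\<gamma> c)) + curve_length \<gamma> c 1)"
    by (simp add: dist_triangle add_right_mono flip: ennreal_plus add.assoc)
  also have "\<dots> \<le> ennreal (e/2) + curve_length \<gamma> c' 1"
    using small c' c by (intro add_mono curve_length_cons ennreal_leI) auto
  finally have "curve_length \<gamma> s 1 \<le> ennreal (e/2) + curve_length \<gamma> c' 1 + ennreal (e/2)"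
    using le c(3) by (meson add_right_mono order_trans)
  then have "curve_length \<gamma> s 1 \<le> curve_length \<gamma> c' 1 + ennreal e"
    using \<open>0 < e\<close> by (smt (verit, best) add.assoc add.commute ennreal_plus field_sum_of_halves half_gt_zero less_eq_real_def)
  moreover have "curve_length \<gamma> s c' + curve_length \<gamma> c' 1 \<le> curve_length \<gamma> s 1"
    using c' by (intro curve_length_add_le) auto
  ultimately have "curve_length \<gamma> c' 1 + curve_length \<gamma> s c' \<le> curve_length \<gamma> c' 1 + ennreal e"
     and "curve_length \<gamma> c' 1 + curve_length \<gamma> s c' < \<infinity>"
    using fin by (auto simp only: add.commute[of "curve_length \<gamma> s c'"] intro: order_trans order_le_less_trans)
  then have "curve_length \<gamma> s c' \<le> ennreal e"
    by (auto simp: ennreal_add_left_cancel_le)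
  then show ?thesis using c' by auto
qed

lemma curve_length_finite:
  assumes "rectifiable_curve \<gamma>" "0 \<le> s" "s \<le> t" "t \<le> 1"
  shows "curve_length \<gamma> s t < \<infinity>"
proof -
  have "curve_length \<gamma> s t \<le> curve_length \<gamma> 0 s + (curve_length \<gamma> s t + curve_length \<gamma> t 1)"
    by (simp add: add_increasing add_increasing2)
  also have "\<dots> \<le> curve_length \<gamma> 0 s + curve_length \<gamma> s 1"
    using assms by (intro add_left_mono curve_length_add_le)
  also have "\<dots> \<le> curve_length \<gamma> 0 1"
    using assms by (intro curve_length_add_le) auto
  also have "\<dots> < \<infinity>" using assms by (simp add: rectifiable_curve_def)
  finally show ?thesis .
qed

lemma length_fun_diff:
  assumes "rectifiable_curve \<gamma>" "0 \<le> s" "s \<le> t" "t \<le> 1"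
  shows "length_fun \<gamma> t = length_fun \<gamma> s + enn2real (curve_length \<gamma> s t)"
proof -
  have "curve_length \<gamma> 0 t = curve_length \<gamma> 0 s + curve_length \<gamma> s t"
    using curve_length_add_le[of 0 s t \<gamma>] curve_length_le_add[of 0 s t \<gamma>] assms by (simp add: antisym)
  moreover have "curve_length \<gamma> 0 s < \<infinity>" "curve_length \<gamma> s t < \<infinity>"
    using curve_length_finite[OF assms(1), of 0 s] curve_length_finite[OF assms] assms by auto
  ultimately show ?thesis
    using assms by (simp add: length_fun_def enn2real_plus)
qed

lemma length_fun_clamp: "length_fun \<gamma> t = length_fun \<gamma> (min 1 (max 0 t))"
  by (simp add: length_fun_def)

lemma length_fun_mono:
  assumes "rectifiable_curve \<gamma>" "x \<le> y"
  shows "length_fun \<gamma> x \<le> length_fun \<gamma> y"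
  using length_fun_diff[OF assms(1), of "min 1 (max 0 x)" "min 1 (max 0 y)"] assms(2)
  by (subst (1 2) length_fun_clamp) (simp add: min_le_iff_disj max_def)

lemma dist_le_length_fun_diff:
  assumes "rectifiable_curve \<gamma>" "0 \<le> s" "s \<le> t" "t \<le> 1"
  shows "dist (\<gamma> s) (\<gamma> t) \<le> length_fun \<gamma> t - length_fun \<gamma> s"
proof -
  have "dist (\<gamma> s) (\<gamma> t) \<le> enn2real (curve_length \<gamma> s t)"
    using dist_le_curve_length[OF assms(3), of \<gamma>] curve_length_finite[OF assms]
    by (cases "curve_length \<gamma> s t") auto
  then show ?thesis using length_fun_diff[OF assms] by simp
qed

text \<open>Without right continuity \<open>interval_measure (length_fun \<gamma>)\<close> would be a junk value.\<close>

lemma length_fun_right_continuous: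
  assumes "rectifiable_curve \<gamma>"
  shows "continuous (at_right a) (length_fun \<gamma>)"
proof -
  have *: "\<exists>b>a. \<forall>x. a < x \<and> x < b \<longrightarrow> dist (length_fun \<gamma> x) (length_fun \<gamma> a) \<le> e" if "e > 0" for e
  proof -
    consider "a < 0" | "1 \<le> a" | "0 \<le> a" "a < 1" by linarith
    then show ?thesis
    proof cases
      case 1
      then show ?thesis using that by (intro exI[of _ 0]) (auto simp: length_fun_def)
    next
      case 2
      then show ?thesis using that by (intro exI[of _ "a + 1"]) (auto simp: length_fun_def)
    next
      case 3
      obtain c where c: "a < c" "c \<le> 1" "curve_length \<gamma> a c \<le> ennreal e"
        using curve_length_right_small[OF assms 3 \<open>e > 0\<close>] by blast
      have "dist (length_fun \<gamma> x) (length_fun \<gamma> a) \<le> e" if x: "a < x" "x < c" for x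
      proof -
        have "length_fun \<gamma> c = length_fun \<gamma> a + enn2real (curve_length \<gamma> a c)"
          using assms 3 c by (intro length_fun_diff) auto
        moreover have "enn2real (curve_length \<gamma> a c) \<le> e"
          using c(3) \<open>e > 0\<close> by (intro enn2real_leI) auto
        moreover have "length_fun \<gamma> a \<le> length_fun \<gamma> x" "length_fun \<gamma> x \<le> length_fun \<gamma> c"
          using length_fun_mono[OF assms] x by auto
        ultimately show ?thesis by (simp add: dist_real_def)
      qed
      then show ?thesis using c by auto
    qed
  qed
  have "\<exists>b>a. \<forall>x. a < x \<and> x < b \<longrightarrow> dist (length_fun \<gamma> x) (length_fun \<gamma> a) < e" if "e > 0" for e
  proof -
    obtain b where "b > a" "\<forall>x. a < x \<and> x < b \<longrightarrow> dist (length_fun \<gamma> x) (length_fun \<gamma> a) \<le> e/2"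
      using *[OF half_gt_zero[OF \<open>0 < e\<close>]] by blast
    then show ?thesis using that by (intro exI[of _ b]) fastforce
  qed
  then show ?thesis
    unfolding continuous_within tendsto_iff eventually_at_right_field by blast
qed

text \<open>On a short piece the estimate holds with \<open>g\<close> taken at every intermediate
  parameter, so the difference quotient of \<open>u\<close> is a lower bound for \<open>g\<close>
  along the whole piece. The resulting step function lies below \<open>g\<close> along the curve,
  and its integral against arc length dominates the telescoping sum of differences.\<close>

lemma upper_gradientI:
  fixes u :: "'a::metric_space \<Rightarrow> real"
  assumes g: "g \<in> borel_measurable borel"
    and local: "\<And>\<gamma>. rectifiable_curve \<gamma> \<Longrightarrow> \<gamma> ` {0..1} \<subseteq> U \<Longrightarrow>
      \<exists>\<eta>>0. \<forall>s r t. 0 \<le> s \<longrightarrow> s \<le> r \<longrightarrow> r \<le> t \<longrightarrow> t \<le> 1 \<longrightarrow> t - s < \<eta> \<longrightarrow>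
        ennreal \<bar>u (\<gamma> s) - u (\<gamma> t)\<bar> \<le> g (\<gamma> r) * ennreal (dist (\<gamma> s) (\<gamma> t))"
  shows "upper_gradient U u g"
  unfolding upper_gradient_def
proof (intro conjI g allI impI, elim conjE)
  fix \<gamma> :: "real \<Rightarrow> 'a"
  assume \<gamma>: "rectifiable_curve \<gamma>" and "\<gamma> ` {0..1} \<subseteq> U"
  then obtain \<eta> where "\<eta> > 0" and \<eta>: "\<And>s r t. 0 \<le> s \<Longrightarrow> s \<le> r \<Longrightarrow> r \<le> t \<Longrightarrow> t \<le> 1 \<Longrightarrow> t - s < \<eta> \<Longrightarrow>
        ennreal \<bar>u (\<gamma> s) - u (\<gamma> t)\<bar> \<le> g (\<gamma> r) * ennreal (dist (\<gamma> s) (\<gamma> t))"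
    using local by meson
  obtain N where N: "N > 0" "1 / real N < \<eta>"
    using \<open>\<eta> > 0\<close> by (metis nat_approx_posE zero_less_Suc)
  define \<tau> where "\<tau> i = real i / real N" for i
  define \<nu> where "\<nu> = interval_measure (length_fun \<gamma>)"
  define \<Delta> where "\<Delta> i = \<bar>u (\<gamma> (\<tau> i)) - u (\<gamma> (\<tau> (Suc i)))\<bar>" for i
  define D where "D i = dist (\<gamma> (\<tau> i)) (\<gamma> (\<tau> (Suc i)))" for i
  \<comment> \<open>Half-open pieces are disjoint, and \<open>interval_measure\<close> gives them
    the increments of \<open>length_fun\<close>. Losing the parameter 0 is harmless, since only a
    lower bound of the integral is sought.\<close>
  define J where "J i = {\<tau> i<..\<tau> (Suc i)}" for i
  have \<tau>: "0 \<le> \<tau> i" "\<tau> i \<le> \<tau> (Suc i)" "\<tau> (Suc i) - \<tau> i < \<eta>" for i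
    using N by (auto simp: \<tau>_def divide_right_mono diff_divide_distrib[symmetric])
  have \<tau>1: "\<tau> (Suc i) \<le> 1" if "i < N" for i
    using that N by (auto simp: \<tau>_def)
  have slope: "ennreal (\<Delta> i / D i) \<le> g (\<gamma> r)" if "i < N" "\<tau> i \<le> r" "r \<le> \<tau> (Suc i)" for i r
  proof (cases "D i = 0")
    case False
    then have "D i > 0" by (simp add: D_def)
    have "ennreal (\<Delta> i) \<le> g (\<gamma> r) * ennreal (D i)"
      unfolding \<Delta>_def D_def using \<tau>[of i] \<tau>1[of i] that by (intro \<eta>) auto
    then have "ennreal (\<Delta> i) / ennreal (D i) \<le> g (\<gamma> r)"
      using \<open>D i > 0\<close> by (intro divide_le_posI_ennreal) (auto simp: mult.commute)
    then show ?thesis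
      using \<open>D i > 0\<close> by (simp add: divide_ennreal \<Delta>_def)
  qed simp
  have \<nu>J: "emeasure \<nu> (J i) = ennreal (length_fun \<gamma> (\<tau> (Suc i)) - length_fun \<gamma> (\<tau> i))" for i
    unfolding \<nu>_def J_def using \<tau>
    by (intro emeasure_interval_measure_Ioc length_fun_mono[OF \<gamma>] length_fun_right_continuous[OF \<gamma>])
  have \<Delta>_le: "ennreal (\<Delta> i) \<le> ennreal (\<Delta> i / D i) * emeasure \<nu> (J i)" if "i < N" for i
  \<comment> \<open>If the piece closes up, the quotient \<open>\<Delta> i / D i\<close> is 0 by
    default, and the local estimate itself forces \<open>\<Delta> i\<close> to vanish.\<close>
  proof (cases "D i = 0")
    case True
    have "ennreal (\<Delta> i) \<le> g (\<gamma> (\<tau> i)) * ennreal (D i)"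
      unfolding \<Delta>_def D_def using \<tau>[of i] \<tau>1[of i] that by (intro \<eta>) auto
    then show ?thesis using True by simp
  next
    case False
    then have "D i > 0" by (simp add: D_def)
    have "ennreal (\<Delta> i) = ennreal (\<Delta> i / D i) * ennreal (D i)"
      using \<open>D i > 0\<close> by (simp add: ennreal_mult[symmetric] \<Delta>_def)
    also have "\<dots> \<le> ennreal (\<Delta> i / D i) * emeasure \<nu> (J i)"
      unfolding \<nu>J D_def using \<tau> \<tau>1[OF that]
      by (intro mult_left_mono ennreal_leI dist_le_length_fun_diff[OF \<gamma>]) auto
    finally show ?thesis .
  qed
  have disj: "i = j" if "t \<in> J i" "t \<in> J j" for i j t
  proof -
    have "\<tau> i < \<tau> (Suc j)" "\<tau> j < \<tau> (Suc i)" using that by (auto simp: J_def)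
    then show ?thesis using N by (simp add: \<tau>_def divide_less_cancel)
  qed
  have "\<bar>u (\<gamma> 0) - u (\<gamma> 1)\<bar> = \<bar>u (\<gamma> (\<tau> 0)) - u (\<gamma> (\<tau> N))\<bar>"
    using N by (simp add: \<tau>_def)
  also have "\<dots> \<le> (\<Sum>i<N. \<Delta> i)"
  proof (induction N)
    case (Suc n)
    then show ?case by (simp add: \<Delta>_def)
  qed simp
  finally have "ennreal \<bar>u (\<gamma> 0) - u (\<gamma> 1)\<bar> \<le> (\<Sum>i<N. ennreal (\<Delta> i))"
    by (simp add: \<Delta>_def sum_ennreal ennreal_leI)
  also have "\<dots> \<le> (\<Sum>i<N. ennreal (\<Delta> i / D i) * emeasure \<nu> (J i))"
    by (intro sum_mono \<Delta>_le) auto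
  also have "\<dots> = (\<integral>\<^sup>+t. (\<Sum>i<N. ennreal (\<Delta> i / D i) * indicator (J i) t) \<partial>\<nu>)"
    by (subst nn_integral_sum) (auto simp: \<nu>_def J_def nn_integral_cmult_indicator)
  also have "\<dots> \<le> (\<integral>\<^sup>+t. g (\<gamma> t) * indicator {0..1} t \<partial>\<nu>)"
  proof (intro nn_integral_mono)
    fix t
    show "(\<Sum>i<N. ennreal (\<Delta> i / D i) * indicator (J i) t) \<le> g (\<gamma> t) * indicator {0..1} t"
    proof (cases "\<exists>j<N. t \<in> J j")
      case True
      then obtain j where j: "j < N" "t \<in> J j" by blast
      have "(\<Sum>i<N. ennreal (\<Delta> i / D i) * indicator (J i) t) = (\<Sum>i<N. if i = j then ennreal (\<Delta> j / D j) else 0)"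
        using disj j by (intro sum.cong) (auto simp: indicator_def)
      also have "\<dots> = ennreal (\<Delta> j / D j)" using j by simp
      also have "\<dots> \<le> g (\<gamma> t)" using j by (intro slope) (auto simp: J_def)
      finally show ?thesis using j \<tau>(1)[of j] \<tau>1[of j] by (auto simp: J_def)
    next
      case False
      then have "(\<Sum>i<N. ennreal (\<Delta> i / D i) * indicator (J i) t) = 0" by (auto simp: indicator_def)
      then show ?thesis by simp
    qed
  qed
  finally show "ennreal \<bar>u (\<gamma> 0) - u (\<gamma> 1)\<bar> \<le> line_integral \<gamma> g"
    by (simp add: line_integral_def \<nu>_def)
qed

subsection \<open>Properness and quasiconvexity\<close>

lemma doubling_measureE:
  fixes \<mu> :: "'a::metric_space measure"
  assumes "doubling_measure \<mu>"
  obtains C where "C > 0" "\<And>x r. r > 0 \<Longrightarrow> 0 < measure \<mu> (ball x r)"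
    "\<And>x r. emeasure \<mu> (ball x r) < \<infinity>"
    "\<And>x r. r > 0 \<Longrightarrow> measure \<mu> (ball x (2*r)) \<le> C * measure \<mu> (ball x r)"
proof -
  obtain C where C: "\<And>x r. r > 0 \<Longrightarrow> 0 < emeasure \<mu> (ball x (2*r))"
     "\<And>x r. r > 0 \<Longrightarrow> emeasure \<mu> (ball x (2*r)) \<le> ennreal C * emeasure \<mu> (ball x r)"
     "\<And>x r. r > 0 \<Longrightarrow> emeasure \<mu> (ball x r) < \<infinity>"
    using assms unfolding doubling_measure_def by blast
  have fin: "emeasure \<mu> (ball x r) < \<infinity>" for x r
    using C(3)[of r x] by (cases "r > 0") (auto simp: ball_empty)
  have em: "emeasure \<mu> (ball x r) = ennreal (measure \<mu> (ball x r))" for x r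
    using fin by (intro emeasure_eq_ennreal_measure) (auto simp: less_top)
  have pos: "0 < measure \<mu> (ball x r)" if "r > 0" for x r
    using C(1)[of "r/2" x] that by (simp add: em)
  have "measure \<mu> (ball x (2*r)) \<le> max 1 C * measure \<mu> (ball x r)" if "r > 0" for x r
  proof -
    have "ennreal (measure \<mu> (ball x (2*r))) \<le> ennreal C * ennreal (measure \<mu> (ball x r))"
      using C(2)[OF that, of x] by (simp only: em)
    also have "\<dots> \<le> ennreal (max 1 C) * ennreal (measure \<mu> (ball x r))"
      by (intro mult_right_mono ennreal_leI) auto
    also have "\<dots> = ennreal (max 1 C * measure \<mu> (ball x r))"
      by (simp add: ennreal_mult)
    finally show ?thesis
      by (subst (asm) ennreal_le_iff) auto
  qed
  with pos fin show ?thesis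
    by (intro that[of "max 1 C"]) auto
qed

text \<open>Balls of radius \<open>e/2\<close> around \<open>e\<close>-separated points are
  disjoint, and by doubling each has at least a fixed fraction of the measure of one big ball. So
  separated sets have bounded size, and a largest one is an \<open>e\<close>-net.\<close>

lemma doubling_compact_cball:
  fixes \<mu> :: "'a::complete_space measure"
  assumes "doubling_measure \<mu>"
  shows "compact (cball (x::'a) R)"
  unfolding compact_eq_totally_bounded
proof (intro conjI allI impI)
  show "complete (cball x R)" by (simp add: complete_eq_closed)
  fix e :: real assume "e > 0"
  have borel: "sets \<mu> = sets borel" using assms by (simp add: doubling_measure_def)
  obtain C where C: "C > 0" and pos: "\<And>x r. r > 0 \<Longrightarrow> 0 < measure \<mu> (ball x r)"
    and fin: "\<And>x r. emeasure \<mu> (ball x r) < \<infinity>"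
    and dbl: "\<And>x r. r > 0 \<Longrightarrow> measure \<mu> (ball x (2*r)) \<le> C * measure \<mu> (ball x r)"
    using doubling_measureE[OF assms] by blast
  define R' where "R' = \<bar>R\<bar> + e"
  have "R' > 0" using \<open>e > 0\<close> by (simp add: R'_def)
  have dblk: "measure \<mu> (ball y (2^k * (e/2))) \<le> C^k * measure \<mu> (ball y (e/2))" for y k
  proof (induction k)
    case (Suc k)
    have "measure \<mu> (ball y (2^(Suc k) * (e/2))) \<le> C * measure \<mu> (ball y (2^k * (e/2)))"
      using dbl[of "2^k * (e/2)" y] \<open>e > 0\<close> by (simp add: mult.assoc)
    also have "\<dots> \<le> C * (C^k * measure \<mu> (ball y (e/2)))"
      using Suc C by (intro mult_left_mono) auto
    finally show ?case by (simp add: mult.assoc)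
  qed simp
  \<comment> \<open>After \<open>k\<close> doublings the ball of radius \<open>e/2\<close> around
    any point of \<open>cball x R\<close> contains \<open>ball x R'\<close>.\<close>
  obtain k :: nat where k: "2 * R' / (e/2) < 2^k"
    using real_arch_pow[of 2 "2 * R' / (e/2)"] by auto
  let ?sep = "\<lambda>S. finite S \<and> S \<subseteq> cball x R \<and> (\<forall>s\<in>S. \<forall>t\<in>S. s \<noteq> t \<longrightarrow> e \<le> dist s t)"
  have bound: "card S \<le> nat \<lceil>C^k\<rceil>" if S: "?sep S" for S
  proof -
    have "real (card S) * (measure \<mu> (ball x R') / C^k) = (\<Sum>s\<in>S. measure \<mu> (ball x R') / C^k)"
      by simp
    also have "\<dots> \<le> (\<Sum>s\<in>S. measure \<mu> (ball s (e/2)))"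
    proof (rule sum_mono)
      fix s assume "s \<in> S"
      then have "dist x s \<le> R" using S by auto
      have "measure \<mu> (ball x R') \<le> measure \<mu> (ball s (2^k * (e/2)))"
      proof (rule measure_mono_fmeasurable)
        have "2 * R' < 2^k * (e/2)" using k \<open>e > 0\<close> by (simp add: field_simps)
        moreover have "dist s y < 2 * R'" if "dist x y < R'" for y
          using that \<open>dist x s \<le> R\<close> dist_triangle[of s y x] \<open>e > 0\<close>
          by (simp add: R'_def dist_commute)
        ultimately show "ball x R' \<subseteq> ball s (2^k * (e/2))" by force
        show "ball s (2^k * (e/2)) \<in> fmeasurable \<mu>" "ball x R' \<in> sets \<mu>"
          using fin borel by (auto simp: fmeasurable_def)
      qed
      also have "\<dots> \<le> C^k * measure \<mu> (ball s (e/2))" by (rule dblk)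
      finally show "measure \<mu> (ball x R') / C^k \<le> measure \<mu> (ball s (e/2))"
        using C by (simp add: field_simps)
    qed
    also have "\<dots> = measure \<mu> (\<Union>s\<in>S. ball s (e/2))"
    proof (rule measure_finite_Union[symmetric])
      show "disjoint_family_on (\<lambda>s. ball s (e/2)) S"
        unfolding disjoint_family_on_def
      proof (intro ballI impI)
        fix s t assume "s \<in> S" "t \<in> S" "s \<noteq> t"
        then have "e \<le> dist s t" using S by blast
        then show "ball s (e/2) \<inter> ball t (e/2) = {}"
          by (intro disjoint_ballI) simp
      qed
    qed (use S fin borel in \<open>auto simp: less_top\<close>)
    also have "\<dots> \<le> measure \<mu> (ball x R')"
    proof (rule measure_mono_fmeasurable)
      show "(\<Union>s\<in>S. ball s (e/2)) \<subseteq> ball x R'"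
      proof clarify
        fix s y assume "s \<in> S" "y \<in> ball s (e/2)"
        moreover then have "dist x s \<le> R" using S by auto
        ultimately show "y \<in> ball x R'"
          using dist_triangle[of x y s] \<open>e > 0\<close> by (simp add: R'_def)
      qed
      show "ball x R' \<in> fmeasurable \<mu>" "(\<Union>s\<in>S. ball s (e/2)) \<in> sets \<mu>"
        using fin borel by (auto simp: fmeasurable_def intro!: borel_open open_UN)
    qed
    finally have "real (card S) / C^k * measure \<mu> (ball x R') \<le> 1 * measure \<mu> (ball x R')" by simp
    then have "real (card S) / C^k \<le> 1"
      using pos[OF \<open>R' > 0\<close>, of x] by (simp only: mult_le_cancel_right)
    then have "real (card S) \<le> C^k" using C by (simp add: field_simps)
    then show ?thesis by linarith
  qed
  have "\<exists>S. ?sep S \<and> (\<forall>T. ?sep T \<longrightarrow> card T \<le> card S)"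
  proof (rule ex_has_greatest_nat)
    show "?sep {}" by simp
    show "\<forall>S. ?sep S \<longrightarrow> card S < Suc (nat \<lceil>C^k\<rceil>)"
      using bound by (simp only: less_Suc_eq_le) blast
  qed
  then obtain S where Smax: "?sep S \<and> (\<forall>T. ?sep T \<longrightarrow> card T \<le> card S)" by (rule exE)
  then have S: "?sep S" by (rule conjunct1)
  have "cball x R \<subseteq> (\<Union>s\<in>S. ball s e)"
  proof
    fix y assume y: "y \<in> cball x R"
    show "y \<in> (\<Union>s\<in>S. ball s e)"
    proof (rule ccontr)
      assume "y \<notin> (\<Union>s\<in>S. ball s e)"
      then have far: "e \<le> dist s y" if "s \<in> S" for s using that by (auto simp: not_less)
      then have "?sep (insert y S)" using S y by (auto simp: dist_commute)
      then have "card (insert y S) \<le> card S" using Smax by simp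
      moreover have "y \<notin> S" using far[of y] \<open>e > 0\<close> by auto
      ultimately show False using S by simp
    qed
  qed
  then show "\<exists>K. finite K \<and> cball x R \<subseteq> (\<Union>y\<in>K. ball y e)"
    using S by (intro exI[of _ S]) simp
qed

lemma doubling_compact:
  fixes \<mu> :: "'a::complete_space measure" and S :: "'a set"
  assumes "doubling_measure \<mu>" "closed S" "bounded S"
  shows "compact S"
proof -
  obtain x R where "S \<subseteq> cball x R" using assms(3) by (auto simp: bounded_def subset_eq)
  then show ?thesis
    using compact_Int_closed[OF doubling_compact_cball[OF assms(1), of x R] assms(2)]
    by (simp add: inf.absorb2)
qed

section \<open>Weighted chains of points and their truncated infimum\<close>

text \<open>Discrete paths: a step from \<open>y\<close> must be shorter than
  \<open>\<rho> y\<close> and is charged at the weight of its starting point. With constant \<rho>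
  and weight 1 this is the length of an \<epsilon>-chain; with a weight growing towards the boundary
  it is a discrete weighted path length.\<close>

inductive weighted_chain :: "('a::metric_space \<Rightarrow> real) \<Rightarrow> ('a \<Rightarrow> real) \<Rightarrow> 'a \<Rightarrow> 'a \<Rightarrow> real \<Rightarrow> bool"
  for \<rho> w x where
  start: "weighted_chain \<rho> w x x 0"
| step: "weighted_chain \<rho> w x y a \<Longrightarrow> dist y z < \<rho> y \<Longrightarrow> weighted_chain \<rho> w x z (a + w y * dist y z)"

text \<open>The inserted \<open>N\<close> caps the value and keeps the set nonempty, so that points
  reached by no chain get \<open>N\<close> instead of an unspecified infimum.\<close>

definition truncated_cost :: "('a::metric_space \<Rightarrow> real) \<Rightarrow> ('a \<Rightarrow> real) \<Rightarrow> 'a \<Rightarrow> real \<Rightarrow> 'a \<Rightarrow> real" where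
  "truncated_cost \<rho> w x N y = Inf (insert N {a. weighted_chain \<rho> w x y a})"

lemma weighted_chain_nonneg:
  assumes "weighted_chain \<rho> w x y a" "\<And>z. w z \<ge> 0"
  shows "a \<ge> 0"
  using assms by (induction) auto

context
  fixes \<rho> w :: "'a::metric_space \<Rightarrow> real" and x :: 'a and N :: real
  assumes w: "\<And>z. w z \<ge> 0" and N: "N \<ge> 0"
begin

lemma truncated_cost_bdd: "bdd_below (insert N {a. weighted_chain \<rho> w x y a})"
  using w N by (intro bdd_belowI[of _ 0]) (auto dest: weighted_chain_nonneg)

lemma truncated_cost_le: "truncated_cost \<rho> w x N y \<le> N"
  unfolding truncated_cost_def by (intro cInf_lower truncated_cost_bdd) auto

lemma truncated_cost_le_chain: "weighted_chain \<rho> w x y a \<Longrightarrow> truncated_cost \<rho> w x N y \<le> a"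
  unfolding truncated_cost_def by (intro cInf_lower truncated_cost_bdd) auto

lemma truncated_cost_nonneg: "0 \<le> truncated_cost \<rho> w x N y"
  unfolding truncated_cost_def using w N by (intro cInf_greatest) (auto dest: weighted_chain_nonneg)

text \<open>Since \<open>b <= N\<close>, the element found below \<open>b\<close> cannot be the
  inserted \<open>N\<close>.\<close>

lemma truncated_cost_less_chain:
  assumes "truncated_cost \<rho> w x N y < b" "b \<le> N"
  shows "\<exists>a<b. weighted_chain \<rho> w x y a"
  using assms unfolding truncated_cost_def by (subst (asm) cInf_less_iff[OF _ truncated_cost_bdd]) auto

lemma truncated_cost_step:
  assumes "dist y z < \<rho> y"
  shows "truncated_cost \<rho> w x N z \<le> truncated_cost \<rho> w x N y + w y * dist y z"
proof -
  have "truncated_cost \<rho> w x N z - w y * dist y z \<le> truncated_cost \<rho> w x N y"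
    unfolding truncated_cost_def[of \<rho> w x N y]
  proof (rule cInf_greatest)
    fix a assume "a \<in> insert N {a. weighted_chain \<rho> w x y a}"
    then consider "a = N" | "weighted_chain \<rho> w x y a" by blast
    then show "truncated_cost \<rho> w x N z - w y * dist y z \<le> a"
    proof cases
      case 1
      then show ?thesis using truncated_cost_le[of z] w[of y] by (simp add: add_increasing2 diff_le_eq)
    next
      case 2
      then show ?thesis using truncated_cost_le_chain[OF step[OF 2 assms]] by simp
    qed
  qed simp
  then show ?thesis by simp
qed

end

section \<open>Lipschitz bounds from the Poincare inequality\<close>

lemma set_average_deviation:
  fixes f :: "'a \<Rightarrow> real"
  assumes f: "set_integrable M B f" and B: "B \<in> sets M" "emeasure M B < \<infinity>" "0 < measure M B"
  shows "\<bar>(LINT y:B|M. f y) / measure M B - c\<bar> \<le> (LINT y:B|M. \<bar>f y - c\<bar>) / measure M B"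
proof -
  have const: "set_integrable M B (\<lambda>_. c)"
    using B by (simp add: set_integrable_def)
  have "(LINT y:B|M. c) = c * measure M B"
    using B by (simp add: set_lebesgue_integral_def)
  then have "(LINT y:B|M. f y) / measure M B - c = (LINT y:B|M. f y - c) / measure M B"
    using set_integral_diff(2)[OF f const] B by (simp add: field_simps)
  moreover have "\<bar>LINT y:B|M. f y - c\<bar> \<le> (LINT y:B|M. \<bar>f y - c\<bar>)"
    using integral_norm_bound[of M "\<lambda>y. indicator B y *\<^sub>R (f y - c)"]
    by (simp add: set_lebesgue_integral_def abs_mult)
  ultimately show ?thesis
    using B by (simp add: divide_right_mono)
qed

text \<open>A function that is 1-Lipschitz at scale \<epsilon> has upper gradient 1, whatever
  \<epsilon> is. The Poincare inequality bounds the differences of its averages over dyadic balls by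
  their radii, and telescoping yields a global constant that depends on neither \<epsilon> nor
  \<open>N\<close>; boundedness by \<open>N\<close> provides integrability.\<close>

lemma poincare_lipschitz:
  fixes \<mu> :: "'a::metric_space measure"
  assumes dm: "doubling_measure \<mu>" and P: "poincare p \<mu>"
  obtains K where "K > 0"
    "\<And>(u :: 'a \<Rightarrow> real) N \<epsilon> x y. \<epsilon> > 0 \<Longrightarrow> (\<And>z. \<bar>u z\<bar> \<le> N) \<Longrightarrow>
      (\<And>y z. dist y z < \<epsilon> \<Longrightarrow> \<bar>u y - u z\<bar> \<le> dist y z) \<Longrightarrow> \<bar>u x - u y\<bar> \<le> K * dist x y"
proof -
  have borel: "sets \<mu> = sets borel" using dm by (simp add: doubling_measure_def)
  define M where "M = completion \<mu>"
  obtain C where C: "C > 0" and pos: "\<And>x r. r > 0 \<Longrightarrow> 0 < measure \<mu> (ball x r)"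
    and fin: "\<And>x r. emeasure \<mu> (ball x r) < \<infinity>"
    and dbl: "\<And>x r. r > 0 \<Longrightarrow> measure \<mu> (ball x (2*r)) \<le> C * measure \<mu> (ball x r)"
    using doubling_measureE[OF dm] by blast
  obtain P lam where P: "P > 0" "lam \<ge> 1" and
    poin: "\<And>x r u g. r > 0 \<Longrightarrow> (\<forall>y s. set_integrable M (ball y s) u) \<Longrightarrow>
        upper_gradient UNIV u g \<Longrightarrow>
        (\<integral>\<^sup>+ y\<in>ball x (lam*r). epow (g y) p \<partial>M) < \<infinity> \<Longrightarrow>
        (let uB = (LINT y:ball x r|M. u y) / measure \<mu> (ball x r) in
          (LINT y:ball x r|M. \<bar>u y - uB\<bar>) / measure \<mu> (ball x r)
          \<le> P * r * (enn2real (\<integral>\<^sup>+ y\<in>ball x (lam*r). epow (g y) p \<partial>M)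
                        / measure \<mu> (ball x (lam*r))) powr (1/p))"
    using P unfolding poincare_def M_def by blast
  have ballM: "ball x r \<in> sets M" "emeasure M (ball x r) < \<infinity>" "measure M (ball x r) = measure \<mu> (ball x r)" for x r
    using fin borel by (auto simp: M_def)
  \<comment> \<open>With \<open>D = dist x y\<close>, the last summand compares the averages over
    \<open>ball y D\<close> and \<open>ball x (2*D)\<close>. The passages from these averages to the
    centres cost \<open>2 * P * C + 1\<close> times \<open>D\<close> and \<open>2*D\<close>, rounded
    up to the first summand.\<close>
  define K where "K = 2 * (4 * P * C + 2) + 2 * P * C^2"
  have main: "\<bar>u x - u y\<bar> \<le> K * dist x y"
    if \<epsilon>: "\<epsilon> > 0" and bd: "\<And>z. \<bar>u z\<bar> \<le> N"
      and lip: "\<And>y z. dist y z < \<epsilon> \<Longrightarrow> \<bar>u y - u z\<bar> \<le> dist y z" for u :: "'a \<Rightarrow> real" and N \<epsilon> x y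
  proof (cases "x = y")
    case False
    define D where "D = dist x y"
    have "D > 0" using False by (simp add: D_def)
    have "continuous_on UNIV u"
      unfolding continuous_on_iff
    proof (intro ballI allI impI)
      fix z :: 'a and e :: real assume "e > 0"
      then show "\<exists>d>0. \<forall>z'\<in>UNIV. dist z' z < d \<longrightarrow> dist (u z') (u z) < e"
        using lip[of _ z] \<epsilon> by (intro exI[of _ "min e \<epsilon>"]) (fastforce simp: dist_real_def)
    qed
    then have "u \<in> borel_measurable borel" by (rule borel_measurable_continuous_onI)
    then have [measurable]: "u \<in> borel_measurable M"
      unfolding M_def using borel by (intro measurable_completion) (simp cong: measurable_cong_sets)
    have int: "set_integrable M (ball z r) (\<lambda>y. u y)" for z r
      unfolding set_integrable_def using ballM bd
      by (intro integrableI_bounded_set_indicator[where B = N]) auto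
    have intabs: "set_integrable M (ball z r) (\<lambda>y. \<bar>u y - c\<bar>)" for z r c
      unfolding set_integrable_def using ballM
      by (intro integrableI_bounded_set_indicator[where B = "N + \<bar>c\<bar>"])
         (auto intro!: order_trans[OF abs_triangle_ineq4] add_mono bd)
    have ug: "upper_gradient UNIV u (\<lambda>_. 1)"
    proof (rule upper_gradientI)
      fix \<gamma> :: "real \<Rightarrow> 'a" assume "rectifiable_curve \<gamma>"
      then have "uniformly_continuous_on {0..1} \<gamma>"
        unfolding rectifiable_curve_def by (intro compact_uniformly_continuous) auto
      then obtain d where d: "d > 0" "\<And>s t. s \<in> {0..1} \<Longrightarrow> t \<in> {0..1} \<Longrightarrow> dist t s < d \<Longrightarrow> dist (\<gamma> t) (\<gamma> s) < \<epsilon>"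
        unfolding uniformly_continuous_on_def using \<epsilon> by meson
      show "\<exists>\<eta>>0. \<forall>s r t. 0 \<le> s \<longrightarrow> s \<le> r \<longrightarrow> r \<le> t \<longrightarrow> t \<le> 1 \<longrightarrow> t - s < \<eta> \<longrightarrow>
        ennreal \<bar>u (\<gamma> s) - u (\<gamma> t)\<bar> \<le> 1 * ennreal (dist (\<gamma> s) (\<gamma> t))"
      proof (intro exI[of _ d] conjI allI impI)
        fix s r t :: real assume "0 \<le> s" "s \<le> r" "r \<le> t" "t \<le> 1" "t - s < d"
        then show "ennreal \<bar>u (\<gamma> s) - u (\<gamma> t)\<bar> \<le> 1 * ennreal (dist (\<gamma> s) (\<gamma> t))"
          using d(2)[of t s] by (auto intro!: ennreal_leI lip simp: dist_real_def)
      qed (use d in auto)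
    qed simp
    define a where "a z r = (LINT y:ball z r|M. u y) / measure \<mu> (ball z r)" for z r
    \<comment> \<open>The upper gradient is 1, so the average of its p-th power is 1 and the
      right-hand side reduces to \<open>P * r\<close>.\<close>
    have dev: "(LINT y:ball z r|M. \<bar>u y - a z r\<bar>) \<le> P * r * measure \<mu> (ball z r)" if "r > 0" for z r
    proof -
      have nn: "(\<integral>\<^sup>+ y\<in>ball z (lam*r). epow 1 p \<partial>M) = ennreal (measure \<mu> (ball z (lam*r)))"
        using ballM(1,2)[of z "lam*r"] ballM(3)[of z "lam*r"]
        by (simp add: epow_def emeasure_eq_ennreal_measure less_top)
      have "lam * r > 0" using P that by simp
      have "(LINT y:ball z r|M. \<bar>u y - a z r\<bar>) / measure \<mu> (ball z r) \<le> P * r * 1"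
        using poin[OF that _ ug, of z] int pos[OF \<open>lam * r > 0\<close>, of z] unfolding nn
        by (simp add: Let_def a_def)
      then show ?thesis using pos[OF that, of z] by (simp add: field_simps)
    qed
    have avg: "\<bar>a z r - c\<bar> \<le> (LINT y:ball z r|M. \<bar>u y - c\<bar>) / measure \<mu> (ball z r)" if "r > 0" for z r c
      unfolding a_def using set_average_deviation[OF int ballM(1,2)] pos[OF that] by (simp add: ballM(3))
    have sub: "\<bar>a z r - a z' r'\<bar> \<le> P * r' * L"
      if "r > 0" "r' > 0" "ball z r \<subseteq> ball z' r'" "measure \<mu> (ball z' r') \<le> L * measure \<mu> (ball z r)" for z r z' r' L
    proof -
      have "\<bar>a z r - a z' r'\<bar> \<le> (LINT y:ball z r|M. \<bar>u y - a z' r'\<bar>) / measure \<mu> (ball z r)"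
        using that by (intro avg)
      also have "\<dots> \<le> (LINT y:ball z' r'|M. \<bar>u y - a z' r'\<bar>) / measure \<mu> (ball z r)"
      proof (rule divide_right_mono)
        show "(LINT y:ball z r|M. \<bar>u y - a z' r'\<bar>) \<le> (LINT y:ball z' r'|M. \<bar>u y - a z' r'\<bar>)"
          unfolding set_lebesgue_integral_def using intabs that(3)
          by (intro integral_mono) (auto simp: set_integrable_def indicator_def)
      qed simp
      also have "\<dots> \<le> (P * r' * measure \<mu> (ball z' r')) / measure \<mu> (ball z r)"
        using that by (intro divide_right_mono dev) auto
      also have "\<dots> \<le> (P * r' * (L * measure \<mu> (ball z r))) / measure \<mu> (ball z r)"
        using that P by (intro divide_right_mono mult_left_mono) auto
      also have "\<dots> = P * r' * L" using pos[OF that(1), of z] by simp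
      finally show ?thesis .
    qed
    \<comment> \<open>Partial sums of a geometric series: halving the radius \<open>R / 2^n\<close>
      changes the average by at most \<open>P * C * R / 2^n\<close>.\<close>
    have tele: "\<bar>a z (R / 2^n) - a z R\<bar> \<le> 2 * P * C * R * (1 - 1 / 2^n)" if "R > 0" for z R n
    proof (induction n)
      case (Suc n)
      have "\<bar>a z (R / 2^Suc n) - a z (R / 2^n)\<bar> \<le> P * (R / 2^n) * C"
        using dbl[of "R / 2^Suc n" z] that by (intro sub) (auto simp: field_simps intro!: subset_ball)
      moreover have "2 * P * C * R * (1 - 1 / 2^n) + P * (R / 2^n) * C = 2 * P * C * R * (1 - 1 / 2^Suc n)"
        by (simp add: field_simps)
      ultimately show ?case using Suc by linarith
    qed simp
    \<comment> \<open>Halving stops at a radius below \<epsilon>, where \<open>u\<close> itself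
      varies by at most that radius; this takes the place of Lebesgue points.\<close>
    have centre: "\<bar>a z R - u z\<bar> \<le> (2 * P * C + 1) * R" if "R > 0" for z R
    proof -
      obtain n :: nat where "R / \<epsilon> < 2^n" using real_arch_pow[of 2 "R / \<epsilon>"] by auto
      define r where "r = R / 2^n"
      have r: "r > 0" "r < \<epsilon>" "r \<le> R"
        using \<open>R / \<epsilon> < 2^n\<close> that \<epsilon> by (auto simp: r_def field_simps)
      have "\<bar>a z r - u z\<bar> \<le> (LINT y:ball z r|M. \<bar>u y - u z\<bar>) / measure \<mu> (ball z r)"
        using r by (intro avg)
      also have "\<dots> \<le> (LINT y:ball z r|M. r) / measure \<mu> (ball z r)"
      proof (intro divide_right_mono set_integral_mono intabs)
        show "set_integrable M (ball z r) (\<lambda>_. r)"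
          using ballM by (simp add: set_integrable_def)
        fix y assume "y \<in> ball z r"
        then show "\<bar>u y - u z\<bar> \<le> r" using lip[of y z] r by (simp add: dist_commute)
      qed simp
      also have "\<dots> = r" using pos[OF r(1), of z] ballM by (simp add: set_lebesgue_integral_def)
      finally have "\<bar>a z r - u z\<bar> \<le> R" using r by simp
      moreover have "\<bar>a z r - a z R\<bar> \<le> 2 * P * C * R"
        using tele[OF that, of z n] that P C unfolding r_def
        by (smt (verit, best) mult_left_le mult_nonneg_nonneg divide_nonneg_nonneg zero_le_power)
      ultimately show ?thesis by (simp add: algebra_simps)
    qed
    \<comment> \<open>The larger ball lies in the ball of radius \<open>4*D\<close> around
      \<open>y\<close>, two doublings away from \<open>ball y D\<close>; hence the square.\<close>
    have "\<bar>a y D - a x (2*D)\<bar> \<le> P * (2*D) * C^2"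
    proof (rule sub)
      show "ball y D \<subseteq> ball x (2*D)"
      proof
        fix z assume "z \<in> ball y D"
        then show "z \<in> ball x (2*D)" using dist_triangle[of x z y] by (simp add: D_def)
      qed
      have "measure \<mu> (ball x (2*D)) \<le> measure \<mu> (ball y (2*(2*D)))"
      proof (rule measure_mono_fmeasurable)
        show "ball x (2*D) \<subseteq> ball y (2*(2*D))"
        proof
          fix z assume "z \<in> ball x (2*D)"
          moreover have "dist y x = D" by (simp add: D_def dist_commute)
          ultimately show "z \<in> ball y (2*(2*D))"
            using dist_triangle[of y z x] \<open>D > 0\<close> by simp
        qed
      qed (use fin borel in \<open>auto simp: fmeasurable_def\<close>)
      also have "\<dots> \<le> C * (C * measure \<mu> (ball y D))"
        using dbl[of "2*D" y] dbl[of D y] \<open>D > 0\<close> C by (meson mult_left_mono less_imp_le order_trans mult_pos_pos zero_less_numeral)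
      finally show "measure \<mu> (ball x (2*D)) \<le> C^2 * measure \<mu> (ball y D)"
        by (simp add: power2_eq_square mult.assoc)
    qed (use \<open>D > 0\<close> in auto)
    moreover have "\<bar>a y D - u y\<bar> \<le> (2 * P * C + 1) * D" "\<bar>a x (2*D) - u x\<bar> \<le> (2 * P * C + 1) * (2*D)"
      using \<open>D > 0\<close> by (auto intro!: centre simp del: mult_le_cancel_right)
    ultimately have "\<bar>u x - u y\<bar> \<le> P * (2*D) * C^2 + (2 * P * C + 1) * D + (2 * P * C + 1) * (2*D)"
      by linarith
    also have "\<dots> \<le> K * D"
      using P C \<open>D > 0\<close> by (simp add: K_def algebra_simps)
    finally show ?thesis by (simp add: D_def)
  qed simp
  have "K > 0" using P C by (simp add: K_def add_pos_pos)
  then show ?thesis by (rule that) (rule main)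
qed

text \<open>Tychonoff's theorem. It serves for functions of a real parameter in the limit of
  \<epsilon>-chains, and later for sequences, where it takes the place of a diagonal
  argument.\<close>

lemma compact_PiE_UNIV:
  fixes K :: "'i \<Rightarrow> 'a::topological_space set"
  assumes "\<And>i. compact (K i)"
  shows "compact (PiE UNIV K)"
  using compactin_PiE[of "\<lambda>_. euclidean" UNIV K] assms
  by (simp add: euclidean_product_topology)

text \<open>The approximants may jump, so Arzela-Ascoli does not apply to them directly. Instead the
  conditions with error \<open>1 / real (Suc n)\<close> define closed sets, and a compact product of
  balls meets any finitely many of them in an approximant with small enough error. A common point of
  all of them has no error left.\<close>

lemma lipschitz_curve_limit:
  fixes x y :: "'a::metric_space"
  assumes cpt: "compact (cball x (L + 1))" and L: "L \<ge> 0"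
    and approx: "\<And>\<epsilon>. \<epsilon> > 0 \<Longrightarrow> \<exists>f. f 0 = x \<and> f L = y \<and>
      (\<forall>s t. 0 \<le> s \<longrightarrow> s \<le> t \<longrightarrow> t \<le> L \<longrightarrow> dist (f s) (f t) \<le> t - s + \<epsilon>)"
  shows "\<exists>c. 1-lipschitz_on {0..L} c \<and> c 0 = x \<and> c L = y"
proof -
  define F where "F n = {f :: real \<Rightarrow> 'a. f 0 = x \<and> f L = y \<and>
    (\<forall>s t. 0 \<le> s \<longrightarrow> s \<le> t \<longrightarrow> t \<le> L \<longrightarrow> dist (f s) (f t) \<le> t - s + 1 / real (Suc n))}" for n
  let ?K = "PiE UNIV (\<lambda>_::real. cball x (L + 1))"
  have "?K \<inter> (\<Inter>n\<in>UNIV. F n) \<noteq> {}"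
  proof (rule compact_imp_fip_image)
    show "compact ?K" by (rule compact_PiE_UNIV) (rule cpt)
    show "closed (F n)" for n
      unfolding F_def
      by (intro closed_Collect_conj closed_Collect_all closed_Collect_imp closed_Collect_le closed_Collect_eq
        continuous_intros continuous_on_product_coordinates open_Collect_const)
    fix I :: "nat set" assume "finite I"
    define n where "n = Max (insert 0 I)"
    obtain f where f: "f 0 = x" "f L = y" "\<And>s t. 0 \<le> s \<Longrightarrow> s \<le> t \<Longrightarrow> t \<le> L \<Longrightarrow> dist (f s) (f t) \<le> t - s + 1 / real (Suc n)"
      using approx[of "1 / real (Suc n)"] by auto
    \<comment> \<open>Clamping the parameter keeps all values in the ball, also outside
      \<open>[0, L]\<close>; the radius \<open>L + 1\<close> suffices because the error is at most
      1.\<close>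
    define f' where "f' t = f (max 0 (min L t))" for t
    have "f' \<in> F m" if "m \<in> I" for m
    proof -
      have "m \<le> n" using that \<open>finite I\<close> by (simp add: n_def)
      then have "1 / real (Suc n) \<le> 1 / real (Suc m)" by (simp add: frac_le)
      then show ?thesis unfolding F_def using f L by (fastforce simp: f'_def)
    qed
    moreover have "f' t \<in> cball x (L + 1)" for t
    proof -
      have "dist (f 0) (f (max 0 (min L t))) \<le> max 0 (min L t) - 0 + 1 / real (Suc n)"
        using L by (intro f(3)) auto
      also have "\<dots> \<le> L + 1" using L by (intro add_mono) auto
      finally show ?thesis by (simp add: f'_def f(1))
    qed
    ultimately show "?K \<inter> (\<Inter>n\<in>I. F n) \<noteq> {}" by blast
  qed
  then obtain c where c: "\<And>n. c \<in> F n" by blast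
  have "dist (c s) (c t) \<le> t - s" if "0 \<le> s" "s \<le> t" "t \<le> L" for s t
  proof (rule field_le_epsilon)
    fix e :: real assume "e > 0"
    then obtain n where "1 / real (Suc n) < e" by (meson nat_approx_posE)
    then show "dist (c s) (c t) \<le> t - s + e"
      using c[of n] that unfolding F_def by fastforce
  qed
  then have "1-lipschitz_on {0..L} c"
    by (intro lipschitz_on_leI) (auto simp: dist_real_def)
  then show ?thesis using c[of 0] by (auto simp: F_def)
qed

lemma weighted_chain_step_function:
  assumes "weighted_chain (\<lambda>_. \<epsilon>) (\<lambda>_. 1) x y a" "\<epsilon> > 0"
  shows "\<exists>f. f 0 = x \<and> f a = y \<and> (\<forall>s t. 0 \<le> s \<longrightarrow> s \<le> t \<longrightarrow> t \<le> a \<longrightarrow> dist (f s) (f t) \<le> t - s + \<epsilon>)"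
  using assms
proof (induction rule: weighted_chain.induct)
  case start
  then show ?case by (intro exI[of _ "\<lambda>_. x"]) auto
next
  case (step y a z)
  then obtain f where f: "f 0 = x" "f a = y"
    "\<And>s t. 0 \<le> s \<Longrightarrow> s \<le> t \<Longrightarrow> t \<le> a \<Longrightarrow> dist (f s) (f t) \<le> t - s + \<epsilon>" by blast
  have a: "a \<ge> 0" using weighted_chain_nonneg[OF step(1)] by simp
  show ?case
  proof (cases "y = z")
    case True
    then show ?thesis using f by (intro exI[of _ f]) auto
  next
    case False
    define b where "b = a + 1 * dist y z"
    have b: "a < b" "dist y z = b - a" using False by (auto simp: b_def)
    \<comment> \<open>The function rests at \<open>y\<close> until time \<open>b\<close> and then
      jumps; the jump is shorter than \<epsilon>, the permitted error.\<close>
    define f' where "f' t = (if t < b then f (min a t) else z)" for t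
    have "dist (f' s) (f' t) \<le> t - s + \<epsilon>" if st: "0 \<le> s" "s \<le> t" "t \<le> b" for s t
    proof -
      consider "t < b" | "s < b" "t = b" | "s = b" "t = b" using st by linarith
      then show ?thesis
      proof cases
        case 1
        then have "dist (f (min a s)) (f (min a t)) \<le> min a t - min a s + \<epsilon>"
          using st a by (intro f(3)) auto
        then show ?thesis using 1 st by (auto simp: f'_def min_def split: if_splits)
      next
        case 2
        have "dist (f (min a s)) z \<le> dist (f (min a s)) (f a) + dist y z"
          using f(2) dist_triangle[of "f (min a s)" z y] by simp
        also have "\<dots> \<le> b - s + \<epsilon>"
        proof (cases "s \<le> a")
          case True
          then show ?thesis using f(3)[of s a] st b by (simp add: min_absorb2)
        next
          case False
          then show ?thesis using 2 step.hyps(2) by (simp add: min_absorb1)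
        qed
        finally show ?thesis using 2 by (simp add: f'_def)
      next
        case 3
        then show ?thesis using \<open>\<epsilon> > 0\<close> by (simp add: f'_def)
      qed
    qed
    moreover have "f' 0 = x" "f' b = z" using a b f by (auto simp: f'_def)
    ultimately show ?thesis unfolding b_def by blast
  qed
qed

text \<open>The \<open>\<epsilon>\<close>-chain distance from \<open>x\<close>, truncated, has upper gradient 1, so the Poincare inequality makes
  it Lipschitz with a constant independent of \<open>\<epsilon>\<close>. The chains converge to a curve as \<open>\<epsilon> \<rightarrow> 0\<close>.\<close>

lemma poincare_quasiconvex:
  fixes \<mu> :: "'a::complete_space measure"
  assumes dm: "doubling_measure \<mu>" and P: "poincare p \<mu>"
  obtains C where "C \<ge> 1" "\<And>x y :: 'a. \<exists>c. 1-lipschitz_on {0..C * dist x y} c \<and> c 0 = x \<and> c (C * dist x y) = y"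
proof -
  obtain K where K: "K > 0" and lip: "\<And>(u :: 'a \<Rightarrow> real) N \<epsilon> x y. \<epsilon> > 0 \<Longrightarrow> (\<And>z. \<bar>u z\<bar> \<le> N) \<Longrightarrow>
      (\<And>y z. dist y z < \<epsilon> \<Longrightarrow> \<bar>u y - u z\<bar> \<le> dist y z) \<Longrightarrow> \<bar>u x - u y\<bar> \<le> K * dist x y"
    using poincare_lipschitz[OF dm P] by blast
  have "\<exists>c. 1-lipschitz_on {0..(K + 1) * dist x y} c \<and> c 0 = x \<and> c ((K + 1) * dist x y) = y" for x y :: 'a
  proof (cases "x = y")
    case True
    then show ?thesis by (intro exI[of _ "\<lambda>_. x"]) auto
  next
    case False
    \<comment> \<open>Taking \<open>K + 1\<close> instead of \<open>K\<close> puts the Lipschitz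
      bound strictly below the truncation level \<open>L\<close>, so the value at \<open>y\<close>
      is witnessed by a genuine chain.\<close>
    define L where "L = (K + 1) * dist x y"
    have L: "K * dist x y < L" "L \<ge> 0" using False K by (auto simp: L_def algebra_simps)
    have "\<exists>c. 1-lipschitz_on {0..L} c \<and> c 0 = x \<and> c L = y"
    proof (rule lipschitz_curve_limit[OF doubling_compact_cball[OF dm] L(2)])
      fix \<epsilon> :: real assume \<epsilon>: "\<epsilon> > 0"
      define u where "u = truncated_cost (\<lambda>_. \<epsilon>) (\<lambda>_. 1) x L"
      have bounds: "0 \<le> u z" "u z \<le> L" for z
        unfolding u_def using L by (auto intro: truncated_cost_nonneg truncated_cost_le)
      have step: "u z \<le> u y + dist y z" if "dist y z < \<epsilon>" for y z
        unfolding u_def using truncated_cost_step[of "\<lambda>_. 1" L y z "\<lambda>_. \<epsilon>" x] L that by simp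
      have "u x \<le> 0"
        unfolding u_def using L by (intro truncated_cost_le_chain weighted_chain.start) auto
      moreover have "\<bar>u x - u y\<bar> \<le> K * dist x y"
      proof (rule lip[OF \<epsilon>])
        show "\<bar>u z\<bar> \<le> L" for z using bounds[of z] by simp
        show "\<bar>u y - u z\<bar> \<le> dist y z" if "dist y z < \<epsilon>" for y z
          using step[of y z] step[of z y] that by (simp add: dist_commute abs_le_iff)
      qed
      ultimately have "u y < L" using L bounds[of x] by linarith
      then obtain a where a: "a < L" "weighted_chain (\<lambda>_. \<epsilon>) (\<lambda>_. 1) x y a"
        unfolding u_def using truncated_cost_less_chain[of "\<lambda>_. 1" L "\<lambda>_. \<epsilon>" x y L] L by auto
      then obtain f where f: "f 0 = x" "f a = y" "\<And>s t. 0 \<le> s \<Longrightarrow> s \<le> t \<Longrightarrow> t \<le> a \<Longrightarrow> dist (f s) (f t) \<le> t - s + \<epsilon>"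
        using weighted_chain_step_function[OF a(2) \<epsilon>] by blast
      have a0: "a \<ge> 0" using weighted_chain_nonneg[OF a(2)] by simp
      show "\<exists>f. f 0 = x \<and> f L = y \<and> (\<forall>s t. 0 \<le> s \<longrightarrow> s \<le> t \<longrightarrow> t \<le> L \<longrightarrow> dist (f s) (f t) \<le> t - s + \<epsilon>)"
      proof (intro exI[of _ "\<lambda>t. f (min a t)"] conjI allI impI)
        fix s t :: real assume "0 \<le> s" "s \<le> t" "t \<le> L"
        then have "dist (f (min a s)) (f (min a t)) \<le> min a t - min a s + \<epsilon>"
          using a0 by (intro f(3)) auto
        then show "dist (f (min a s)) (f (min a t)) \<le> t - s + \<epsilon>"
          using \<open>s \<le> t\<close> by (auto simp: min_def split: if_splits)
      qed (use a a0 f in auto)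
    qed
    then show ?thesis by (simp add: L_def)
  qed
  then show ?thesis using K by (intro that[of "K + 1"]) auto
qed

section \<open>Paths with a bound on their length\<close>

text \<open>A 1-Lipschitz parametrisation on \<open>[0, l]\<close> controls length and diameter by
  the single number \<open>l\<close>. It is merely an upper bound for the length, so it can be
  rounded up freely (\<open>lip_path_pad\<close>).\<close>

definition lip_path :: "'a::metric_space set \<Rightarrow> real \<Rightarrow> 'a \<Rightarrow> 'a \<Rightarrow> bool" where
  "lip_path A l x y \<longleftrightarrow> 0 \<le> l \<and> (\<exists>c. 1-lipschitz_on {0..l} c \<and> c ` {0..l} \<subseteq> A \<and> c 0 = x \<and> c l = y)"

lemma lip_path_refl: "x \<in> A \<Longrightarrow> 0 \<le> l \<Longrightarrow> lip_path A l x x"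
  unfolding lip_path_def by (intro conjI exI[of _ "\<lambda>_. x"]) (auto intro!: lipschitz_on_leI)

lemma lip_path_mono: "lip_path A l x y \<Longrightarrow> A \<subseteq> B \<Longrightarrow> lip_path B l x y"
  unfolding lip_path_def by blast

lemma lip_path_mem: "lip_path A l x y \<Longrightarrow> x \<in> A \<and> y \<in> A"
  unfolding lip_path_def by force

lemma lip_path_shift:
  assumes "1-lipschitz_on {a..b} c" "a \<le> b" "c ` {a..b} \<subseteq> A"
  shows "lip_path A (b - a) (c a) (c b)"
  unfolding lip_path_def
proof (intro conjI exI[of _ "\<lambda>t. c (t + a)"])
  show "1-lipschitz_on {0..b - a} (\<lambda>t. c (t + a))"
  proof (rule lipschitz_onI)
    fix s t assume "s \<in> {0..b - a}" "t \<in> {0..b - a}"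
    then have "dist (c (s + a)) (c (t + a)) \<le> 1 * dist (s + a) (t + a)"
      by (intro lipschitz_onD[OF assms(1)]) auto
    then show "dist (c (s + a)) (c (t + a)) \<le> 1 * dist s t" by (simp add: dist_real_def)
  qed simp
  show "(\<lambda>t. c (t + a)) ` {0..b - a} \<subseteq> A" using assms(3) by force
qed (use assms(2) in auto)

lemma lipschitz_concat_shift:
  fixes l m :: real
  assumes "1-lipschitz_on {0..l} c" "1-lipschitz_on {0..m} c'" "c l = c' 0" "0 \<le> l"
  shows "1-lipschitz_on {0..l + m} (\<lambda>t. if t \<le> l then c t else c' (t - l))"
proof (rule lipschitz_on_concat)
  show "1-lipschitz_on {l..l + m} (\<lambda>t. c' (t - l))"
  proof (rule lipschitz_onI)
    fix s t assume "s \<in> {l..l + m}" "t \<in> {l..l + m}"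
    then have "dist (c' (s - l)) (c' (t - l)) \<le> 1 * dist (s - l) (t - l)"
      by (intro lipschitz_onD[OF assms(2)]) auto
    then show "dist (c' (s - l)) (c' (t - l)) \<le> 1 * dist s t" by (simp add: dist_real_def)
  qed simp
qed (use assms in auto)

lemma lip_path_trans:
  assumes "lip_path A l x y" "lip_path A m y z"
  shows "lip_path A (l + m) x z"
proof -
  obtain c c' where c: "0 \<le> l" "1-lipschitz_on {0..l} c" "c ` {0..l} \<subseteq> A" "c 0 = x" "c l = y"
    and c': "0 \<le> m" "1-lipschitz_on {0..m} c'" "c' ` {0..m} \<subseteq> A" "c' 0 = y" "c' m = z"
    using assms unfolding lip_path_def by blast
  let ?f = "\<lambda>t. if t \<le> l then c t else c' (t - l)"
  have "1-lipschitz_on {0..l + m} ?f"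
    using c c' by (intro lipschitz_concat_shift) auto
  moreover have "?f ` {0..l + m} \<subseteq> A" using c c' by (auto simp: image_subset_iff)
  moreover have "?f 0 = x" "?f (l + m) = z" using c c' by auto
  ultimately show ?thesis
    unfolding lip_path_def using c(1) c'(1) by (intro conjI exI[of _ ?f]) auto
qed

lemma lip_path_pad: "lip_path A l x y \<Longrightarrow> l \<le> m \<Longrightarrow> lip_path A m x y"
  using lip_path_trans[of A l x y "m - l" y] lip_path_refl[of y A "m - l"] lip_path_mem[of A l x y] by simp

lemma lip_path_sym:
  assumes "lip_path A l x y" shows "lip_path A l y x"
proof -
  obtain c where c: "0 \<le> l" "1-lipschitz_on {0..l} c" "c ` {0..l} \<subseteq> A" "c 0 = x" "c l = y"
    using assms unfolding lip_path_def by blast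
  show ?thesis
    unfolding lip_path_def
  proof (intro conjI exI[of _ "\<lambda>t. c (l - t)"])
    show "1-lipschitz_on {0..l} (\<lambda>t. c (l - t))"
    proof (rule lipschitz_onI)
      fix s t assume "s \<in> {0..l}" "t \<in> {0..l}"
      then have "dist (c (l - s)) (c (l - t)) \<le> 1 * dist (l - s) (l - t)"
        by (intro lipschitz_onD[OF c(2)]) auto
      then show "dist (c (l - s)) (c (l - t)) \<le> 1 * dist s t" by (simp add: dist_real_def)
    qed simp
  qed (use c in \<open>auto simp: image_subset_iff\<close>)
qed

lemma lipschitz_image_continuum:
  assumes "1-lipschitz_on {a..b} c" "a \<le> (b::real)"
  shows "compact (c ` {a..b})" "connected (c ` {a..b})" "diameter (c ` {a..b}) \<le> b - a"
proof -
  have "continuous_on {a..b} c" using assms(1) by (rule lipschitz_on_continuous_on)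
  then show "compact (c ` {a..b})" "connected (c ` {a..b})"
    by (auto intro: compact_continuous_image connected_continuous_image)
  show "diameter (c ` {a..b}) \<le> b - a"
  proof -
    have "dist x y \<le> b - a" if "x \<in> c ` {a..b}" "y \<in> c ` {a..b}" for x y
    proof -
      obtain s t where st: "s \<in> {a..b}" "t \<in> {a..b}" "x = c s" "y = c t" using \<open>x \<in> _\<close> \<open>y \<in> _\<close> by blast
      then have "dist x y \<le> dist s t" using lipschitz_onD[OF assms(1), of s t] by simp
      also have "\<dots> \<le> b - a" using st by (auto simp: dist_real_def)
      finally show ?thesis .
    qed
    moreover have "c ` {a..b} \<noteq> {}" using assms by auto
    ultimately show ?thesis
      unfolding diameter_def by (auto intro!: cSUP_least)
  qed
qed

text \<open>Turns a path into a competitor in the infimum defining the Mazurkiewicz metric.\<close>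

lemma lip_path_continuum:
  assumes "lip_path A l x y"
  obtains K where "compact K" "connected K" "K \<subseteq> A" "x \<in> K" "y \<in> K" "diameter K \<le> l"
proof -
  obtain c where c: "0 \<le> l" "1-lipschitz_on {0..l} c" "c ` {0..l} \<subseteq> A" "c 0 = x" "c l = y"
    using assms unfolding lip_path_def by blast
  show ?thesis
    using lipschitz_image_continuum[OF c(2,1)] c by (intro that[of "c ` {0..l}"]) force+
qed

lemma diameter_leI:
  assumes "S \<noteq> {}" "\<And>x y. x \<in> S \<Longrightarrow> y \<in> S \<Longrightarrow> dist x y \<le> d"
  shows "diameter S \<le> d"
  unfolding diameter_def using assms by (auto intro!: cSUP_least)

lemma lipschitz_curve_length:
  assumes "L-lipschitz_on {a..b} \<gamma>" "a \<le> b"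
  shows "curve_length \<gamma> a b \<le> ennreal (L * (b - a))"
proof (rule curve_length_leI)
  fix n :: nat and t :: "nat \<Rightarrow> real"
  assume t: "t 0 = a" "t n = b" and mono: "\<And>i. i < n \<Longrightarrow> t i \<le> t (Suc i)"
  have "(\<Sum>i<n. dist (\<gamma> (t i)) (\<gamma> (t (Suc i)))) \<le> (\<Sum>i<n. L * (t (Suc i) - t i))"
  proof (rule sum_mono)
    fix i assume "i \<in> {..<n}"
    then have "i < n" by simp
    have "a \<le> t i" "t (Suc i) \<le> b" "t i \<le> t (Suc i)"
      using partition_mono[of n t 0 i] partition_mono[of n t "Suc i" n] mono t \<open>i < n\<close> by auto
    then show "dist (\<gamma> (t i)) (\<gamma> (t (Suc i))) \<le> L * (t (Suc i) - t i)"
      using lipschitz_onD[OF assms(1), of "t i" "t (Suc i)"] by (simp add: dist_real_def)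
  qed
  also have "\<dots> = L * (b - a)"
    using t by (simp add: sum_distrib_left[symmetric] sum_lessThan_telescope)
  finally show "(\<Sum>i<n. ennreal (dist (\<gamma> (t i)) (\<gamma> (t (Suc i))))) \<le> ennreal (L * (b - a))"
    by (simp add: sum_ennreal ennreal_leI)
qed

lemma chain_divides_refl: "chain_divides E E"
  unfolding chain_divides_def by blast

lemma chain_divides_impression:
  assumes "chain_divides E F"
  shows "(\<Inter>k. closure (E k)) \<subseteq> (\<Inter>k. closure (F k))"
proof (rule INT_greatest)
  fix k
  obtain l where "E l \<subseteq> F k" using assms unfolding chain_divides_def by blast
  then show "(\<Inter>k. closure (E k)) \<subseteq> closure (F k)" using closure_mono by blast
qed

subsection \<open>Chains and accessible prime ends\<close>

locale bounded_domain =
  fixes \<Omega> :: "'a::complete_space set" and C :: real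
  assumes C: "C \<ge> 1" and quasiconvex: "\<And>x y :: 'a. lip_path UNIV (C * dist x y) x y"
    and proper: "\<And>S :: 'a set. closed S \<Longrightarrow> bounded S \<Longrightarrow> compact S"
    and dom: "open \<Omega>" "connected \<Omega>" "\<Omega> \<noteq> {}" "bounded \<Omega>" "\<Omega> \<noteq> UNIV"
begin

text \<open>The quasiconvexity curve is too short to leave the ball around its starting
  point.\<close>

lemma lip_path_in_ball:
  fixes x y :: 'a
  assumes "ball x r \<subseteq> A" "C * dist x y < r"
  shows "lip_path A (C * dist x y) x y"
proof -
  obtain c where c: "0 \<le> C * dist x y" "1-lipschitz_on {0..C * dist x y} c" "c 0 = x" "c (C * dist x y) = y"
    using quasiconvex[of x y] unfolding lip_path_def by blast
  have "c t \<in> A" if "t \<in> {0..C * dist x y}" for t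
  proof -
    have "dist (c 0) (c t) \<le> t" using lipschitz_onD[OF c(2), of 0 t] that by (auto simp: dist_real_def)
    then show ?thesis using assms c(3) that by auto
  qed
  then show ?thesis using c unfolding lip_path_def by blast
qed

text \<open>The component of \<open>x\<close> in \<open>A\<close> with respect to rectifiable paths.
  For open \<open>A\<close> it is open and relatively closed, because nearby points are joined by
  short curves inside \<open>A\<close>.\<close>

definition reach :: "'a set \<Rightarrow> 'a \<Rightarrow> 'a set" where
  "reach A x = {y. \<exists>l. lip_path A l x y}"

lemma reach_subset: "reach A x \<subseteq> A"
  unfolding reach_def using lip_path_mem by blast

lemma reach_closed:
  assumes "open A" "y \<in> A" "y \<in> closure (reach A x)"
  shows "y \<in> reach A x"
proof -
  obtain r where r: "r > 0" "ball y r \<subseteq> A" using assms by (meson open_contains_ball)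
  then have "r / C > 0" using C by simp
  then obtain z where z: "z \<in> reach A x" "dist z y < r / C"
    using assms(3) closure_approachable by blast
  then have "C * dist y z < r" using C by (simp add: field_simps dist_commute)
  then have "lip_path A (C * dist y z) y z" using r by (intro lip_path_in_ball)
  then show ?thesis using z unfolding reach_def by (blast intro: lip_path_trans lip_path_sym)
qed

lemma open_reach:
  assumes "open A"
  shows "open (reach A x)"
  unfolding open_contains_ball
proof
  fix y assume y: "y \<in> reach A x"
  then obtain r where r: "r > 0" "ball y r \<subseteq> A" using assms reach_subset by (meson open_contains_ball subsetD)
  have "ball y (r / C) \<subseteq> reach A x"
  proof
    fix z assume "z \<in> ball y (r / C)"
    then have "C * dist y z < r" using C by (simp add: field_simps)
    then have "lip_path A (C * dist y z) y z" using r by (intro lip_path_in_ball)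
    then show "z \<in> reach A x" using y unfolding reach_def by (blast intro: lip_path_trans)
  qed
  then show "\<exists>e>0. ball y e \<subseteq> reach A x" using r C by (intro exI[of _ "r / C"]) simp
qed

lemma connected_reach: "connected (reach A x)"
proof -
  have *: "\<exists>K. connected K \<and> K \<subseteq> reach A x \<and> x \<in> K \<and> y \<in> K" if y: "y \<in> reach A x" for y
  proof -
    obtain l :: real and c where c: "0 \<le> l" "1-lipschitz_on {0..l} c" "c ` {0..l} \<subseteq> A" "c 0 = x" "c l = y"
      using y unfolding reach_def lip_path_def by blast
    have "c t \<in> reach A x" if "t \<in> {0..l}" for t
    proof -
      have "c ` {0..t} \<subseteq> c ` {0..l}" using that by (intro image_mono) auto
      then have "lip_path A (t - 0) (c 0) (c t)"
        using that c(3) by (intro lip_path_shift lipschitz_on_subset[OF c(2)]) auto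
      then show ?thesis using c(4) by (auto simp: reach_def)
    qed
    then have "c ` {0..l} \<subseteq> reach A x" by (rule image_subsetI)
    moreover have "x \<in> c ` {0..l}" "y \<in> c ` {0..l}" using c by (auto intro: rev_image_eqI)
    ultimately show ?thesis
      using lipschitz_image_continuum(2)[OF c(2,1)] by blast
  qed
  have "reach A x = \<Union>{K. connected K \<and> K \<subseteq> reach A x \<and> x \<in> K}"
  proof
    show "reach A x \<subseteq> \<Union>{K. connected K \<and> K \<subseteq> reach A x \<and> x \<in> K}"
      using * by (intro subsetI) (simp only: Union_iff mem_Collect_eq Bex_def, meson)
  qed auto
  also have "connected \<dots>" by (rule connected_Union) auto
  finally show ?thesis .
qed

lemma lip_path_connected:
  fixes x y :: 'a
  assumes "open A" "connected A" "x \<in> A" "y \<in> A"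
  shows "\<exists>l. lip_path A l x y"
proof (rule ccontr)
  assume "\<not> ?thesis"
  then have "y \<notin> reach A x" by (simp add: reach_def)
  moreover have "x \<in> reach A x" using assms lip_path_refl[of x A 0] by (auto simp: reach_def)
  ultimately have "A \<inter> frontier (reach A x) \<noteq> {}"
    using assms by (intro connected_Int_frontier) auto
  then show False
    using reach_closed[OF assms(1)] open_reach[OF assms(1)]
    by (auto simp: frontier_def interior_open)
qed

section \<open>The Mazurkiewicz metric and chains\<close>

lemma mazurkiewicz_le:
  assumes "compact K" "connected K" "K \<subseteq> \<Omega>" "x \<in> K" "y \<in> K"
  shows "mazurkiewicz \<Omega> x y \<le> diameter K"
  unfolding mazurkiewicz_def
proof (rule cInf_lower)
  show "bdd_below {diameter E |E. compact E \<and> connected E \<and> E \<subseteq> \<Omega> \<and> x \<in> E \<and> y \<in> E}"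
    by (intro bdd_belowI[of _ 0]) (auto intro!: diameter_ge_0 compact_imp_bounded)
qed (use assms in blast)

lemma dist_le_mazurkiewicz:
  assumes "x \<in> \<Omega>" "y \<in> \<Omega>"
  shows "dist x y \<le> mazurkiewicz \<Omega> x y"
  unfolding mazurkiewicz_def
proof (rule cInf_greatest)
  \<comment> \<open>A joining curve shows that the set of diameters is nonempty; otherwise its
    \<open>Inf\<close> would be unspecified.\<close>
  obtain l where "lip_path \<Omega> l x y" using lip_path_connected[OF dom(1,2) assms] by blast
  then obtain K where "compact K" "connected K" "K \<subseteq> \<Omega>" "x \<in> K" "y \<in> K"
    by (rule lip_path_continuum)
  then have "diameter K \<in> {diameter E |E. compact E \<and> connected E \<and> E \<subseteq> \<Omega> \<and> x \<in> E \<and> y \<in> E}" by auto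
  then show "{diameter E |E. compact E \<and> connected E \<and> E \<subseteq> \<Omega> \<and> x \<in> E \<and> y \<in> E} \<noteq> {}"
    by (metis empty_iff)
qed (auto intro!: diameter_bounded_bound compact_imp_bounded)

lemma dist_M_le:
  assumes "A \<subseteq> \<Omega>" "B \<subseteq> \<Omega>" "x \<in> A" "y \<in> B"
  shows "dist_M \<Omega> A B \<le> mazurkiewicz \<Omega> x y"
  unfolding dist_M_def
proof (rule cInf_lower)
  have "0 \<le> mazurkiewicz \<Omega> x y" if "x \<in> A" "y \<in> B" for x y
    using dist_le_mazurkiewicz[of x y] zero_le_dist[of x y] that assms(1,2) by (meson order_trans subsetD)
  then show "bdd_below {mazurkiewicz \<Omega> x y |x y. x \<in> A \<and> y \<in> B}"
    by (intro bdd_belowI[of _ 0]) auto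
qed (use assms in blast)

text \<open>Connectedness of \<Omega> keeps \<open>dist_M\<close> between frontiers from being the
  infimum of an empty set.\<close>

lemma acceptable_frontier:
  assumes "acceptable \<Omega> E"
  shows "\<Omega> \<inter> frontier E \<noteq> {}"
proof -
  have "E \<noteq> {}" "E \<subset> \<Omega>" using assms by (auto simp: acceptable_def)
  then show ?thesis using dom(2) by (intro connected_Int_frontier) auto
qed

text \<open>A connected set that meets \<open>E (Suc k)\<close> and leaves \<open>E k\<close>
  crosses both frontiers inside \<Omega>, so its diameter is at least their Mazurkiewicz distance.
  Positivity of that distance is exploited mainly in this form.\<close>

lemma chain_continuum_subset:
  assumes E: "pe_chain \<Omega> E" and K: "compact K" "connected K" "K \<subseteq> \<Omega>" "K \<inter> E (Suc k) \<noteq> {}"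
    and diam: "diameter K < dist_M \<Omega> (\<Omega> \<inter> frontier (E (Suc k))) (\<Omega> \<inter> frontier (E k))"
  shows "K \<subseteq> E k"
proof (rule ccontr)
  assume not: "\<not> K \<subseteq> E k"
  have sub: "E (Suc k) \<subseteq> E k" using E by (simp add: pe_chain_def)
  obtain x where x: "x \<in> K" "x \<in> frontier (E (Suc k))"
    using connected_Int_frontier[OF K(2), of "E (Suc k)"] K not sub by blast
  obtain y where y: "y \<in> K" "y \<in> frontier (E k)"
    using connected_Int_frontier[OF K(2), of "E k"] K not sub by blast
  have "dist_M \<Omega> (\<Omega> \<inter> frontier (E (Suc k))) (\<Omega> \<inter> frontier (E k)) \<le> mazurkiewicz \<Omega> x y"
    using x y K by (intro dist_M_le) auto
  also have "\<dots> \<le> diameter K" using x y K by (intro mazurkiewicz_le)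
  finally show False using diam by simp
qed

text \<open>A common frontier point of consecutive sets would put their frontiers at Mazurkiewicz
  distance 0. Hence the interiors of the sets of a chain are neighbourhoods of its end.\<close>

lemma chain_interior:
  assumes E: "pe_chain \<Omega> E"
  shows "\<Omega> \<inter> closure (E (Suc k)) \<subseteq> interior (E k)"
proof
  fix x assume x: "x \<in> \<Omega> \<inter> closure (E (Suc k))"
  have sub: "E (Suc k) \<subseteq> E k" and pos: "dist_M \<Omega> (\<Omega> \<inter> frontier (E (Suc k))) (\<Omega> \<inter> frontier (E k)) > 0"
    using E by (simp_all add: pe_chain_def)
  show "x \<in> interior (E k)"
  proof (rule ccontr)
    assume "x \<notin> interior (E k)"
    then have "x \<in> frontier (E k)" "x \<in> frontier (E (Suc k))"
      using x closure_mono[OF sub] interior_mono[OF sub] by (auto simp: frontier_def)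
    then have "dist_M \<Omega> (\<Omega> \<inter> frontier (E (Suc k))) (\<Omega> \<inter> frontier (E k)) \<le> mazurkiewicz \<Omega> x x"
      using x by (intro dist_M_le) auto
    also have "\<dots> \<le> diameter {x}" using x by (intro mazurkiewicz_le) auto
    finally show False using pos by simp
  qed
qed

lemma curve_end_in_frontier:
  fixes S :: real
  assumes E: "pe_chain \<Omega> E" and \<Gamma>: "1-lipschitz_on {0..S} \<Gamma>" "S > 0"
    and tail: "\<And>k. \<exists>t\<in>{0<..<S}. \<Gamma> ` {t<..<S} \<subseteq> E k"
  shows "\<Gamma> S \<in> frontier \<Omega>"
proof -
  have "\<Gamma> S \<in> closure (E k)" for k
    unfolding closure_approachable
  proof (intro allI impI)
    fix e :: real assume "e > 0"
    obtain t where t: "t \<in> {0<..<S}" "\<Gamma> ` {t<..<S} \<subseteq> E k" using tail by blast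
    define s where "s = max ((t + S) / 2) (S - e / 2)"
    have s: "t < s" "s < S" "S - e < s" using t \<open>e > 0\<close> by (auto simp: s_def less_max_iff_disj)
    then have "dist (\<Gamma> s) (\<Gamma> S) < e"
      using lipschitz_onD[OF \<Gamma>(1), of s S] t by (auto simp: dist_real_def)
    moreover have "\<Gamma> s \<in> E k" using t(2) s by (auto simp: image_subset_iff)
    ultimately show "\<exists>y\<in>E k. dist y (\<Gamma> S) < e" by blast
  qed
  then show ?thesis using E unfolding pe_chain_def by blast
qed

text \<open>The components of \<open>\<Omega> \<inter> ball z r\<close> containing the end of the curve form a chain with
  impression \<open>{z}\<close> that divides the given prime end, hence represents it.\<close>

lemma rect_accessibleI:
  fixes S :: real
  assumes e: "e \<in> prime_ends \<Omega>" and Ee: "E \<in> e"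
    and \<Gamma>: "1-lipschitz_on {0..S} \<Gamma>" "S > 0" "\<Gamma> ` {0..<S} \<subseteq> \<Omega>"
    and tail: "\<And>k. \<exists>t\<in>{0<..<S}. \<Gamma> ` {t<..<S} \<subseteq> E k"
  shows "e \<in> rect_accessible_prime_ends \<Omega>"
proof -
  have E: "pe_chain \<Omega> E" using e Ee unfolding prime_ends_def pe_ends_def by blast
  define z where "z = \<Gamma> S"
  have z: "z \<in> frontier \<Omega>" unfolding z_def using E \<Gamma>(1,2) tail by (rule curve_end_in_frontier)
  then have "z \<notin> \<Omega>" using dom(1) by (simp add: frontier_def interior_open)
  obtain w where w: "w \<in> \<Omega>" using dom by blast
  \<comment> \<open>Radii at most \<open>dist z w\<close> keep the point \<open>w\<close> of
    \<Omega> out of every ball, so the components are proper subsets of \<Omega>.\<close>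
  define r where "r l = dist z w / real (Suc l)" for l
  have "dist z w > 0" using w \<open>z \<notin> \<Omega>\<close> by auto
  then have r: "r l > 0" "r l \<le> dist z w" "r (Suc l) < r l" for l
    by (auto simp: r_def field_simps)
  define A where "A l = \<Omega> \<inter> ball z (r l)" for l
  have openA: "open (A l)" for l using dom by (auto simp: A_def)
  \<comment> \<open>The minimum keeps \<open>\<tau> l\<close> positive, and the half puts the curve
    strictly inside the ball from time \<open>\<tau> l\<close> on.\<close>
  define \<tau> where "\<tau> l = S - min S (r l) / 2" for l
  have \<tau>: "0 < \<tau> l" "\<tau> l < S" for l using r[of l] \<Gamma>(2) by (auto simp: \<tau>_def min_def)
  have \<Gamma>A: "\<Gamma> t \<in> A l" if "\<tau> l \<le> t" "t < S" for t l
  proof -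
    have "dist (\<Gamma> t) z \<le> S - t"
      unfolding z_def using lipschitz_onD[OF \<Gamma>(1), of t S] that \<tau>[of l] by (auto simp: dist_real_def)
    also have "\<dots> < r l" using that r[of l] by (auto simp: \<tau>_def min_def split: if_splits)
    finally show ?thesis using \<Gamma>(3) that \<tau>[of l] by (auto simp: A_def dist_commute)
  qed
  define F where "F l = reach (A l) (\<Gamma> (\<tau> l))" for l
  have \<Gamma>F: "\<Gamma> t \<in> F l" if "\<tau> l \<le> t" "t < S" for t l
  proof -
    have "lip_path (A l) (t - \<tau> l) (\<Gamma> (\<tau> l)) (\<Gamma> t)"
      using that \<tau>[of l] \<Gamma>A by (intro lip_path_shift lipschitz_on_subset[OF \<Gamma>(1)]) auto
    then show ?thesis by (auto simp: F_def reach_def)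
  qed
  have FA: "F l \<subseteq> A l" for l unfolding F_def by (rule reach_subset)
  have zF: "z \<in> closure (F l)" for l
    unfolding closure_approachable
  proof (intro allI impI)
      fix e :: real assume "e > 0"
      define s where "s = max (\<tau> l) (S - e / 2)"
      have s: "\<tau> l \<le> s" "s < S" "S - e < s" using \<tau>[of l] \<open>e > 0\<close> by (auto simp: s_def less_max_iff_disj)
      then have "dist (\<Gamma> s) z < e"
        unfolding z_def using lipschitz_onD[OF \<Gamma>(1), of s S] \<tau>[of l] by (auto simp: dist_real_def)
      then show "\<exists>y\<in>F l. dist y z < e" using \<Gamma>F s by blast
  qed
  have accF: "acceptable \<Omega> (F l)" for l
    unfolding acceptable_def
  proof (intro conjI)
    show "connected (F l)" unfolding F_def by (rule connected_reach)
    have "w \<notin> F l" using FA[of l] r(2)[of l] by (auto simp: A_def)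
    then show "F l \<subset> \<Omega>" using FA[of l] w by (auto simp: A_def)
    show "closure (F l) \<inter> frontier \<Omega> \<noteq> {}" using z zF by blast
  qed
  have clF: "closure (F l) \<subseteq> cball z (r l)" for l
    using FA[of l] by (intro closure_minimal) (auto simp: A_def)
  \<comment> \<open>A component is open and relatively closed in \<open>A l\<close>, so inside
    \<Omega> its frontier lies on the sphere of radius \<open>r l\<close>. Consecutive frontiers are
    thus \<open>r l - r (Suc l)\<close> apart in \<open>dist\<close>, hence in the larger
    Mazurkiewicz metric.\<close>
  have frF: "dist z x = r l" if "x \<in> \<Omega>" "x \<in> frontier (F l)" for x l
  proof (rule ccontr)
    assume "dist z x \<noteq> r l"
    then have "x \<in> A l" using that clF[of l] by (auto simp: A_def frontier_def)
    then have "x \<in> F l" unfolding F_def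
      using that openA by (intro reach_closed) (auto simp: frontier_def F_def)
    moreover have "open (F l)" unfolding F_def by (intro open_reach openA)
    ultimately show False using that by (simp add: frontier_def interior_open)
  qed
  have impF: "(\<Inter>l. closure (F l)) = {z}"
  proof
    show "(\<Inter>l. closure (F l)) \<subseteq> {z}"
    proof
      fix x assume x: "x \<in> (\<Inter>l. closure (F l))"
      have "dist z x \<le> r l" for l using x clF[of l] by auto
      moreover have "r \<longlonglongrightarrow> 0"
        unfolding r_def using LIMSEQ_Suc[OF lim_const_over_n] by blast
      ultimately have "dist z x \<le> 0" by (intro LIMSEQ_le_const) auto
      then show "x \<in> {z}" by simp
    qed
  qed (use zF in auto)
  have F: "pe_chain \<Omega> F"
    unfolding pe_chain_def
  proof (intro conjI allI accF)
    fix l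
    show "F (Suc l) \<subseteq> F l"
    proof
      fix y assume "y \<in> F (Suc l)"
      then obtain m where "lip_path (A (Suc l)) m (\<Gamma> (\<tau> (Suc l))) y" by (auto simp: F_def reach_def)
      then have "lip_path (A l) m (\<Gamma> (\<tau> (Suc l))) y"
        by (rule lip_path_mono) (use r(3)[of l] in \<open>auto simp: A_def\<close>)
      moreover have "\<Gamma> (\<tau> (Suc l)) \<in> F l"
        using r(3)[of l] \<tau>[of "Suc l"] by (intro \<Gamma>F) (auto simp: \<tau>_def)
      ultimately show "y \<in> F l" unfolding F_def reach_def by (auto intro: lip_path_trans)
    qed
    have "r l - r (Suc l) \<le> dist_M \<Omega> (\<Omega> \<inter> frontier (F (Suc l))) (\<Omega> \<inter> frontier (F l))"
      unfolding dist_M_def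
    proof (rule cInf_greatest)
      show "{mazurkiewicz \<Omega> x y |x y. x \<in> \<Omega> \<inter> frontier (F (Suc l)) \<and> y \<in> \<Omega> \<inter> frontier (F l)} \<noteq> {}"
        using acceptable_frontier[OF accF, of l] acceptable_frontier[OF accF, of "Suc l"] by blast
      fix m assume "m \<in> {mazurkiewicz \<Omega> x y |x y. x \<in> \<Omega> \<inter> frontier (F (Suc l)) \<and> y \<in> \<Omega> \<inter> frontier (F l)}"
      then obtain x y where xy: "m = mazurkiewicz \<Omega> x y" "x \<in> \<Omega>" "x \<in> frontier (F (Suc l))"
        "y \<in> \<Omega>" "y \<in> frontier (F l)" by blast
      have "r l - r (Suc l) \<le> dist x y"
        using frF[OF xy(2,3)] frF[OF xy(4,5)] dist_triangle[of z y x] by simp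
      then show "r l - r (Suc l) \<le> m" using dist_le_mazurkiewicz[OF xy(2,4)] xy(1) by simp
    qed
    then show "0 < dist_M \<Omega> (\<Omega> \<inter> frontier (F (Suc l))) (\<Omega> \<inter> frontier (F l))"
      using r(3)[of l] by simp
  qed (use impF z in auto)
  have "chain_divides F E"
    unfolding chain_divides_def
  proof
    fix k
    define \<delta> where "\<delta> = dist_M \<Omega> (\<Omega> \<inter> frontier (E (Suc k))) (\<Omega> \<inter> frontier (E k))"
    have "\<delta> > 0" using E by (simp add: \<delta>_def pe_chain_def)
    \<comment> \<open>Continua inside the ball of radius \<open>r l\<close> then have diameter below
      \<delta>, so one that meets \<open>E (Suc k)\<close> stays in \<open>E k\<close>.\<close>
    obtain l :: nat where "2 * dist z w / \<delta> < real l" using reals_Archimedean2 by blast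
    then have l: "2 * r l < \<delta>" using \<open>\<delta> > 0\<close> by (simp add: r_def field_simps)
    obtain t where t: "t \<in> {0<..<S}" "\<Gamma> ` {t<..<S} \<subseteq> E (Suc k)" using tail by blast
    define s where "s = max (\<tau> l) ((t + S) / 2)"
    have s: "\<tau> l \<le> s" "t < s" "s < S" using t \<tau>[of l] by (auto simp: s_def less_max_iff_disj)
    have "F l \<subseteq> E k"
    proof
      fix y assume "y \<in> F l"
      then have "\<exists>m. lip_path (A l) m (\<Gamma> s) y"
        using \<Gamma>F[OF s(1,3)] unfolding F_def reach_def by (auto intro: lip_path_trans[OF lip_path_sym])
      then obtain m where "lip_path (A l) m (\<Gamma> s) y" by blast
      then obtain K where K: "compact K" "connected K" "K \<subseteq> A l" "\<Gamma> s \<in> K" "y \<in> K"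
        by (rule lip_path_continuum)
      have "diameter K \<le> 2 * r l"
      proof (rule diameter_leI)
        fix a b assume "a \<in> K" "b \<in> K"
        then have "dist z a < r l" "dist z b < r l" using K by (auto simp: A_def)
        then show "dist a b \<le> 2 * r l" using dist_triangle[of a b z] by (simp add: dist_commute)
      qed (use K in auto)
      moreover have "\<Gamma> s \<in> E (Suc k)" using t(2) s by (auto simp: image_subset_iff)
      ultimately have "K \<subseteq> E k"
        using K l by (intro chain_continuum_subset[OF E]) (auto simp: A_def \<delta>_def)
      then show "y \<in> E k" using K by blast
    qed
    then show "\<exists>l. F l \<subseteq> E k" by blast
  qed
  define f where "f = {G. pe_chain \<Omega> G \<and> chain_equiv F G}"
  have "F \<in> f" using F by (simp add: f_def chain_equiv_def chain_divides_refl)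
  moreover have "f \<in> pe_ends \<Omega>" using F unfolding pe_ends_def f_def by blast
  moreover have "end_divides f e"
    unfolding end_divides_def using \<open>F \<in> f\<close> Ee \<open>chain_divides F E\<close> by blast
  ultimately have "f = e" using e unfolding prime_ends_def by blast
  \<comment> \<open>\<open>impression\<close> looks at one chosen representative; equivalent chains
    have the same impression, so it can be computed from \<open>F\<close>.\<close>
  have "(SOME G. G \<in> e) \<in> e" using Ee by (metis someI)
  then have "impression e = {z}"
    unfolding impression_def \<open>f = e\<close>[symmetric] using impF
    by (auto simp: f_def chain_equiv_def dest!: chain_divides_impression)
  then have sing: "e \<in> singleton_prime_ends \<Omega>" using e by (auto simp: singleton_prime_ends_def)
  define \<gamma> where "\<gamma> t = \<Gamma> (S * t)" for t
  have "S-lipschitz_on {0..1} \<gamma>"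
  proof (rule lipschitz_onI)
    fix s t :: real assume "s \<in> {0..1}" "t \<in> {0..1}"
    then have "dist (\<Gamma> (S * s)) (\<Gamma> (S * t)) \<le> 1 * dist (S * s) (S * t)"
      using \<Gamma>(2) by (intro lipschitz_onD[OF \<Gamma>(1)]) (auto simp: mult_left_le)
    then show "dist (\<gamma> s) (\<gamma> t) \<le> S * dist s t"
      using \<Gamma>(2) by (simp add: \<gamma>_def dist_real_def abs_mult flip: right_diff_distrib)
  qed (use \<Gamma>(2) in simp)
  then have "rectifiable_curve \<gamma>"
    unfolding rectifiable_curve_def
    using lipschitz_curve_length[of S 0 1 \<gamma>] lipschitz_on_continuous_on[of S "{0..1}" \<gamma>]
    by (auto intro: order_le_less_trans[OF _ ennreal_less_top])
  moreover have "\<gamma> ` {0..<1} \<subseteq> \<Omega>"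
    using \<Gamma>(2,3) by (auto simp: \<gamma>_def image_subset_iff)
  moreover have "impression e = {\<gamma> 1}" using \<open>impression e = {z}\<close> by (simp add: \<gamma>_def z_def)
  moreover have "\<exists>t\<in>{0<..<1}. \<gamma> ` {t<..<1} \<subseteq> E k" for k
  proof -
    obtain t where t: "t \<in> {0<..<S}" "\<Gamma> ` {t<..<S} \<subseteq> E k" using tail by blast
    then show ?thesis
      using \<Gamma>(2) by (intro bexI[of _ "t / S"]) (auto simp: \<gamma>_def image_subset_iff field_simps)
  qed
  ultimately show ?thesis
    unfolding rect_accessible_prime_ends_def using sing Ee by blast
qed

end

text \<open>The paths are laid end to end on consecutive intervals. They fill a bounded half-open
  interval \<open>[0, S)\<close>, and completeness supplies the endpoint through the Lipschitz
  extension to the closure.\<close>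

lemma lip_path_infinite_concat:
  fixes z :: "nat \<Rightarrow> 'a::complete_space" and l :: "nat \<Rightarrow> real"
  assumes l: "\<And>k. l k > 0" "summable l" and path: "\<And>k. lip_path (A k) (l k) (z k) (z (Suc k))"
  obtains \<Gamma> S where "S > 0" "1-lipschitz_on {0..S} \<Gamma>" "\<And>k. (\<Sum>i<k. l i) < S"
    "\<And>k t. (\<Sum>i<k. l i) \<le> t \<Longrightarrow> t < S \<Longrightarrow> \<exists>j\<ge>k. \<Gamma> t \<in> A j"
proof -
  obtain c where c: "\<And>k. 1-lipschitz_on {0..l k} (c k)" "\<And>k. c k ` {0..l k} \<subseteq> A k"
    "\<And>k. c k 0 = z k" "\<And>k. c k (l k) = z (Suc k)"
    using path unfolding lip_path_def by metis
  define s where "s k = (\<Sum>i<k. l i)" for k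
  define S where "S = suminf l"
  have s0: "s 0 = 0" and sSuc: "s (Suc k) = s k + l k" for k by (auto simp: s_def)
  have sS: "s k < S" for k
    unfolding s_def S_def using l by (intro sum_less_suminf)
  have s_mono: "s j \<le> s k" if "j \<le> k" for j k
    using that by (rule lift_Suc_mono_le[rotated]) (use l in \<open>simp add: sSuc less_imp_le\<close>)
  have s_lim: "s \<longlonglongrightarrow> S"
    unfolding s_def S_def using l(2) by (rule summable_LIMSEQ)
  \<comment> \<open>\<open>G k\<close> runs through the first \<open>k\<close> paths; later stages
    leave it unchanged on \<open>[0, s k]\<close>, so the stages fit together to one
    function.\<close>
  define G where "G = rec_nat (\<lambda>_. z 0) (\<lambda>k g t. if t \<le> s k then g t else c k (t - s k))"
  have G0: "G 0 t = z 0" and GSuc: "G (Suc k) t = (if t \<le> s k then G k t else c k (t - s k))" for k t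
    by (auto simp: G_def)
  have G: "1-lipschitz_on {0..s k} (G k) \<and> G k (s k) = z k" for k
  proof (induction k)
    case 0
    show ?case by (auto simp: s0 G0 intro!: lipschitz_onI)
  next
    case (Suc k)
    have "1-lipschitz_on {0..s k + l k} (\<lambda>t. if t \<le> s k then G k t else c k (t - s k))"
      using Suc c s_mono[of 0 k] by (intro lipschitz_concat_shift) (auto simp: s0)
    moreover have "G (Suc k) = (\<lambda>t. if t \<le> s k then G k t else c k (t - s k))" by (auto simp: GSuc)
    ultimately show ?case using l(1)[of k] c(4) by (simp add: sSuc)
  qed
  have agree: "G j t = G k t" if "k \<le> j" "t \<le> s k" for j k t
    using that
  proof (induction j rule: dec_induct)
    case (step n)
    then show ?case using s_mono[of k n] by (simp add: GSuc)
  qed simp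
  have ex: "\<exists>k. t < s k" if "t < S" for t
    using order_tendstoD(1)[OF s_lim that] eventually_sequentially by auto
  define \<Gamma>0 where "\<Gamma>0 t = G (LEAST k. t \<le> s k) t" for t
  have \<Gamma>0: "\<Gamma>0 t = G k t" if "t \<le> s k" for k t
    unfolding \<Gamma>0_def
    by (rule agree[symmetric]) (use that in \<open>auto intro: Least_le LeastI\<close>)
  have "1-lipschitz_on {0..<S} \<Gamma>0"
  proof (rule lipschitz_onI)
    fix x y assume xy: "x \<in> {0..<S}" "y \<in> {0..<S}"
    then obtain k where "max x y < s k" using ex[of "max x y"] by auto
    then show "dist (\<Gamma>0 x) (\<Gamma>0 y) \<le> 1 * dist x y"
      using xy G[of k] lipschitz_onD[of 1 "{0..s k}" "G k" x y] by (simp add: \<Gamma>0[of _ k])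
  qed simp
  then obtain \<Gamma> where \<Gamma>: "1-lipschitz_on (closure {0..<S}) \<Gamma>" "\<And>x. x \<in> {0..<S} \<Longrightarrow> \<Gamma> x = \<Gamma>0 x"
    using lipschitz_extend_closure by blast
  have "S > 0" using sS[of 0] by (simp add: s0)
  moreover have "1-lipschitz_on {0..S} \<Gamma>" using \<Gamma>(1) \<open>S > 0\<close> by simp
  moreover have "\<exists>j\<ge>k. \<Gamma> t \<in> A j" if t: "s k \<le> t" "t < S" for k t
  proof -
    define m where "m = (LEAST m. t < s m)"
    have m: "t < s m" unfolding m_def using ex[OF t(2)] by (rule LeastI_ex)
    have "k < m" using m t s_mono[of m k] by (meson leD leI order_trans)
    then obtain j where j: "m = Suc j" by (cases m) auto
    have "\<not> t < s j" unfolding m_def using not_less_Least[of j "\<lambda>m. t < s m"] j m_def by auto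
    then have tj: "s j \<le> t" "t \<le> s (Suc j)" using m j by auto
    have "\<Gamma> t = G (Suc j) t"
      using \<Gamma>(2)[of t] \<Gamma>0[OF tj(2)] t s_mono[of 0 k] s0 by simp
    also have "\<dots> = c j (t - s j)"
      using G[of j] c(3) tj by (auto simp: GSuc)
    also have "\<dots> \<in> A j" using c(2)[of j] tj by (auto simp: sSuc image_subset_iff)
    finally show ?thesis using \<open>k < m\<close> j by (intro exI[of _ j]) auto
  qed
  ultimately show ?thesis using sS that[of S \<Gamma>] unfolding s_def by blast
qed

context bounded_domain
begin

lemma infdist_pos: "x \<in> \<Omega> \<longleftrightarrow> 0 < infdist x (- \<Omega>)"
proof -
  have "closed (- \<Omega>)" "- \<Omega> \<noteq> {}" using dom by auto
  then show ?thesis using in_closed_iff_infdist_zero[of "- \<Omega>" x] infdist_nonneg[of x "- \<Omega>"] by auto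
qed

lemma compact_infdist_ge:
  assumes "r > 0"
  shows "compact {x. r \<le> infdist x (- \<Omega>)}"
proof (rule proper)
  show "closed {x. r \<le> infdist x (- \<Omega>)}"
    by (intro closed_Collect_le continuous_intros)
  show "bounded {x. r \<le> infdist x (- \<Omega>)}"
    using assms by (intro bounded_subset[OF dom(4)]) (auto simp: infdist_pos)
qed

section \<open>Curves that run into a chain\<close>

lemma chain_lip_path:
  assumes E: "pe_chain \<Omega> E" and path: "lip_path \<Omega> l x y" and mem: "x \<in> E (Suc k) \<or> y \<in> E (Suc k)"
    and l: "l < dist_M \<Omega> (\<Omega> \<inter> frontier (E (Suc k))) (\<Omega> \<inter> frontier (E k))"
  shows "lip_path (E k) l x y"
proof -
  obtain c where c: "0 \<le> l" "1-lipschitz_on {0..l} c" "c ` {0..l} \<subseteq> \<Omega>" "c 0 = x" "c l = y"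
    using path unfolding lip_path_def by blast
  have "x \<in> c ` {0..l}" "y \<in> c ` {0..l}" using c by (auto intro: rev_image_eqI)
  then have "c ` {0..l} \<subseteq> E k"
    using lipschitz_image_continuum[OF c(2,1)] c(3) mem l
    by (intro chain_continuum_subset[OF E]) auto
  then show ?thesis using c unfolding lip_path_def by blast
qed

text \<open>The time \<open>s k\<close> is the last time at which the curve is outside
  \<open>E k\<close>, as a supremum. If \<open>s (Suc k)\<close> followed too soon, a short piece of
  the curve would lead from outside \<open>E k\<close> into \<open>E (Suc k)\<close>, against
  \<open>chain_lip_path\<close>.\<close>

lemma chain_crossing_times:
  fixes T :: real
  assumes E: "pe_chain \<Omega> E" and c: "1-lipschitz_on {0..T} c" "c ` {0..T} \<subseteq> \<Omega>" "c 0 \<notin> E 0"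
    and end_in: "c T \<in> E n" and T: "T \<ge> 0"
  obtains s where "\<And>k. k \<le> n \<Longrightarrow> 0 \<le> s k \<and> s k \<le> T"
    "\<And>k t. k \<le> n \<Longrightarrow> s k < t \<Longrightarrow> t \<le> T \<Longrightarrow> c t \<in> E k"
    "\<And>k. k < n \<Longrightarrow> s k + dist_M \<Omega> (\<Omega> \<inter> frontier (E (Suc k))) (\<Omega> \<inter> frontier (E k)) \<le> s (Suc k)"
proof -
  define B where "B k = {t \<in> {0..T}. c t \<notin> E k}" for k
  define s where "s k = Sup (B k)" for k
  have dec: "E (Suc k) \<subseteq> E k" for k using E by (simp add: pe_chain_def)
  have anti: "E k \<subseteq> E j" if "j \<le> k" for j k
    using that dec by (rule lift_Suc_antimono_le[rotated])
  have B0: "0 \<in> B k" for k using c(3) anti[of 0 k] T by (auto simp: B_def)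
  have bdd: "bdd_above (B k)" for k by (intro bdd_aboveI[of _ T]) (auto simp: B_def)
  have s: "0 \<le> s k" "s k \<le> T" for k
    unfolding s_def using B0[of k] bdd[of k] by (auto intro!: cSup_upper cSup_least simp: B_def)
  have after: "c t \<in> E k" if "s k < t" "t \<le> T" for k t
  proof (rule ccontr)
    assume "c t \<notin> E k"
    then have "t \<in> B k" using that s(1)[of k] by (auto simp: B_def)
    then have "t \<le> s k" unfolding s_def using bdd by (intro cSup_upper)
    then show False using that by simp
  qed
  have gap: "s k + dist_M \<Omega> (\<Omega> \<inter> frontier (E (Suc k))) (\<Omega> \<inter> frontier (E k)) \<le> s (Suc k)" if "k < n" for k
  proof (rule ccontr)
    define \<delta> where "\<delta> = dist_M \<Omega> (\<Omega> \<inter> frontier (E (Suc k))) (\<Omega> \<inter> frontier (E k))"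
    assume "\<not> ?thesis"
    then have less: "s (Suc k) < s k + \<delta>" by (simp add: \<delta>_def)
    \<comment> \<open>The suprema need not be attained. Moving back by less than
      \<open>\<eta> / 2\<close> and forward by at most \<open>\<eta> / 4\<close> uses up less than
      the slack \<eta>, so the piece from \<open>a\<close> to \<open>b\<close> is still shorter than
      \<delta>.\<close>
    define \<eta> where "\<eta> = s k + \<delta> - s (Suc k)"
    have "\<eta> > 0" using less by (simp add: \<eta>_def)
    have mono: "s k \<le> s (Suc k)"
      unfolding s_def using B0[of k] bdd dec[of k] by (intro cSup_subset_mono) (auto simp: B_def)
    obtain a where a: "a \<in> B k" "s k - \<eta> / 2 < a"
      using less_cSupD[of "B k" "s k - \<eta> / 2"] B0[of k] \<open>\<eta> > 0\<close> unfolding s_def by auto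
    have "a \<le> s k" unfolding s_def using a bdd by (intro cSup_upper)
    define b where "b = min T (s (Suc k) + \<eta> / 4)"
    have b: "a \<le> b" "b \<le> T" "b \<le> s (Suc k) + \<eta> / 4"
      using \<open>a \<le> s k\<close> mono s(2)[of "Suc k"] \<open>\<eta> > 0\<close> by (auto simp: b_def)
    have "c b \<in> E (Suc k)"
    \<comment> \<open>When \<open>b = T\<close> there may be no time after \<open>s (Suc k)\<close>
      left; membership then comes from the end condition.\<close>
    proof (cases "b = T")
      case True
      then show ?thesis using end_in anti[of "Suc k" n] that by auto
    next
      case False
      then show ?thesis using b \<open>\<eta> > 0\<close> by (intro after) (auto simp: b_def)
    qed
    have a0: "0 \<le> a" "c a \<notin> E k" using a by (auto simp: B_def)
    have "c ` {a..b} \<subseteq> c ` {0..T}" using a0 b by (intro image_mono) auto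
    then have "lip_path \<Omega> (b - a) (c a) (c b)"
      using a0 b c(2) by (intro lip_path_shift lipschitz_on_subset[OF c(1)]) auto
    then have "lip_path (E k) (b - a) (c a) (c b)"
    proof (rule chain_lip_path[OF E])
      show "b - a < dist_M \<Omega> (\<Omega> \<inter> frontier (E (Suc k))) (\<Omega> \<inter> frontier (E k))"
        using a(2) b(3) \<open>\<eta> > 0\<close> unfolding \<eta>_def \<delta>_def by argo
    qed (use \<open>c b \<in> E (Suc k)\<close> in blast)
    then show False using a0 lip_path_mem by blast
  qed
  show ?thesis using s after gap by (intro that[of s]) auto
qed

lemma chain_shift:
  assumes "pe_chain \<Omega> E"
  shows "pe_chain \<Omega> (\<lambda>k. E (k + m))"
proof -
  have sub: "E (Suc k) \<subseteq> E k" for k using assms by (simp add: pe_chain_def)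
  have anti: "E k \<subseteq> E j" if "j \<le> k" for j k
    using that sub by (rule lift_Suc_antimono_le[rotated])
  have "(\<Inter>k. closure (E (k + m))) \<subseteq> (\<Inter>k. closure (E k))"
    using anti[of _ "_ + m"] by (intro INT_greatest) (meson INT_lower closure_mono le_add1 order_trans UNIV_I)
  then show ?thesis using assms by (auto simp: pe_chain_def)
qed

text \<open>Each curve \<open>c n\<close> spends a definite time between \<open>E k\<close> and \<open>E (k + 1)\<close>, hence visits there a
  compact subset of \<open>\<Omega>\<close> that does not depend on \<open>n\<close>. A diagonal argument makes the visited
  points converge as \<open>n \<rightarrow> \<infinity>\<close>, and splicing pieces of the curves \<open>c n\<close> at the limit
  points yields one curve ending at the prime end.\<close>

lemma rect_accessible_limit:
  fixes c :: "nat \<Rightarrow> real \<Rightarrow> 'a" and T :: "nat \<Rightarrow> real" and M :: real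
  assumes e: "e \<in> prime_ends \<Omega>" and Ee: "E \<in> e"
    and T: "\<And>n. 0 \<le> T n" "\<And>n. T n \<le> M"
    and c: "\<And>n. 1-lipschitz_on {0..T n} (c n)" "\<And>n. c n ` {0..T n} \<subseteq> \<Omega>" "\<And>n. c n 0 = x0"
      "\<And>n. c n (T n) \<in> E n"
    and visit: "\<And>\<delta>. \<delta> > 0 \<Longrightarrow> \<exists>r>0. \<forall>n s s'. 0 \<le> s \<longrightarrow> s + \<delta> \<le> s' \<longrightarrow> s' \<le> T n \<longrightarrow>
        (\<exists>t\<in>{s<..<s'}. r \<le> infdist (c n t) (- \<Omega>))"
  shows "e \<in> rect_accessible_prime_ends \<Omega>"
proof -
  have E: "pe_chain \<Omega> E" using e Ee unfolding prime_ends_def pe_ends_def by blast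
  have x0: "x0 \<in> \<Omega>" using c(2)[of 0] c(3)[of 0] T(1)[of 0] by (force simp: image_subset_iff)
  then have "x0 \<notin> frontier \<Omega>" using dom(1) by (simp add: frontier_def interior_open)
  \<comment> \<open>Discarding the first \<open>m\<close> sets puts the common starting point
    outside the chain, as the crossing times require.\<close>
  then obtain m where m: "x0 \<notin> closure (E m)" using E unfolding pe_chain_def by blast
  define D where "D k = E (k + m)" for k
  have D: "pe_chain \<Omega> D" unfolding D_def by (rule chain_shift[OF E])
  have dec: "D (Suc k) \<subseteq> D k" for k using D by (simp add: pe_chain_def)
  have anti: "D k \<subseteq> D j" if "j \<le> k" for j k
    using that dec by (rule lift_Suc_antimono_le[rotated])
  have D\<Omega>: "D k \<subseteq> \<Omega>" for k using D by (auto simp: pe_chain_def acceptable_def)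
  have DE: "D k \<subseteq> E k" for k
  proof -
    have "E (Suc k) \<subseteq> E k" for k using E by (simp add: pe_chain_def)
    then show ?thesis unfolding D_def by (rule lift_Suc_antimono_le) simp
  qed
  define \<delta> where "\<delta> k = dist_M \<Omega> (\<Omega> \<inter> frontier (D (Suc k))) (\<Omega> \<inter> frontier (D k))" for k
  have \<delta>: "\<delta> k > 0" for k using D by (simp add: \<delta>_def pe_chain_def)
  define T' c' where "T' n = T (n + m)" and "c' n = c (n + m)" for n
  have c': "1-lipschitz_on {0..T' n} (c' n)" "c' n ` {0..T' n} \<subseteq> \<Omega>" "c' n 0 \<notin> D 0"
      "c' n (T' n) \<in> D n" "T' n \<ge> 0" for n
    using c[of "n + m"] T[of "n + m"] m closure_subset[of "E m"] by (auto simp: T'_def c'_def D_def)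
  define P where "P n s \<longleftrightarrow> (\<forall>k\<le>n. 0 \<le> s k \<and> s k \<le> T' n) \<and>
      (\<forall>k t. k \<le> n \<longrightarrow> s k < t \<longrightarrow> t \<le> T' n \<longrightarrow> c' n t \<in> D k) \<and>
      (\<forall>k<n. s k + \<delta> k \<le> s (Suc k))" for n s
  have "\<exists>s. P n s" for n
  proof -
    obtain s where "\<And>k. k \<le> n \<Longrightarrow> 0 \<le> s k \<and> s k \<le> T' n"
      "\<And>k t. k \<le> n \<Longrightarrow> s k < t \<Longrightarrow> t \<le> T' n \<Longrightarrow> c' n t \<in> D k"
      "\<And>k. k < n \<Longrightarrow> s k + \<delta> k \<le> s (Suc k)"
      using chain_crossing_times[OF D c'(1,2,3,4,5)[of n]] unfolding \<delta>_def by blast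
    then show ?thesis unfolding P_def by (intro exI[of _ s]) auto
  qed
  then obtain s where "\<And>n. P n (s n)" by metis
  then have s: "\<And>n k. k \<le> n \<Longrightarrow> 0 \<le> s n k" "\<And>n k. k \<le> n \<Longrightarrow> s n k \<le> T' n"
      "\<And>n k t. k \<le> n \<Longrightarrow> s n k < t \<Longrightarrow> t \<le> T' n \<Longrightarrow> c' n t \<in> D k"
      "\<And>n k. k < n \<Longrightarrow> s n k + \<delta> k \<le> s n (Suc k)"
    unfolding P_def by auto
  obtain r where r: "\<And>k. r k > 0" "\<And>k n s s'. 0 \<le> s \<Longrightarrow> s + \<delta> k \<le> s' \<Longrightarrow> s' \<le> T n \<Longrightarrow>
        (\<exists>t\<in>{s<..<s'}. r k \<le> infdist (c n t) (- \<Omega>))"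
    using visit[OF \<delta>] by metis
  \<comment> \<open>The gap between the crossing times is at least \<open>\<delta> k\<close>, so
    \<open>visit\<close> applies with a radius \<open>r k\<close> that does not depend on
    \<open>n\<close>.\<close>
  have "\<exists>t. s n k < t \<and> t < s n (Suc k) \<and> r k \<le> infdist (c' n t) (- \<Omega>)" if "k < n" for n k
    using r(2)[of "s n k" k "s n (Suc k)" "n + m"] s(1)[of k n] s(2)[of "Suc k" n] s(4)[OF that] that
    unfolding T'_def c'_def by auto
  note ex_t = this
  define t where "t n k = (SOME t. s n k < t \<and> t < s n (Suc k) \<and> r k \<le> infdist (c' n t) (- \<Omega>))" for n k
  have t: "s n k < t n k" "t n k < s n (Suc k)" "r k \<le> infdist (c' n (t n k)) (- \<Omega>)" if "k < n" for n k
    using someI_ex[OF ex_t[OF that]] unfolding t_def by auto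
  have t_bd: "0 \<le> t n k" "t n k \<le> T' n" "T' n \<le> M" if "k < n" for n k
    using t(1,2)[OF that] s(1)[of k n] s(2)[of "Suc k" n] that T(2)[of "n + m"] by (auto simp: T'_def)
  have t_mono: "t n k \<le> t n (Suc k)" if "Suc k < n" for n k
    using t(2)[of k n] t(1)[of "Suc k" n] that by simp
  define Z where "Z n k = c' n (t n k)" for n k
  have ZD: "Z n k \<in> D k" if "k < n" for n k
    unfolding Z_def using s(3)[of k n] t(1)[OF that] t_bd[OF that] that by simp
  have seg: "lip_path (D k) (t n (Suc k) - t n k) (Z n k) (Z n (Suc k))" if "Suc k < n" for n k
    unfolding Z_def
  proof (rule lip_path_shift[OF _ t_mono[OF that]])
    show "1-lipschitz_on {t n k..t n (Suc k)} (c' n)"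
      using t_bd[of k n] t_bd[of "Suc k" n] that by (intro lipschitz_on_subset[OF c'(1)]) auto
    show "c' n ` {t n k..t n (Suc k)} \<subseteq> D k"
      using s(3)[of k n] t(1)[of k n] t_bd[of "Suc k" n] that by (auto simp: image_subset_iff)
  qed
  \<comment> \<open>For \<open>k >= n\<close> nothing is known about \<open>t n k\<close>; the index
    \<open>max n (Suc k)\<close> replaces it so that every \<open>W n\<close> lies in the compact
    product. Limits in \<open>n\<close> are unaffected.\<close>
  define W where "W n k = (Z (max n (Suc k)) k, t (max n (Suc k)) k)" for n k
  let ?K = "PiE UNIV (\<lambda>k. {x. r k \<le> infdist x (- \<Omega>)} \<times> {0..M})"
  have "compact ?K"
    by (intro compact_PiE_UNIV compact_Times compact_infdist_ge r) auto
  moreover have "W n \<in> ?K" for n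
  proof -
    have "W n k \<in> {x. r k \<le> infdist x (- \<Omega>)} \<times> {0..M}" for k
    proof -
      have "k < max n (Suc k)" by (simp add: less_max_iff_disj)
      then show ?thesis using t(3)[of k "max n (Suc k)"] t_bd[of k "max n (Suc k)"] by (simp add: W_def Z_def)
    qed
    then show ?thesis by auto
  qed
  ultimately obtain w \<phi> where w: "w \<in> ?K" and \<phi>: "strict_mono \<phi>" and lim: "(W \<circ> \<phi>) \<longlonglongrightarrow> w"
    unfolding compact_eq_seq_compact_metric seq_compact_def by meson
  define \<zeta> \<theta> where "\<zeta> k = fst (w k)" and "\<theta> k = snd (w k)" for k
  have w_mem: "\<zeta> k \<in> \<Omega>" "0 \<le> \<theta> k" "\<theta> k \<le> M" for k
  proof -
    have "w k \<in> {x. r k \<le> infdist x (- \<Omega>)} \<times> {0..M}" using w by auto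
    then show "\<zeta> k \<in> \<Omega>" "0 \<le> \<theta> k" "\<theta> k \<le> M"
      using r(1)[of k] by (auto simp: \<zeta>_def \<theta>_def infdist_pos)
  qed
  have limk: "(\<lambda>n. W (\<phi> n) k) \<longlonglongrightarrow> w k" for k
  proof -
    have "continuous_on UNIV (\<lambda>f :: nat \<Rightarrow> 'a \<times> real. f k)" by (rule continuous_on_product_coordinates)
    then have "isCont (\<lambda>f :: nat \<Rightarrow> 'a \<times> real. f k) w" using continuous_on_eq_continuous_at[OF open_UNIV] by blast
    then show ?thesis using isCont_tendsto_compose[OF _ lim] by (simp add: o_def)
  qed
  have large: "\<forall>\<^sub>F n in sequentially. k < \<phi> n" for k
  proof (rule eventually_sequentiallyI[of "Suc k"])
    show "k < \<phi> n" if "Suc k \<le> n" for n using seq_suble[OF \<phi>, of n] that by simp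
  qed
  have limZ: "(\<lambda>n. Z (\<phi> n) k) \<longlonglongrightarrow> \<zeta> k" and limt: "(\<lambda>n. t (\<phi> n) k) \<longlonglongrightarrow> \<theta> k" for k
  proof -
    have eq: "\<forall>\<^sub>F n in sequentially. W (\<phi> n) k = (Z (\<phi> n) k, t (\<phi> n) k)"
      using large[of k] by eventually_elim (simp add: W_def max_absorb1)
    have 1: "(\<lambda>n. fst (W (\<phi> n) k)) \<longlonglongrightarrow> \<zeta> k" and 2: "(\<lambda>n. snd (W (\<phi> n) k)) \<longlonglongrightarrow> \<theta> k"
      using limk[of k] by (auto simp: \<zeta>_def \<theta>_def intro: tendsto_fst tendsto_snd)
    show "(\<lambda>n. Z (\<phi> n) k) \<longlonglongrightarrow> \<zeta> k"
      using 1 by (rule Lim_transform_eventually) (use eq in \<open>auto elim: eventually_mono\<close>)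
    show "(\<lambda>n. t (\<phi> n) k) \<longlonglongrightarrow> \<theta> k"
      using 2 by (rule Lim_transform_eventually) (use eq in \<open>auto elim: eventually_mono\<close>)
  qed
  have join: "\<forall>\<^sub>F n in sequentially. lip_path \<Omega> \<epsilon> (\<zeta> k) (Z (\<phi> n) k)" if "\<epsilon> > 0" for k \<epsilon>
  proof -
    obtain \<rho> where \<rho>: "\<rho> > 0" "ball (\<zeta> k) \<rho> \<subseteq> \<Omega>" using w_mem(1) dom(1) by (meson open_contains_ball)
    have "\<forall>\<^sub>F n in sequentially. dist (Z (\<phi> n) k) (\<zeta> k) < min \<rho> \<epsilon> / C"
      using limZ[of k] \<rho>(1) that C by (intro tendstoD) auto
    then show ?thesis
    proof eventually_elim
      case (elim n)
      then have "C * dist (\<zeta> k) (Z (\<phi> n) k) < min \<rho> \<epsilon>"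
        using C by (simp add: dist_commute less_divide_eq mult.commute)
      then show ?case
        using lip_path_in_ball[OF \<rho>(2), of "Z (\<phi> n) k"] by (auto intro: lip_path_pad)
    qed
  qed
  \<comment> \<open>The differences of \<theta> telescope to at most \<open>M\<close>. The added
    \<open>4 * (1/2)^k\<close> pays for two joining paths and for two errors in replacing times by
    their limits. Indices start at \<open>Suc k\<close> because a short join with one end in
    \<open>D (Suc k)\<close> is only known to stay in \<open>D k\<close>.\<close>
  define l where "l k = \<theta> (Suc (Suc k)) - \<theta> (Suc k) + 4 * (1/2)^k" for k
  have path: "0 < l k \<and> lip_path (D k) (l k) (\<zeta> (Suc k)) (\<zeta> (Suc (Suc k)))" for k
  proof -
    \<comment> \<open>The bound \<open>\<delta> k / 2\<close> keeps the joining paths inside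
      \<open>D k\<close>; the other bound makes their lengths summable.\<close>
    define \<epsilon> where "\<epsilon> = min ((1/2)^k) (\<delta> k / 2)"
    have \<epsilon>: "0 < \<epsilon>" "\<epsilon> \<le> (1/2)^k" "\<epsilon> < \<delta> k" using \<delta>[of k] by (auto simp: \<epsilon>_def)
    have tt: "\<forall>\<^sub>F n in sequentially. \<bar>t (\<phi> n) j - \<theta> j\<bar> < (1/2)^k" for j
      using tendstoD[OF limt[of j], of "(1/2)^k"] by (simp add: dist_real_def)
    have "\<forall>\<^sub>F n in sequentially. 0 < l k \<and> lip_path (D k) (l k) (\<zeta> (Suc k)) (\<zeta> (Suc (Suc k)))"
      using large[of "Suc (Suc k)"] tt[of "Suc k"] tt[of "Suc (Suc k)"] join[OF \<epsilon>(1), of "Suc k"] join[OF \<epsilon>(1), of "Suc (Suc k)"]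
    proof eventually_elim
      case (elim n)
      have "lip_path (D k) \<epsilon> (\<zeta> (Suc k)) (Z (\<phi> n) (Suc k))"
        using elim(1,4) ZD[of "Suc k" "\<phi> n"] \<epsilon> by (intro chain_lip_path[OF D]) (auto simp: \<delta>_def)
      moreover have "lip_path (D k) (t (\<phi> n) (Suc (Suc k)) - t (\<phi> n) (Suc k)) (Z (\<phi> n) (Suc k)) (Z (\<phi> n) (Suc (Suc k)))"
        using seg[OF elim(1)] dec by (rule lip_path_mono)
      moreover have "lip_path (D k) \<epsilon> (Z (\<phi> n) (Suc (Suc k))) (\<zeta> (Suc (Suc k)))"
        using lip_path_sym[OF elim(5)] elim(1) ZD[of "Suc (Suc k)" "\<phi> n"] dec[of "Suc k"] \<epsilon>
        by (intro chain_lip_path[OF D]) (auto simp: \<delta>_def)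
      ultimately have p: "lip_path (D k) (\<epsilon> + (t (\<phi> n) (Suc (Suc k)) - t (\<phi> n) (Suc k)) + \<epsilon>) (\<zeta> (Suc k)) (\<zeta> (Suc (Suc k)))"
        by (blast intro: lip_path_trans)
      have "\<epsilon> + (t (\<phi> n) (Suc (Suc k)) - t (\<phi> n) (Suc k)) + \<epsilon> \<le> l k"
        using elim(2,3) \<epsilon>(2) unfolding l_def by linarith
      moreover have "0 < \<epsilon> + (t (\<phi> n) (Suc (Suc k)) - t (\<phi> n) (Suc k)) + \<epsilon>"
        using t_mono[OF elim(1)] \<epsilon>(1) by linarith
      ultimately show ?case using lip_path_pad[OF p] by simp
    qed
    \<comment> \<open>The claim does not involve \<open>n\<close>, so one late \<open>n\<close>
      establishes it; different \<open>k\<close> may use different approximating curves.\<close>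
    then show ?thesis by (simp add: eventually_const_iff)
  qed
  have "summable l"
  proof (rule summableI_nonneg_bounded)
    show "0 \<le> l k" for k using path[of k] by simp
    fix n
    have "(\<Sum>k<n. l k) = (\<Sum>k<n. \<theta> (Suc (Suc k)) - \<theta> (Suc k)) + 4 * (\<Sum>k<n. (1/2)^k)"
      by (simp add: l_def sum.distrib sum_distrib_left)
    also have "(\<Sum>k<n. \<theta> (Suc (Suc k)) - \<theta> (Suc k)) = \<theta> (Suc n) - \<theta> (Suc 0)"
      by (rule sum_lessThan_telescope)
    also have "(\<Sum>k<n. (1/2::real)^k) \<le> 2"
      using sum_le_suminf[of "\<lambda>k. (1/2::real)^k" "{..<n}"] by (simp add: suminf_geometric summable_geometric)
    finally show "(\<Sum>k<n. l k) \<le> M + 8" using w_mem(2)[of "Suc 0"] w_mem(3)[of "Suc n"] by simp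
  qed
  moreover have "0 < l k" "lip_path (D k) (l k) (\<zeta> (Suc k)) (\<zeta> (Suc (Suc k)))" for k using path by auto
  ultimately obtain \<Gamma> S where \<Gamma>: "S > 0" "1-lipschitz_on {0..S} \<Gamma>" "\<And>k. (\<Sum>i<k. l i) < S"
    "\<And>k t. (\<Sum>i<k. l i) \<le> t \<Longrightarrow> t < S \<Longrightarrow> \<exists>j\<ge>k. \<Gamma> t \<in> D j"
    using lip_path_infinite_concat[of l D "\<lambda>k. \<zeta> (Suc k)"] by (metis (no_types, lifting))
  show ?thesis
  proof (rule rect_accessibleI[OF e Ee \<Gamma>(2,1)])
    show "\<Gamma> ` {0..<S} \<subseteq> \<Omega>" using \<Gamma>(4)[of 0] D\<Omega> by (fastforce simp: image_subset_iff)
    fix k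
    have "0 < (\<Sum>i<Suc k. l i)" using path by (intro sum_pos) auto
    moreover have "\<Gamma> t \<in> E k" if lt: "(\<Sum>i<Suc k. l i) < t" "t < S" for t
    proof -
      obtain j where "j \<ge> Suc k" "\<Gamma> t \<in> D j" using \<Gamma>(4)[OF less_imp_le[OF lt(1)] lt(2)] by blast
      then show ?thesis using anti[of k j] DE[of k] by auto
    qed
    ultimately show "\<exists>t\<in>{0<..<S}. \<Gamma> ` {t<..<S} \<subseteq> E k"
      using \<Gamma>(3)[of "Suc k"] by (intro bexI[of _ "\<Sum>i<Suc k. l i"]) (auto simp: image_subset_iff)
  qed
qed

subsection \<open>The weighted path distance\<close>

abbreviation bdist :: "'a \<Rightarrow> real" where "bdist x \<equiv> infdist x (- \<Omega>)"

text \<open>A step from \<open>y\<close> below this size is spanned by a curve of length below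
  \<open>bdist y / 2\<close>, along which the distance to the complement stays above
  \<open>bdist y / 2\<close>.\<close>

definition step_size :: "'a \<Rightarrow> real" where "step_size y = bdist y / (2 * C)"

lemma bdist_lipschitz: "bdist y \<le> bdist z + dist y z"
  by (rule infdist_triangle)

text \<open>Each step is replaced by its quasiconvexity curve. If that curve comes within
  \<open>r\<close> of the complement, then \<open>bdist y < 2 * r\<close>, so the step was charged
  at rate at least \<open>h (4 * r)\<close>: time near the boundary is paid for by cost, up to the
  factor \<open>C\<close>. As \<open>h\<close> is at least 1, cost also bounds the total
  length.\<close>

lemma weighted_chain_curve:
  assumes h1: "\<And>r. 1 \<le> h r" and anti: "\<And>r r'. 0 < r \<Longrightarrow> r \<le> r' \<Longrightarrow> h r' \<le> h r" and x: "x \<in> \<Omega>"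
    and chain: "weighted_chain step_size (\<lambda>y. h (2 * bdist y)) x y a"
  shows "\<exists>T c. 0 \<le> T \<and> T \<le> C * a \<and> 1-lipschitz_on {0..T} c \<and> c ` {0..T} \<subseteq> \<Omega> \<and> c 0 = x \<and> c T = y \<and>
    (\<forall>r s s'. 0 < r \<longrightarrow> 0 \<le> s \<longrightarrow> s \<le> s' \<longrightarrow> s' \<le> T \<longrightarrow> (\<forall>t\<in>{s<..<s'}. bdist (c t) < r) \<longrightarrow>
       s' - s \<le> C * a / h (4 * r))"
  using chain
proof (induction rule: weighted_chain.induct)
  case start
  show ?case
    by (intro exI[of _ 0] exI[of _ "\<lambda>_. x"]) (use x in auto)
next
  case (step y a z)
  then obtain T c where T: "0 \<le> T" "T \<le> C * a" and c: "1-lipschitz_on {0..T} c" "c ` {0..T} \<subseteq> \<Omega>" "c 0 = x" "c T = y"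
    and slow: "\<And>r s s'. 0 < r \<Longrightarrow> 0 \<le> s \<Longrightarrow> s \<le> s' \<Longrightarrow> s' \<le> T \<Longrightarrow> (\<And>t. t \<in> {s<..<s'} \<Longrightarrow> bdist (c t) < r) \<Longrightarrow>
       s' - s \<le> C * a / h (4 * r)"
    by blast
  define m where "m = C * dist y z"
  have "y \<in> \<Omega>" using c T by (auto simp: image_subset_iff)
  then have dy: "0 < bdist y" by (simp add: infdist_pos)
  have m: "0 \<le> m" "m < bdist y / 2"
    using step.hyps(2) C by (auto simp: m_def step_size_def field_simps)
  have "lip_path (ball y (bdist y / 2)) m y z"
    unfolding m_def using m(2) by (intro lip_path_in_ball) (auto simp: m_def)
  then obtain c' where c': "1-lipschitz_on {0..m} c'" "c' ` {0..m} \<subseteq> ball y (bdist y / 2)" "c' 0 = y" "c' m = z"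
    unfolding lip_path_def by blast
  have far: "bdist y / 2 < bdist (c' t)" if "t \<in> {0..m}" for t
  proof -
    have "dist y (c' t) < bdist y / 2" using c'(2) that by (auto simp: image_subset_iff)
    then show ?thesis using bdist_lipschitz[of y "c' t"] by simp
  qed
  define w where "w = h (2 * bdist y)"
  have mw: "m \<le> C * (w * dist y z)"
    unfolding m_def w_def using h1[of "2 * bdist y"] C
    by (intro mult_left_mono) (auto simp: mult_le_cancel_right1)
  define f where "f t = (if t \<le> T then c t else c' (t - T))" for t
  have f_lip: "1-lipschitz_on {0..T + m} f"
    unfolding f_def using c c' T by (intro lipschitz_concat_shift) auto
  have f_in: "f ` {0..T + m} \<subseteq> \<Omega>"
  proof (rule image_subsetI)
    fix t assume "t \<in> {0..T + m}"
    then show "f t \<in> \<Omega>"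
      using c(2) far[of "t - T"] dy by (auto simp: f_def image_subset_iff infdist_pos)
  qed
  have slow': "s' - s \<le> C * (a + w * dist y z) / h (4 * r)"
    if r: "0 < r" and s: "0 \<le> s" "s \<le> s'" "s' \<le> T + m" and close: "\<And>t. t \<in> {s<..<s'} \<Longrightarrow> bdist (f t) < r" for r s s'
  proof -
    have h0: "0 < h (4 * r)" using h1[of "4 * r"] by simp
    \<comment> \<open>The interval is split at \<open>T\<close> into its parts on the old and on the
      new curve; \<open>min\<close> and \<open>max\<close> cover the cases where one part is
      empty.\<close>
    have "min s' T - min s T \<le> C * a / h (4 * r)"
    proof (rule slow)
      fix t assume "t \<in> {min s T<..<min s' T}"
      then have "t \<in> {s<..<s'}" "t \<le> T" by auto
      then show "bdist (c t) < r" using close[of t] by (simp add: f_def)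
    qed (use r s T in auto)
    moreover have "max s' T - max s T \<le> C * (w * dist y z) / h (4 * r)"
    proof (cases "max s T < max s' T")
      case True
      then obtain t where t: "max s T < t" "t < max s' T" using dense by blast
      then have "t \<in> {s<..<s'}" "T < t" by auto
      then have "bdist y / 2 < r" using close[of t] far[of "t - T"] s(3) by (auto simp: f_def)
      then have "h (4 * r) \<le> w" unfolding w_def using dy by (intro anti) auto
      have "max s' T - max s T \<le> m" using s T m by auto
      also have "m = m * h (4 * r) / h (4 * r)" using h0 by simp
      also have "\<dots> \<le> m * w / h (4 * r)"
        using \<open>h (4 * r) \<le> w\<close> h0 m by (intro divide_right_mono mult_left_mono) auto
      also have "\<dots> = C * (w * dist y z) / h (4 * r)" by (simp add: m_def)
      finally show ?thesis .
    next
      case False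
      have "0 \<le> C * (w * dist y z) / h (4 * r)" using mw m h0 by simp
      then show ?thesis using False by linarith
    qed
    moreover have "s' - s = (min s' T - min s T) + (max s' T - max s T)" by (auto simp: min_def max_def)
    ultimately show ?thesis by (simp add: add_divide_distrib distrib_left)
  qed
  show ?case
    unfolding w_def[symmetric]
  proof (intro exI[of _ "T + m"] exI[of _ f] conjI allI impI)
    show "T + m \<le> C * (a + w * dist y z)" using T mw by (simp add: distrib_left)
    show "f 0 = x" "f (T + m) = z" using T m c c' by (auto simp: f_def)
  qed (use T m f_lip f_in slow' in auto)
qed

text \<open>The set of reached points is open and relatively closed in \<Omega>. This makes the
  weighted distance finite at every point of \<Omega>, whence the test functions tend to 0
  pointwise.\<close>

lemma weighted_chain_reaches:
  assumes "x \<in> \<Omega>" "y \<in> \<Omega>"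
  shows "\<exists>a. weighted_chain step_size w x y a"
proof (rule ccontr)
  define R where "R = {y. \<exists>a. weighted_chain step_size w x y a}"
  assume "\<not> ?thesis"
  then have "y \<notin> R" by (simp add: R_def)
  have near: "z' \<in> R" if "z \<in> R" "dist z z' < step_size z" for z z'
    using that unfolding R_def by (auto intro: weighted_chain.step)
  have "x \<in> R" unfolding R_def using weighted_chain.start by auto
  then have "\<Omega> \<inter> frontier R \<noteq> {}"
    using dom(2) assms \<open>y \<notin> R\<close> by (intro connected_Int_frontier) auto
  then obtain z where z: "z \<in> \<Omega>" "z \<in> closure R" "z \<notin> interior R" by (auto simp: frontier_def)
  have dz: "0 < bdist z" using z by (simp add: infdist_pos)
  \<comment> \<open>Step sizes are measured at the start of a step, here at \<open>y'\<close>. Since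
    \<open>bdist y'\<close> may be as small as \<open>bdist z / 2\<close>, the constant is 4 where
    \<open>step_size\<close> has 2.\<close>
  then have "0 < bdist z / (4 * C)" using C by simp
  then obtain y' where y': "y' \<in> R" "dist y' z < bdist z / (4 * C)"
    using z(2) closure_approachable by blast
  have small: "bdist z / (4 * C) \<le> bdist z / 4"
    using C dz by (simp add: field_simps)
  then have "bdist z / 2 \<le> bdist y'" using bdist_lipschitz[of z y'] y'(2) dz by (simp add: dist_commute)
  then have "bdist z / (4 * C) \<le> step_size y'" using C by (simp add: step_size_def field_simps)
  then have "z \<in> R" using near[OF y'(1)] y'(2) by simp
  moreover have "0 < step_size z" using dz C by (simp add: step_size_def)
  ultimately have "ball z (step_size z) \<subseteq> R" using near[OF \<open>z \<in> R\<close>] by auto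
  then have "z \<in> interior R" using \<open>0 < step_size z\<close> by (meson centre_in_ball interiorI open_ball)
  then show False using z(3) by simp
qed

context
  fixes h :: "real \<Rightarrow> real" and x0 :: 'a and N :: real
  assumes h1: "\<And>r. 1 \<le> h r" and anti: "\<And>r r'. 0 < r \<Longrightarrow> r \<le> r' \<Longrightarrow> h r' \<le> h r"
    and x0: "x0 \<in> \<Omega>" and N: "N > 0"
begin

text \<open>The cost of a step is \<open>h (2 * bdist y)\<close> and the upper gradient \<open>h (bdist x)\<close>: the factor 2 absorbs the
  variation of \<open>bdist\<close> between nearby points.\<close>

definition cost :: "'a \<Rightarrow> real" where
  "cost = truncated_cost step_size (\<lambda>y. h (2 * bdist y)) x0 N"

lemma h_nonneg: "0 \<le> h r" using h1[of r] by simp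

lemma cost_bounds: "0 \<le> cost y" "cost y \<le> N"
  unfolding cost_def using h_nonneg N by (auto intro: truncated_cost_nonneg truncated_cost_le)

lemma cost_le_chain: "weighted_chain step_size (\<lambda>y. h (2 * bdist y)) x0 y a \<Longrightarrow> cost y \<le> a"
  unfolding cost_def using h_nonneg N by (intro truncated_cost_le_chain) auto

text \<open>Near \<open>x\<close> the distance to the complement is at least
  \<open>bdist x / 2\<close>, so steps from there cost at most the rate \<open>h (bdist x)\<close>
  and may be as long as \<open>bdist x / (4 * C)\<close>, in both directions. Keeping
  \<open>x\<close> apart from \<open>y\<close> and \<open>z\<close> matches the intermediate
  parameter in \<open>upper_gradientI\<close>.\<close>

lemma cost_local:
  assumes x: "x \<in> \<Omega>" and y: "dist x y < bdist x / (8 * C)" and z: "dist x z < bdist x / (8 * C)"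
  shows "\<bar>cost y - cost z\<bar> \<le> h (bdist x) * dist y z"
proof -
  have dx: "0 < bdist x" using x by (simp add: infdist_pos)
  have small: "bdist x / (8 * C) \<le> bdist x / 8" using C dx by (simp add: field_simps)
  have yz: "dist y z < bdist x / (4 * C)"
    using y z dist_triangle[of y z x] by (simp add: dist_commute)
  have step: "cost b \<le> cost a + h (bdist x) * dist a b"
    if "dist x a < bdist x / (8 * C)" "dist a b < bdist x / (4 * C)" for a b
  proof -
    have a: "bdist x / 2 \<le> bdist a" using bdist_lipschitz[of x a] that(1) small dx by simp
    then have "bdist x / (4 * C) \<le> step_size a" using C by (simp add: step_size_def field_simps)
    then have "cost b \<le> cost a + h (2 * bdist a) * dist a b"
      unfolding cost_def using that(2) h_nonneg N by (intro truncated_cost_step) auto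
    also have "\<dots> \<le> cost a + h (bdist x) * dist a b"
      using a dx by (intro add_left_mono mult_right_mono anti) auto
    finally show ?thesis .
  qed
  show ?thesis
    using step[OF y yz] step[OF z, of y] yz by (simp add: dist_commute abs_le_iff)
qed

lemma continuous_on_cost: "continuous_on \<Omega> cost"
  unfolding continuous_on_iff
proof (intro ballI allI impI)
  fix x e assume x: "x \<in> \<Omega>" and e: "(0::real) < e"
  have dx: "0 < bdist x" using x by (simp add: infdist_pos)
  have hx: "0 < h (bdist x)" using h1[of "bdist x"] by simp
  define d where "d = min (bdist x / (8 * C)) (e / h (bdist x))"
  show "\<exists>d>0. \<forall>x'\<in>\<Omega>. dist x' x < d \<longrightarrow> dist (cost x') (cost x) < e"
  proof (intro exI[of _ d] conjI ballI impI)
    show "0 < d" using dx e C hx by (simp add: d_def)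
    fix y assume "dist y x < d"
    then have y: "dist x y < bdist x / (8 * C)" "dist y x < e / h (bdist x)" by (auto simp: d_def dist_commute)
    then have "\<bar>cost y - cost x\<bar> \<le> h (bdist x) * dist y x"
      using x dx C by (intro cost_local) auto
    also have "\<dots> < e" using y(2) hx by (simp add: field_simps)
    finally show "dist (cost y) (cost x) < e" by (simp add: dist_real_def)
  qed
qed

lemma upper_gradient_cost:
  assumes "h \<in> borel_measurable borel"
  shows "upper_gradient \<Omega> (\<lambda>x. cost x / N) (\<lambda>x. ennreal (h (bdist x) / N))"
proof (rule upper_gradientI)
  have [measurable]: "bdist \<in> borel_measurable borel"
    by (intro borel_measurable_continuous_onI continuous_intros)
  show "(\<lambda>x. ennreal (h (bdist x) / N)) \<in> borel_measurable borel"
    using assms by measurable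
  fix \<gamma> :: "real \<Rightarrow> 'a"
  assume \<gamma>: "rectifiable_curve \<gamma>" "\<gamma> ` {0..1} \<subseteq> \<Omega>"
  then have cont: "continuous_on {0..1} \<gamma>" by (simp add: rectifiable_curve_def)
  have "continuous_on {0..1} (\<lambda>t. bdist (\<gamma> t))"
    using cont by (intro continuous_intros)
  \<comment> \<open>The least value of \<open>bdist\<close> along the curve is positive and makes
    the scale in \<open>cost_local\<close> uniform in the parameter.\<close>
  then obtain t0 where t0: "t0 \<in> {0..1}" "\<And>t. t \<in> {0..1} \<Longrightarrow> bdist (\<gamma> t0) \<le> bdist (\<gamma> t)"
    using continuous_attains_inf[of "{0..1}" "\<lambda>t. bdist (\<gamma> t)"] by auto
  define \<epsilon> where "\<epsilon> = bdist (\<gamma> t0) / (8 * C)"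
  have "\<gamma> t0 \<in> \<Omega>" using \<gamma>(2) t0(1) by blast
  then have "\<epsilon> > 0" using C by (simp add: \<epsilon>_def infdist_pos)
  have \<epsilon>: "\<epsilon> \<le> bdist (\<gamma> t) / (8 * C)" if "t \<in> {0..1}" for t
    unfolding \<epsilon>_def using t0(2)[OF that] C by (intro divide_right_mono) auto
  have "uniformly_continuous_on {0..1} \<gamma>"
    using cont by (intro compact_uniformly_continuous) auto
  then obtain \<eta> where \<eta>: "\<eta> > 0" "\<And>s t. s \<in> {0..1} \<Longrightarrow> t \<in> {0..1} \<Longrightarrow> dist t s < \<eta> \<Longrightarrow> dist (\<gamma> t) (\<gamma> s) < \<epsilon>"
    unfolding uniformly_continuous_on_def using \<open>\<epsilon> > 0\<close> by meson
  show "\<exists>\<eta>>0. \<forall>s r t. 0 \<le> s \<longrightarrow> s \<le> r \<longrightarrow> r \<le> t \<longrightarrow> t \<le> 1 \<longrightarrow> t - s < \<eta> \<longrightarrow>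
      ennreal \<bar>cost (\<gamma> s) / N - cost (\<gamma> t) / N\<bar> \<le> ennreal (h (bdist (\<gamma> r)) / N) * ennreal (dist (\<gamma> s) (\<gamma> t))"
  proof (intro exI[of _ \<eta>] conjI allI impI \<eta>(1))
    fix s r t :: real assume st: "0 \<le> s" "s \<le> r" "r \<le> t" "t \<le> 1" "t - s < \<eta>"
    have "\<bar>cost (\<gamma> s) - cost (\<gamma> t)\<bar> \<le> h (bdist (\<gamma> r)) * dist (\<gamma> s) (\<gamma> t)"
    proof (rule cost_local)
      show "\<gamma> r \<in> \<Omega>" using \<gamma>(2) st by (auto simp: image_subset_iff)
      show "dist (\<gamma> r) (\<gamma> s) < bdist (\<gamma> r) / (8 * C)"
        using \<eta>(2)[of s r] \<epsilon>[of r] st by (auto simp: dist_real_def)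
      show "dist (\<gamma> r) (\<gamma> t) < bdist (\<gamma> r) / (8 * C)"
        using \<eta>(2)[of t r] \<epsilon>[of r] st by (auto simp: dist_real_def)
    qed
    then have "\<bar>cost (\<gamma> s) / N - cost (\<gamma> t) / N\<bar> \<le> h (bdist (\<gamma> r)) / N * dist (\<gamma> s) (\<gamma> t)"
      using N by (simp add: divide_right_mono flip: diff_divide_distrib)
    then have "ennreal \<bar>cost (\<gamma> s) / N - cost (\<gamma> t) / N\<bar> \<le> ennreal (h (bdist (\<gamma> r)) / N * dist (\<gamma> s) (\<gamma> t))"
      by (rule ennreal_leI)
    also have "\<dots> = ennreal (h (bdist (\<gamma> r)) / N) * ennreal (dist (\<gamma> s) (\<gamma> t))"
      using h_nonneg[of "bdist (\<gamma> r)"] N by (intro ennreal_mult) auto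
    finally show "ennreal \<bar>cost (\<gamma> s) / N - cost (\<gamma> t) / N\<bar> \<le> ennreal (h (bdist (\<gamma> r)) / N) * ennreal (dist (\<gamma> s) (\<gamma> t))" .
  qed
qed

text \<open>Cost below \<open>N\<close> yields curves to the points \<open>y n\<close> of length at
  most \<open>C * N\<close>, on which each stay within \<open>r\<close> of the complement lasts at
  most \<open>C * N / h (4 * r)\<close>. As \<open>h\<close> is unbounded, this drops below any
  \<delta>, which is the visiting condition of \<open>rect_accessible_limit\<close>.\<close>

lemma cost_accessible:
  assumes unbounded: "\<And>B. \<exists>r>0. B < h r"
    and e: "e \<in> prime_ends \<Omega>" and Ee: "E \<in> e" and y: "\<And>n. y n \<in> E n" "\<And>n. cost (y n) < N"
  shows "e \<in> rect_accessible_prime_ends \<Omega>"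
proof -
  define P where "P n T c \<longleftrightarrow> 0 \<le> T \<and> T \<le> C * N \<and> 1-lipschitz_on {0..T} c \<and> c ` {0..T} \<subseteq> \<Omega> \<and> c 0 = x0 \<and> c T = y n \<and>
    (\<forall>r s s'. 0 < r \<longrightarrow> 0 \<le> s \<longrightarrow> s \<le> s' \<longrightarrow> s' \<le> T \<longrightarrow> (\<forall>t\<in>{s<..<s'}. bdist (c t) < r) \<longrightarrow>
       s' - s \<le> C * N / h (4 * r))" for n T c
  have "\<exists>T c. P n T c" for n
  proof -
    obtain a where a: "a < N" "weighted_chain step_size (\<lambda>y. h (2 * bdist y)) x0 (y n) a"
      using y(2)[of n] truncated_cost_less_chain[of "\<lambda>y. h (2 * bdist y)" N step_size x0 "y n" N] h_nonneg N
      unfolding cost_def by auto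
    have mono: "C * a \<le> C * N" "C * a / h r \<le> C * N / h r" for r
      using a(1) C h_nonneg[of r] by (auto intro!: divide_right_mono)
    obtain T c where "0 \<le> T" "T \<le> C * a" "1-lipschitz_on {0..T} c" "c ` {0..T} \<subseteq> \<Omega>" "c 0 = x0" "c T = y n"
      and slow: "\<And>r s s'. 0 < r \<Longrightarrow> 0 \<le> s \<Longrightarrow> s \<le> s' \<Longrightarrow> s' \<le> T \<Longrightarrow> (\<forall>t\<in>{s<..<s'}. bdist (c t) < r) \<Longrightarrow>
       s' - s \<le> C * a / h (4 * r)"
      using weighted_chain_curve[OF h1 anti x0 a(2)] by blast
    then have "P n T c" unfolding P_def using mono(1) order_trans[OF slow mono(2)] by auto
    then show ?thesis by blast
  qed
  then obtain T c where "\<And>n. P n (T n) (c n)" by metis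
  then have T: "\<And>n. 0 \<le> T n" "\<And>n. T n \<le> C * N"
    and c: "\<And>n. 1-lipschitz_on {0..T n} (c n)" "\<And>n. c n ` {0..T n} \<subseteq> \<Omega>" "\<And>n. c n 0 = x0"
      "\<And>n. c n (T n) = y n"
    and slow: "\<And>n r s s'. 0 < r \<Longrightarrow> 0 \<le> s \<Longrightarrow> s \<le> s' \<Longrightarrow> s' \<le> T n \<Longrightarrow> (\<forall>t\<in>{s<..<s'}. bdist (c n t) < r) \<Longrightarrow>
       s' - s \<le> C * N / h (4 * r)"
    unfolding P_def by (simp_all only:)
  show ?thesis
  proof (rule rect_accessible_limit[OF e Ee T c(1,2,3)])
    show "c n (T n) \<in> E n" for n using c(4) y(1) by simp
    fix \<delta> :: real assume "\<delta> > 0"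
    obtain r where r: "r > 0" "C * N / \<delta> < h r" using unbounded by blast
    have "C * N / h r < \<delta>" using r(2) h1[of r] \<open>\<delta> > 0\<close> by (simp add: field_simps)
    show "\<exists>r>0. \<forall>n s s'. 0 \<le> s \<longrightarrow> s + \<delta> \<le> s' \<longrightarrow> s' \<le> T n \<longrightarrow> (\<exists>t\<in>{s<..<s'}. r \<le> bdist (c n t))"
    \<comment> \<open>Dividing by 4 compensates the factor 4 in \<open>slow\<close>.\<close>
    proof (intro exI[of _ "r / 4"] conjI allI impI)
      fix n s s' assume s: "0 \<le> s" "s + \<delta> \<le> s'" "s' \<le> T n"
      show "\<exists>t\<in>{s<..<s'}. r / 4 \<le> bdist (c n t)"
      proof (rule ccontr)
        assume "\<not> ?thesis"
        then have "\<forall>t\<in>{s<..<s'}. bdist (c n t) < r / 4" by (simp add: not_le)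
        then have "s' - s \<le> C * N / h (4 * (r / 4))"
          using r(1) s \<open>\<delta> > 0\<close> by (intro slow) auto
        then show False using \<open>C * N / h r < \<delta>\<close> s(2) by simp
      qed
    qed (use r in auto)
  qed
qed

text \<open>If the lower limit were below 1, every \<open>interior (E n)\<close> would contain a
  point of cost below \<open>N\<close>, and \<open>cost_accessible\<close> would make the end
  accessible. Interiors appear because the neighbourhood filter is generated by open sets.\<close>

lemma cost_liminf:
  assumes unbounded: "\<And>B. \<exists>r>0. B < h r"
    and e: "e \<in> prime_ends \<Omega> - rect_accessible_prime_ends \<Omega>"
  shows "1 \<le> Liminf (pe_nhds \<Omega> e) (\<lambda>y. ereal (cost y / N))"
  unfolding le_Liminf_iff
proof (intro allI impI)
  fix b :: ereal assume "b < 1"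
  then obtain a where a: "b < ereal a" "a < 1"
    by (metis ereal_dense2 ereal_less(3) less_ereal.simps(1) one_ereal_def)
  have "e \<in> pe_ends \<Omega>" using e by (simp add: prime_ends_def)
  then obtain E where E: "pe_chain \<Omega> E" and "e = {F. pe_chain \<Omega> F \<and> chain_equiv E F}"
    unfolding pe_ends_def by blast
  then have Ee: "E \<in> e" by (simp add: chain_equiv_def chain_divides_refl)
  have "\<exists>n. \<forall>y\<in>interior (E n). a < cost y / N"
  proof (rule ccontr)
    assume "\<not> ?thesis"
    then have "\<forall>n. \<exists>y. y \<in> interior (E n) \<and> cost y / N \<le> a" by (meson not_less)
    then obtain y where y: "\<And>n. y n \<in> interior (E n)" "\<And>n. cost (y n) / N \<le> a" by metis
    have "y n \<in> E n" for n using y(1)[of n] interior_subset by blast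
    moreover have "cost (y n) < N" for n
      using order_le_less_trans[OF y(2)[of n] a(2)] N by simp
    ultimately show False using cost_accessible[OF unbounded _ Ee] e by blast
  qed
  then obtain n where n: "\<forall>y\<in>interior (E n). a < cost y / N" by blast
  have acc: "E k \<subseteq> \<Omega>" for k using E by (auto simp: pe_chain_def acceptable_def)
  have "E (Suc n) \<subseteq> interior (E n)"
    using chain_interior[OF E, of n] acc[of "Suc n"] closure_subset[of "E (Suc n)"] by blast
  then have "pe_nhds \<Omega> e \<le> principal (interior (E n))"
    unfolding pe_nhds_def using Ee acc[of n] interior_subset[of "E n"]
    by (intro INF_lower) auto
  moreover have "eventually (\<lambda>y. b < ereal (cost y / N)) (principal (interior (E n)))"
    unfolding eventually_principal using n a(1) by (auto intro: less_trans)
  ultimately show "eventually (\<lambda>y. b < ereal (cost y / N)) (pe_nhds \<Omega> e)"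
    by (rule filter_leD)
qed

end

end

section \<open>A p-integrable weight that is unbounded at the boundary\<close>

lemma max_one_powr_inverse_powr:
  fixes a p :: real
  assumes "1 < p" "1 \<le> a"
  shows "(max 1 (a powr (1/p))) powr p = a"
proof -
  have "1 \<le> a powr (1/p)" using assms by (intro ge_one_powr_ge_zero) auto
  then show ?thesis using assms by (simp add: max_absorb2 powr_powr)
qed

text \<open>The weight satisfies \<open>h r powr p = 1 + card {j. r < \<rho> j}\<close>, where \<open>\<rho> j\<close> is chosen so small that
  the boundary strip of width \<open>\<rho> j\<close> has measure at most \<open>1 / 2 ^ j\<close>.\<close>

lemma boundary_weight_exists:
  fixes \<mu> :: "'a::metric_space measure" and \<Omega> :: "'a set"
  assumes borel: "sets \<mu> = sets borel" and \<Omega>: "open \<Omega>" "\<Omega> \<noteq> UNIV" and fin: "emeasure \<mu> \<Omega> < \<infinity>" and p: "1 < p"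
  obtains h :: "real \<Rightarrow> real" where "h \<in> borel_measurable borel" "\<And>r. 1 \<le> h r"
    "\<And>r r'. 0 < r \<Longrightarrow> r \<le> r' \<Longrightarrow> h r' \<le> h r" "\<And>B. \<exists>r>0. B < h r"
    "(\<integral>\<^sup>+x\<in>\<Omega>. ennreal (h (infdist x (- \<Omega>)) powr p) \<partial>\<mu>) < \<infinity>"
proof -
  let ?d = "\<lambda>x. infdist x (- \<Omega>)"
  have [measurable]: "?d \<in> borel_measurable \<mu>"
    unfolding measurable_cong_sets[OF borel refl]
    by (intro borel_measurable_continuous_onI continuous_intros)
  have [measurable]: "\<Omega> \<in> sets \<mu>" using \<Omega> borel by auto
  have space: "space \<mu> = UNIV" using sets_eq_imp_space_eq[OF borel] by simp
  have pos: "0 < ?d x" if "x \<in> \<Omega>" for x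
  proof -
    have "closed (- \<Omega>)" "- \<Omega> \<noteq> {}" using \<Omega> by auto
    then show ?thesis using in_closed_iff_infdist_zero[of "- \<Omega>" x] infdist_nonneg[of x "- \<Omega>"] that by auto
  qed
  define A where "A n = {x \<in> \<Omega>. ?d x < 1 / real (Suc n)}" for n
  have [measurable]: "A n \<in> sets \<mu>" for n
  proof -
    have "A n = {x \<in> space \<mu>. x \<in> \<Omega> \<and> ?d x < 1 / real (Suc n)}" by (auto simp: A_def space)
    also have "\<dots> \<in> sets \<mu>" by measurable
    finally show ?thesis .
  qed
  have "(\<lambda>n. emeasure \<mu> (A n)) \<longlonglongrightarrow> emeasure \<mu> (\<Inter>n. A n)"
  proof (rule Lim_emeasure_decseq)
    show "range A \<subseteq> sets \<mu>" by auto
    have "1 / real (Suc n) \<le> 1 / real (Suc m)" if "m \<le> n" for m n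
      using that by (simp add: frac_le)
    then show "decseq A" unfolding decseq_def A_def by (force intro: order_less_le_trans)
    show "emeasure \<mu> (A n) \<noteq> \<infinity>" for n
      using emeasure_mono[of "A n" \<Omega> \<mu>] fin by (auto simp: A_def less_top top_unique)
  qed
  moreover have "(\<Inter>n. A n) = {}"
  proof -
    have "x \<notin> (\<Inter>n. A n)" for x
    proof (cases "x \<in> \<Omega>")
      case True
      obtain n where "1 / real (Suc n) < ?d x" by (rule nat_approx_posE[OF pos[OF True]])
      then have "x \<notin> A n" by (simp add: A_def)
      then show ?thesis by blast
    qed (simp add: A_def)
    then show ?thesis by blast
  qed
  ultimately have lim: "(\<lambda>n. emeasure \<mu> (A n)) \<longlonglongrightarrow> 0" by simp
  have "\<exists>n\<ge>j. emeasure \<mu> (A n) < ennreal ((1/2)^j)" for j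
  proof -
    have "\<forall>\<^sub>F n in sequentially. emeasure \<mu> (A n) < ennreal ((1/2)^j)"
      using order_tendstoD(2)[OF lim] by simp
    then show ?thesis unfolding eventually_sequentially by (meson le_cases)
  qed
  \<comment> \<open>The condition \<open>n j >= j\<close> forces \<open>\<rho> j\<close> to tend to
    0, which makes the counting function \<open>H\<close> finite at positive arguments.\<close>
  then obtain n where n: "\<And>j. n j \<ge> j" "\<And>j. emeasure \<mu> (A (n j)) < ennreal ((1/2)^j)" by metis
  define \<rho> where "\<rho> j = 1 / real (Suc (n j))" for j
  have \<rho>: "0 < \<rho> j" "\<rho> j \<le> 1 / real (Suc j)" for j
    using n(1)[of j] by (auto simp: \<rho>_def frac_le)
  define H where "H r = (\<Sum>j. indicator {..<\<rho> j} r :: ennreal)" for r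
  have H_fin: "H r < \<infinity>" if "r > 0" for r
  proof -
    obtain J where J: "1 / real (Suc J) < r" by (rule nat_approx_posE[OF \<open>r > 0\<close>])
    have "indicator {..<\<rho> j} r = (0::ennreal)" if "j \<notin> {..<J}" for j
    proof -
      have "1 / real (Suc j) \<le> 1 / real (Suc J)" using that by (simp add: frac_le)
      then show ?thesis using \<rho>(2)[of j] J by simp
    qed
    then have "H r = (\<Sum>j<J. indicator {..<\<rho> j} r)"
      unfolding H_def by (intro suminf_finite) auto
    also have "\<dots> \<le> (\<Sum>j<J. 1)" by (intro sum_mono) (simp add: indicator_def)
    also have "\<dots> < \<infinity>" by (simp add: of_nat_less_top)
    finally show ?thesis .
  qed
  have H_anti: "H r' \<le> H r" if "r \<le> r'" for r r'
    unfolding H_def using that by (intro suminf_le) (auto simp: indicator_def)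
  define a where "a r = enn2real (1 + H r)" for r
  have a_eq: "ennreal (a r) = 1 + H r" if "r > 0" for r
    using H_fin[OF that] by (simp add: a_def less_top ennreal_enn2real)
  have a1: "1 \<le> a r" if "r > 0" for r
  proof -
    have "ennreal 1 \<le> ennreal (a r)" using a_eq[OF that] by simp
    then show ?thesis by (subst (asm) ennreal_le_iff) (auto simp: a_def)
  qed
  have a_anti: "a r' \<le> a r" if "0 < r" "r \<le> r'" for r r'
    unfolding a_def using H_anti[OF that(2)] H_fin[OF that(1)]
    by (intro enn2real_mono) (auto simp: less_top intro: add_left_mono)
  \<comment> \<open>The maximum matters for \<open>r <= 0\<close>: there \<open>H r\<close> is
    infinite, \<open>a r\<close> is 0 by default, and \<open>h r\<close> becomes 1. At positive
    \<open>r\<close> it changes nothing.\<close>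
  define h where "h r = max 1 (a r powr (1/p))" for r
  have [measurable]: "H \<in> borel_measurable borel" unfolding H_def by measurable
  have h_meas [measurable]: "h \<in> borel_measurable borel" unfolding h_def a_def by measurable
  have h1: "1 \<le> h r" for r by (simp add: h_def)
  have h_anti: "h r' \<le> h r" if "0 < r" "r \<le> r'" for r r'
    unfolding h_def using a_anti[OF that] a1[of r'] that p
    by (intro max.mono powr_mono2) auto
  have h_unbounded: "\<exists>r>0. B < h r" for B
  proof -
    obtain J :: nat where J: "\<bar>B\<bar> powr p < real J" using reals_Archimedean2 by blast
    define r where "r = Min (\<rho> ` {..J}) / 2"
    have Min_pos: "0 < Min (\<rho> ` {..J})" using \<rho>(1) by (subst Min_gr_iff) auto
    then have r: "0 < r" by (simp add: r_def)
    have r_less: "r < \<rho> j" if "j \<le> J" for j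
    proof -
      have "Min (\<rho> ` {..J}) \<le> \<rho> j" using that by (intro Min_le) auto
      then show ?thesis using Min_pos unfolding r_def by linarith
    qed
    have "ennreal (real J) = (\<Sum>j<J. indicator {..<\<rho> j} r)"
      using r_less by (simp add: ennreal_of_nat_eq_real_of_nat[symmetric])
    also have "\<dots> \<le> H r" unfolding H_def by (intro sum_le_suminf) auto
    also have "\<dots> \<le> ennreal (a r)" unfolding a_eq[OF r] by simp
    finally have "real J \<le> a r" using a1[OF r] by (subst (asm) ennreal_le_iff) auto
    then have "\<bar>B\<bar> powr p < a r" using J by simp
    then have "(\<bar>B\<bar> powr p) powr (1/p) < a r powr (1/p)" using p by (intro powr_less_mono2) auto
    then have "\<bar>B\<bar> < a r powr (1/p)" using p by (simp add: powr_powr)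
    then show ?thesis using r by (intro exI[of _ r]) (auto simp: h_def)
  qed
  have "(\<integral>\<^sup>+x\<in>\<Omega>. ennreal (h (?d x) powr p) \<partial>\<mu>) = (\<integral>\<^sup>+x. (indicator \<Omega> x + (\<Sum>j. indicator (A (n j)) x)) \<partial>\<mu>)"
  proof (rule nn_integral_cong)
    fix x
    show "ennreal (h (?d x) powr p) * indicator \<Omega> x = indicator \<Omega> x + (\<Sum>j. indicator (A (n j)) x)"
    proof (cases "x \<in> \<Omega>")
      case True
      have "ennreal (h (?d x) powr p) = 1 + H (?d x)"
        unfolding h_def using max_one_powr_inverse_powr[OF p a1[OF pos[OF True]]] a_eq[OF pos[OF True]] by simp
      moreover have "indicator {..<\<rho> j} (?d x) = (indicator (A (n j)) x :: ennreal)" for j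
        using True by (simp add: A_def \<rho>_def indicator_def)
      ultimately show ?thesis using True by (simp add: H_def)
    qed (simp add: A_def)
  qed
  \<comment> \<open>Integrating the counting function term by term gives the measures of the strips,
    which the choice of \<open>n j\<close> makes summable.\<close>
  also have "\<dots> = emeasure \<mu> \<Omega> + (\<Sum>j. emeasure \<mu> (A (n j)))"
    by (subst nn_integral_add, simp, simp, subst nn_integral_suminf) auto
  also have "\<dots> \<le> emeasure \<mu> \<Omega> + (\<Sum>j. ennreal ((1/2)^j))"
    using n(2) by (intro add_left_mono suminf_le) (auto intro: less_imp_le)
  also have "(\<Sum>j. ennreal ((1/2)^j)) = ennreal (\<Sum>j. (1/2)^j)"
    by (intro suminf_ennreal2 summable_geometric) auto
  also have "emeasure \<mu> \<Omega> + ennreal (\<Sum>j. (1/2)^j) < \<infinity>" using fin by simp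
  finally show ?thesis using that[OF h_meas h1 h_anti h_unbounded] by blast
qed

section \<open>The test functions and the vanishing of the capacity\<close>

theorem theorem3p3:
  fixes \<mu> :: "'a::complete_space measure" and p :: real and \<Omega> :: "'a set"
  assumes "1 < p"
    and "doubling_measure \<mu>"
    and "poincare p \<mu>"
    and "open \<Omega>" and "connected \<Omega>" and "\<Omega> \<noteq> {}" and "bounded \<Omega>" and "\<Omega> \<noteq> UNIV"
    and "sobolev_cap p \<mu> (UNIV - \<Omega>) > 0"
    and "ends_chains_bounded \<Omega>"
  shows "pe_cap p \<mu> \<Omega> (prime_ends \<Omega> - rect_accessible_prime_ends \<Omega>) = 0"
proof -
  have borel: "sets \<mu> = sets borel" using assms(2) by (simp add: doubling_measure_def)
  have [measurable]: "\<Omega> \<in> sets \<mu>" using assms(4) borel by auto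
  obtain C where C: "C \<ge> 1" "\<And>x y :: 'a. \<exists>c. 1-lipschitz_on {0..C * dist x y} c \<and> c 0 = x \<and> c (C * dist x y) = y"
    using poincare_quasiconvex[OF assms(2,3)] by blast
  interpret bounded_domain \<Omega> C
  proof
    show "lip_path UNIV (C * dist x y) x y" for x y :: 'a
      unfolding lip_path_def using C by auto
  qed (use C assms doubling_compact[OF assms(2)] in auto)
  obtain x0 where x0: "x0 \<in> \<Omega>" using assms(6) by blast
  obtain R where "\<Omega> \<subseteq> ball x0 R" using assms(7) bounded_subset_ballD by blast
  then have fin: "emeasure \<mu> \<Omega> < \<infinity>"
    using doubling_measureE[OF assms(2)] borel
    by (metis emeasure_mono borel_open open_ball order_le_less_trans)
  obtain h :: "real \<Rightarrow> real" where h: "h \<in> borel_measurable borel" "\<And>r. 1 \<le> h r"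
    "\<And>r r'. 0 < r \<Longrightarrow> r \<le> r' \<Longrightarrow> h r' \<le> h r" "\<And>B. \<exists>r>0. B < h r"
    "(\<integral>\<^sup>+x\<in>\<Omega>. ennreal (h (bdist x) powr p) \<partial>\<mu>) < \<infinity>"
    using boundary_weight_exists[OF borel assms(4,8) fin assms(1)] by blast
  have [measurable]: "h \<in> borel_measurable borel" by (rule h(1))
  have [measurable]: "bdist \<in> borel_measurable \<mu>"
    unfolding measurable_cong_sets[OF borel refl]
    by (intro borel_measurable_continuous_onI continuous_intros)
  define N where "N n = real (Suc n)" for n
  have N: "N n > 0" for n by (simp add: N_def)
  define u where "u n x = cost h x0 (N n) x / N n" for n x
  have u: "0 \<le> u n x" "u n x \<le> 1" for n x
    using cost_bounds[of h x0 "N n" x, OF h(2,3) x0 N] N[of n] by (auto simp: u_def)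
  have u_meas: "(\<lambda>x. u n x * indicator \<Omega> x) \<in> borel_measurable \<mu>" for n
  proof -
    have "continuous_on \<Omega> (u n)"
      unfolding u_def using N[of n] by (intro continuous_intros continuous_on_cost[of h x0 "N n", OF h(2,3) x0 N]) auto
    then have "(\<lambda>x. indicator \<Omega> x *\<^sub>R u n x) \<in> borel_measurable borel"
      using assms(4) by (intro borel_measurable_continuous_on_indicator) auto
    then show ?thesis unfolding measurable_cong_sets[OF borel refl] by (simp add: mult.commute)
  qed
  \<comment> \<open>The function part \<open>a n\<close> tends to 0 by dominated convergence; the
    gradient part \<open>b n\<close> is \<open>(1 / N n) powr p\<close> times one fixed finite
    integral.\<close>
  define a where "a n = (\<integral>\<^sup>+x\<in>\<Omega>. ennreal (\<bar>u n x\<bar> powr p) \<partial>\<mu>)" for n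
  define b where "b n = (\<integral>\<^sup>+x\<in>\<Omega>. ennreal ((h (bdist x) / N n) powr p) \<partial>\<mu>)" for n
  have norm_le: "N1p_normp p \<mu> \<Omega> (u n) \<le> a n + b n" for n
    unfolding N1p_normp_def nn_integral_completion a_def[symmetric]
  proof (rule add_left_mono)
    have ug: "upper_gradient \<Omega> (u n) (\<lambda>x. ennreal (h (bdist x) / N n))"
      unfolding u_def by (rule upper_gradient_cost[of h x0 "N n", OF h(2,3) x0 N h(1)])
    have eq: "epow (ennreal (h (bdist x) / N n)) p = ennreal ((h (bdist x) / N n) powr p)" for x
      using h(2)[of "bdist x"] N[of n] by (simp add: epow_def)
    show "(INF g\<in>{g. upper_gradient \<Omega> (u n) g}. \<integral>\<^sup>+x\<in>\<Omega>. epow (g x) p \<partial>\<mu>) \<le> b n"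
      unfolding b_def eq[symmetric] by (rule INF_lower) (use ug in simp)
  qed
  have b_eq: "b n = ennreal ((1 / N n) powr p) * (\<integral>\<^sup>+x\<in>\<Omega>. ennreal (h (bdist x) powr p) \<partial>\<mu>)" for n
  proof -
    have "ennreal ((h (bdist x) / N n) powr p) * indicator \<Omega> x =
        ennreal ((1 / N n) powr p) * (ennreal (h (bdist x) powr p) * indicator \<Omega> x)" for x
    proof -
      have "(h (bdist x) / N n) powr p = (1 / N n) powr p * h (bdist x) powr p"
        using h(2)[of "bdist x"] N[of n] powr_mult[of "1 / N n" "h (bdist x)" p] by simp
      then show ?thesis by (simp add: ennreal_mult mult.assoc)
    qed
    then show ?thesis unfolding b_def by (simp add: nn_integral_cmult)
  qed
  have inv_lim: "(\<lambda>n. k / N n) \<longlonglongrightarrow> 0" for k :: real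
    unfolding N_def using LIMSEQ_Suc[OF lim_const_over_n] by blast
  have powr_lim: "(\<lambda>n. f n powr p) \<longlonglongrightarrow> 0" if "f \<longlonglongrightarrow> 0" "\<And>n. 0 \<le> f n" for f :: "nat \<Rightarrow> real"
    using tendsto_powr'[OF that(1) tendsto_const, of p] assms(1) that(2) by simp
  have b_lim: "b \<longlonglongrightarrow> 0"
  proof -
    define i where "i = enn2real (\<integral>\<^sup>+x\<in>\<Omega>. ennreal (h (bdist x) powr p) \<partial>\<mu>)"
    have "b = (\<lambda>n. ennreal ((1 / N n) powr p * i))"
      unfolding b_eq[abs_def] using h(5) by (simp add: i_def ennreal_mult less_top)
    moreover have "(\<lambda>n. ennreal ((1 / N n) powr p * i)) \<longlonglongrightarrow> ennreal 0"
      using powr_lim[OF inv_lim[of 1]] N by (intro tendsto_ennrealI tendsto_mult_left_zero) (auto simp: less_imp_le)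
    ultimately show ?thesis by simp
  qed
  have a_lim: "a \<longlonglongrightarrow> 0"
  proof -
    have "a \<longlonglongrightarrow> (\<integral>\<^sup>+x. 0 \<partial>\<mu>)"
      unfolding a_def[abs_def]
    proof (rule nn_integral_dominated_convergence)
      show "(\<lambda>x. ennreal (\<bar>u n x\<bar> powr p) * indicator \<Omega> x) \<in> borel_measurable \<mu>" for n
      proof -
        have "(\<lambda>x. ennreal (\<bar>u n x * indicator \<Omega> x\<bar> powr p)) \<in> borel_measurable \<mu>"
          using u_meas[of n] by measurable
        also have "(\<lambda>x. ennreal (\<bar>u n x * indicator \<Omega> x\<bar> powr p)) = (\<lambda>x. ennreal (\<bar>u n x\<bar> powr p) * indicator \<Omega> x)"
          by (auto simp: indicator_def)
        finally show ?thesis .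
      qed
      show "AE x in \<mu>. ennreal (\<bar>u n x\<bar> powr p) * indicator \<Omega> x \<le> indicator \<Omega> x" for n
        using u[of n] assms(1) by (intro AE_I2) (auto simp: indicator_def powr_le1)
      show "AE x in \<mu>. (\<lambda>n. ennreal (\<bar>u n x\<bar> powr p) * indicator \<Omega> x) \<longlonglongrightarrow> 0"
      proof (rule AE_I2)
        fix x
        show "(\<lambda>n. ennreal (\<bar>u n x\<bar> powr p) * indicator \<Omega> x) \<longlonglongrightarrow> 0"
        proof (cases "x \<in> \<Omega>")
          case True
          \<comment> \<open>The cost \<open>k\<close> of one chain to \<open>x\<close> does not
            depend on \<open>n\<close>, so \<open>u n x\<close> is at most
            \<open>k / N n\<close>.\<close>
          obtain k where k: "weighted_chain step_size (\<lambda>y. h (2 * bdist y)) x0 x k"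
            using weighted_chain_reaches[OF x0 True] by blast
          have "u n x \<le> k / N n" for n
            unfolding u_def using cost_le_chain[of h x0 "N n", OF h(2,3) x0 N k] N[of n]
            by (intro divide_right_mono) auto
          then have "(\<lambda>n. u n x) \<longlonglongrightarrow> 0"
            using u(1) by (intro tendsto_sandwich[OF _ _ tendsto_const inv_lim[of k]]) auto
          then have "(\<lambda>n. ennreal (u n x powr p)) \<longlonglongrightarrow> ennreal 0"
            using u(1) by (intro tendsto_ennrealI powr_lim) auto
          then show ?thesis using True u(1) by simp
        qed simp
      qed
      show "(\<integral>\<^sup>+x. indicator \<Omega> x \<partial>\<mu>) < \<infinity>" using fin by simp
    qed simp_all
    then show ?thesis by simp
  qed
  have ab_fin: "a n + b n < \<infinity>" for n
  proof -
    have "a n \<le> (\<integral>\<^sup>+x. indicator \<Omega> x \<partial>\<mu>)"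
      unfolding a_def using u[of n] assms(1)
      by (intro nn_integral_mono) (auto simp: indicator_def powr_le1)
    also have "\<dots> < \<infinity>" using fin by simp
    finally have "a n < \<infinity>" .
    moreover have "b n < \<infinity>" unfolding b_eq using h(5) by (simp add: ennreal_mult_less_top)
    ultimately show ?thesis by simp
  qed
  have "pe_cap p \<mu> \<Omega> (prime_ends \<Omega> - rect_accessible_prime_ends \<Omega>) \<le> a n + b n" for n
  proof -
    have "in_N1p p \<mu> \<Omega> (u n)"
      unfolding in_N1p_def using norm_le[of n] ab_fin[of n]
      by (auto intro: measurable_completion[OF u_meas] order_le_less_trans)
    moreover have "1 \<le> Liminf (pe_nhds \<Omega> e) (\<lambda>y. ereal (u n y))"
      if "e \<in> prime_ends \<Omega> - rect_accessible_prime_ends \<Omega>" for e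
      unfolding u_def by (rule cost_liminf[of h x0 "N n", OF h(2,3) x0 N h(4) that])
    ultimately have "pe_cap p \<mu> \<Omega> (prime_ends \<Omega> - rect_accessible_prime_ends \<Omega>) \<le> N1p_normp p \<mu> \<Omega> (u n)"
      unfolding pe_cap_def by (intro INF_lower) blast
    then show ?thesis using norm_le[of n] by (rule order_trans)
  qed
  moreover have "(\<lambda>n. a n + b n) \<longlonglongrightarrow> 0 + 0" by (intro tendsto_add a_lim b_lim)
  ultimately have "pe_cap p \<mu> \<Omega> (prime_ends \<Omega> - rect_accessible_prime_ends \<Omega>) \<le> 0"
    by (intro LIMSEQ_le_const) auto
  then show ?thesis by simp
qed

end
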